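(* Let $E$ be a Hermite–Biehler function with no real zeros such that $z\mapsto E(iz)$ is real entire. Let $\mathcal{H}(E)$ be the associated de Branges space with reproducing kernel $K$. Let $A:=\frac12(E+E^* )$ and let $\xi_0$ be the smallest positive real zero of $A$. Then \[ \inf_{F \in \mathcal{H}(E),\ F\neq 0} \frac{\|z \, F\|_{\mathcal{H}(E)}}{\|F\|_{\mathcal{H}(E)}} = \xi_0, \] and the functions attaining this infimum are exactly $\mathfrak{F}(z) = c\big( K(\xi_0, z) + K(\xi_0, -z)\big)$ with $c \in \mathbb{C}\setminus\{0\}$.
   Context: For an entire function $F$, $F^*(z):=\overline{F(\overline{z})}$; $F$ is real entire if it is real on $\mathbb{R}$. An entire $E$ is Hermite–Biehler if $|E(\overline{z})|<|E(z)|$ for all $z$ with $\mathrm{Im}\,z>0$. The de Branges space $\mathcal{H}(E)$ is the space of entire $F$ with $\|F\|^2_{\mathcal{H}(E)}:=\int_{\mathbb{R}}|F(x)|^2|E(x)|^{-2}dx<\infty$ such that $F/E$ and $F^*/E$ have bounded type (quotient of two bounded analytic functions) and non-positive mean type ($\limsup_{y\to\infty}y^{-1}\log|h(iy)|\le 0$) in the upper half-plane; it is a Hilbert space with inner product $\int F\overline{G}|E|^{-2}dx$ and reproducing kernel given by $2\pi i(\overline{w}-z)K(w,z)=E(z)E^*(\overline{w})-E^*(z)E(\overline{w})$. In the ratio, $\|zF\|_{\mathcal{H}(E)}$ denotes $(\int_{\mathbb{R}}|xF(x)|^2|E(x)|^{-2}dx)^{1/2}$, possibly $+\infty$. *)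

theory Defs
  imports "HOL-Complex_Analysis.Complex_Analysis"
begin

definition star_fun :: "(complex \<Rightarrow> complex) \<Rightarrow> complex \<Rightarrow> complex" where
  "star_fun F z = cnj (F (cnj z))"

definition entire :: "(complex \<Rightarrow> complex) \<Rightarrow> bool" where
  "entire F \<longleftrightarrow> F holomorphic_on UNIV"

definition real_entire :: "(complex \<Rightarrow> complex) \<Rightarrow> bool" where
  "real_entire F \<longleftrightarrow> entire F \<and> (\<forall>x::real. F (complex_of_real x) \<in> \<real>)"

definition hermite_biehler :: "(complex \<Rightarrow> complex) \<Rightarrow> bool" where
  "hermite_biehler E \<longleftrightarrow> entire E \<and> (\<forall>z. Im z > 0 \<longrightarrow> norm (E (cnj z)) < norm (E z))"

definition UHP :: "complex set" where
  "UHP = {z. Im z > 0}"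

definition bounded_type :: "(complex \<Rightarrow> complex) \<Rightarrow> bool" where
  "bounded_type h \<longleftrightarrow> (\<exists>f g. f holomorphic_on UHP \<and> g holomorphic_on UHP \<and>
      bounded (f ` UHP) \<and> bounded (g ` UHP) \<and> (\<exists>z\<in>UHP. g z \<noteq> 0) \<and>
      (\<forall>z\<in>UHP. h z * g z = f z))"

definition mean_type_nonpos :: "(complex \<Rightarrow> complex) \<Rightarrow> bool" where
  "mean_type_nonpos h \<longleftrightarrow>
     Limsup at_top (\<lambda>y::real. ereal (ln (norm (h (\<i> * complex_of_real y))) / y)) \<le> 0"

definition dB_normsq :: "(complex \<Rightarrow> complex) \<Rightarrow> (complex \<Rightarrow> complex) \<Rightarrow> ennreal" where
  "dB_normsq E F = (\<integral>\<^sup>+ x. ennreal ((norm (F (complex_of_real x)))\<^sup>2 / (norm (E (complex_of_real x)))\<^sup>2) \<partial>lborel)"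

definition dB_space :: "(complex \<Rightarrow> complex) \<Rightarrow> (complex \<Rightarrow> complex) set" where
  "dB_space E = {F. entire F \<and> dB_normsq E F < \<infinity> \<and>
      bounded_type (\<lambda>z. F z / E z) \<and> mean_type_nonpos (\<lambda>z. F z / E z) \<and>
      bounded_type (\<lambda>z. star_fun F z / E z) \<and> mean_type_nonpos (\<lambda>z. star_fun F z / E z)}"

definition dB_norm :: "(complex \<Rightarrow> complex) \<Rightarrow> (complex \<Rightarrow> complex) \<Rightarrow> ereal" where
  "dB_norm E F = (if dB_normsq E F = \<infinity> then \<infinity> else ereal (sqrt (enn2real (dB_normsq E F))))"

text \<open>Reproducing kernel: 2 pi i (cnj w - z) K(w,z) = E(z)E*(cnj w) - E*(z)E(cnj w);
  on the diagonal z = cnj w the value is the (continuous) limit.\<close>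
definition dB_kernel :: "(complex \<Rightarrow> complex) \<Rightarrow> complex \<Rightarrow> complex \<Rightarrow> complex" where
  "dB_kernel E w z =
     (if z \<noteq> cnj w then
        (E z * star_fun E (cnj w) - star_fun E z * E (cnj w)) / (2 * pi * \<i> * (cnj w - z))
      else
        (deriv (star_fun E) (cnj w) * E (cnj w) - deriv E (cnj w) * star_fun E (cnj w)) / (2 * pi * \<i>))"

definition dB_A :: "(complex \<Rightarrow> complex) \<Rightarrow> complex \<Rightarrow> complex" where
  "dB_A E z = (E z + star_fun E z) / 2"

end

theory Submission
  imports Defs "HOL-Probability.Sinc_Integral" "HOL-Real_Asymp.Real_Asymp"
begin

text \<open>
  Rotation invariance gives \<open>E\<^sup>*(z) = E(-z)\<close>, and the candidate extremal is a multiple of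
  \<open>\<phi> = A / (z\<^sup>2 - \<xi>\<^sup>2)\<close>. Put \<open>\<Theta> = E\<^sup>* / E\<close> and \<open>h = F / E\<close>. If \<open>x F\<close> has finite norm and \<open>p\<close> is a
  polynomial of degree at most 2, then \<open>p F F\<^sup>* / (E\<^sup>2 (1 + r \<Theta>))\<close> is analytic in the upper half-plane,
  of bounded type and non-positive mean type, and integrable on the real line, so its integral vanishes.
  Since \<open>F F\<^sup>* / E\<^sup>2 = |h|\<^sup>2 \<Theta>\<close> on the line, the real part of this says
  \<open>\<integral> p |h|\<^sup>2 = \<integral> p |h|\<^sup>2 P\<^sub>r\<close> with the Poisson kernel \<open>P\<^sub>r = (1 - r\<^sup>2) / |1 + r \<Theta>|\<^sup>2\<close>, which concentrates
  on the zeros of \<open>A\<close> as \<open>r\<close> tends to 1. With \<open>p = x\<^sup>2 - \<xi>\<^sup>2\<close> only \<open>|x| < \<xi>\<close> contributes negatively, and that part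
  tends to 0; this is the lower bound. The quadratic form is therefore positive semidefinite, and its
  null space is spanned by \<open>\<phi>\<close>: after subtracting a multiple of \<open>\<phi>\<close> one may assume \<open>F(\<xi>) = 0\<close>, and
  then \<open>p = (x + \<xi>)\<^sup>2\<close> gives \<open>\<integral> (x + \<xi>)\<^sup>2 |h|\<^sup>2 = 0\<close>.

  The vanishing of the integral replaces Nevanlinna factorization by a Phragmen-Lindelof argument: a quotient
  of bounded functions is at most \<open>exp (C (1 + |z|\<^sup>2) / Im z)\<close>, and a primitive of an integrable function
  is bounded on the real line.
\<close>

subsection \<open>Pointwise growth of functions of bounded type\<close>

text \<open>Stopping at r < 1 replaces the classical quadrature sum over the zeros of
  \<open>A\<close> by an integral. The price is that the concentration of \<open>P_r\<close> must be
  quantified, and this is done by comparison with \<open>\<phi>\<close>. The identity with p = 1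
  shows that the Poisson-weighted mass of |\<phi> / E|^2 is the same for every r, while
  multiplication by (x^2 - \<xi>^2)^2 turns that density into a multiple of \<open>P_r\<close> |A /
  E|^2, which is O(1 - r). Interpolating between the two bounds makes the negative part decay like
  the square root of 1 - r. The comparison requires \<open>\<phi>\<close> to have no zero on
  [-\<xi>, \<xi>]: in the interior this is the minimality of \<xi>, at the end points the simplicity
  of the zero of \<open>A\<close>. Degree 2 is the limit for p because finite norms of F and x F
  mean exactly that (1 + x^2) |h|^2 is integrable.\<close>

lemma Schwarz_Lemma_le:
  assumes "f holomorphic_on ball 0 1" "f 0 = 0" "\<And>z. norm z < 1 \<Longrightarrow> norm (f z) \<le> 1"
    and "norm z < 1"
  shows "norm (f z) \<le> norm z"
\<comment> \<open>The strict Schwarz lemma applies to \<open>t * f\<close>, whose modulus is below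
  1; then t tends to 1.\<close>
proof (rule field_le_mult_one_interval)
  fix t :: real assume t: "0 < t" "t < 1"
  have "norm (complex_of_real t * f w) < 1" if "norm w < 1" for w
  proof -
    have "t * norm (f w) \<le> t * 1" using assms(3)[OF that] t by (intro mult_left_mono) auto
    then have "t * norm (f w) < 1" using t by linarith
    then show ?thesis using t by (simp add: norm_mult)
  qed
  then have "norm (complex_of_real t * f z) \<le> norm z"
    using assms by (intro Schwarz_Lemma(1)) (auto intro!: holomorphic_intros)
  then show "t * norm (f z) \<le> norm z"
    using t by (simp add: norm_mult)
qed

text \<open>The Cayley transform \<open>\<psi>\<close> centred at \<open>q 0\<close> maps the left
  half-plane to the disc and vanishes at 0, so Schwarz gives |q z - q 0| \<le> |z| |q z + cnj (q
  0)|. The triangle inequality turns this into a bound on |q z| itself.\<close>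

lemma Harnack_unit_disc_strict:
  assumes hol: "q holomorphic_on ball 0 1" and Re: "\<And>z. norm z < 1 \<Longrightarrow> Re (q z) < 0"
    and z: "norm z < 1"
  shows "norm (q z) * (1 - norm z) \<le> norm (q 0) * (1 + norm z)"
proof -
  define \<psi> where "\<psi> w = (q w - q 0) / (q w + cnj (q 0))" for w
  have nz: "q w + cnj (q 0) \<noteq> 0" if "norm w < 1" for w
  proof -
    have "Re (q w + cnj (q 0)) < 0" using Re[OF that] Re[of 0] by simp
    then show ?thesis by (metis less_irrefl zero_complex.simps(1))
  qed
  have le: "norm (q w - q 0) \<le> norm (q w + cnj (q 0))" if "norm w < 1" for w
  proof -
    have "0 \<le> Re (q w) * Re (q 0)" using Re[OF that] Re[of 0] by (simp add: mult_neg_neg less_imp_le)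
    then have "(norm (q w - q 0))\<^sup>2 \<le> (norm (q w + cnj (q 0)))\<^sup>2"
      unfolding cmod_power2 by (simp add: power2_eq_square algebra_simps)
    then show ?thesis by (rule power2_le_imp_le) simp
  qed
  have "norm (\<psi> z) \<le> norm z"
  proof (rule Schwarz_Lemma_le)
    show "\<psi> holomorphic_on ball 0 1"
      unfolding \<psi>_def using nz hol by (auto intro!: holomorphic_intros)
    show "norm (\<psi> w) \<le> 1" if "norm w < 1" for w
      using le[OF that] nz[OF that] by (simp add: \<psi>_def norm_divide)
  qed (use z in \<open>auto simp: \<psi>_def\<close>)
  then have "norm (q z - q 0) \<le> norm z * norm (q z + cnj (q 0))"
    using nz[OF z] by (simp add: \<psi>_def norm_divide divide_simps)
  also have "\<dots> \<le> norm z * (norm (q z) + norm (q 0))"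
    by (intro mult_left_mono) (metis complex_mod_cnj norm_triangle_ineq, simp)
  finally have "norm (q z) - norm (q 0) \<le> norm z * (norm (q z) + norm (q 0))"
    using norm_triangle_ineq2[of "q z" "q 0"] by linarith
  then show ?thesis by (simp add: algebra_simps)
qed

lemma Harnack_ball:
  assumes hol: "q holomorphic_on ball c R" and Re: "\<And>z. z \<in> ball c R \<Longrightarrow> Re (q z) \<le> 0"
    and z: "z \<in> ball c R"
  shows "norm (q z) * (R - dist c z) \<le> norm (q c) * (R + dist c z)"
proof -
  have R: "R > 0" using z by (meson mem_ball zero_le_dist le_less_trans)
  define w where "w = (z - c) / R"
  have w: "norm w = dist c z / R" using R by (simp add: w_def norm_divide dist_norm norm_minus_commute)
  have w1: "norm w < 1" using z R by (simp add: w)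
  have inb: "c + R * u \<in> ball c R" if "norm u < 1" for u :: complex
    using that R by (simp add: dist_norm norm_mult)
  \<comment> \<open>Subtracting \<delta> makes the real part strictly negative; \<delta> tends to 0
    afterwards.\<close>
  have "norm (q z - complex_of_real \<delta>) * (1 - norm w) \<le> norm (q c - complex_of_real \<delta>) * (1 + norm w)"
    if "\<delta> > 0" for \<delta>
  proof -
    have "norm (q (c + R * w) - complex_of_real \<delta>) * (1 - norm w)
        \<le> norm (q (c + complex_of_real R * 0) - complex_of_real \<delta>) * (1 + norm w)"
    proof (rule Harnack_unit_disc_strict[where q = "\<lambda>u. q (c + R * u) - complex_of_real \<delta>"])
      show "(\<lambda>u. q (c + R * u) - complex_of_real \<delta>) holomorphic_on ball 0 1"
        by (intro holomorphic_intros holomorphic_on_compose_gen[OF _ hol, unfolded o_def])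
           (use inb in auto)
      show "Re (q (c + R * u) - complex_of_real \<delta>) < 0" if "norm u < 1" for u :: complex
        using Re[OF inb[OF that]] \<open>\<delta> > 0\<close> by simp
    qed (rule w1)
    moreover have "c + R * w = z" using R by (simp add: w_def)
    ultimately show ?thesis by simp
  qed
  then have ev: "\<forall>\<^sub>F \<delta> in at_right 0. norm (q z - complex_of_real \<delta>) * (1 - norm w)
      \<le> norm (q c - complex_of_real \<delta>) * (1 + norm w)"
    by (simp add: eventually_at_right_less eventually_mono[OF eventually_at_right_less])
  have "norm (q z - complex_of_real 0) * (1 - norm w) \<le> norm (q c - complex_of_real 0) * (1 + norm w)"
    by (rule tendsto_le[OF _ _ _ ev]) (simp, (intro tendsto_intros)+)
  then have "norm (q z) * (1 - norm w) * R \<le> norm (q c) * (1 + norm w) * R"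
    using R by simp
  then show ?thesis using R by (simp add: w algebra_simps)
qed

text \<open>With v = \<open>Moebius_function 0 a z\<close> as the variable, the bounded product
  vanishes at v = 0, so Schwarz bounds it by |v|, and cancelling |v| leaves the bound on
  \<open>k\<close>. The point z = a, where the factor vanishes, follows by continuity.\<close>

lemma Blaschke_factor_divide_bound:
  assumes k: "k holomorphic_on ball 0 1" and a: "norm a < 1"
    and le: "\<And>z. norm z < 1 \<Longrightarrow> norm (k z * Moebius_function 0 a z) \<le> 1"
    and z: "norm z < 1"
  shows "norm (k z) \<le> 1"
proof -
  let ?M = "Moebius_function 0"
  have na: "norm (-a) < 1" using a by simp
  have key: "norm (k w) \<le> 1" if w: "norm w < 1" "w \<noteq> a" for w
  proof -
    let ?u = "?M a w"
    have u: "norm ?u < 1" using Moebius_function_norm_lt_1 a w by blast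
    have bk: "?M (-a) ?u = w"
      using Moebius_function_compose[of "-a" a w] na a w by simp
    have "norm (k (?M (-a) ?u) * ?M a (?M (-a) ?u)) \<le> norm ?u"
    proof (rule Schwarz_Lemma_le[where f = "\<lambda>v. k (?M (-a) v) * ?M a (?M (-a) v)"])
      show "(\<lambda>v. k (?M (-a) v) * ?M a (?M (-a) v)) holomorphic_on ball 0 1"
        by (intro holomorphic_on_mult holomorphic_on_compose_gen[OF _ k, unfolded o_def]
            holomorphic_on_compose_gen[OF _ Moebius_function_holomorphic[OF a], unfolded o_def]
            Moebius_function_holomorphic na)
           (use Moebius_function_norm_lt_1 na in auto)
      show "norm (k (?M (-a) v) * ?M a (?M (-a) v)) \<le> 1" if "norm v < 1" for v
        by (intro le Moebius_function_norm_lt_1 na that)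
    qed (use u in \<open>auto simp: Moebius_function_of_zero Moebius_function_eq_zero\<close>)
    then have "norm (k w) * norm ?u \<le> norm ?u"
      by (simp add: bk norm_mult)
    moreover have "?u \<noteq> 0"
    proof
      assume "?u = 0"
      then have "w = ?M (-a) 0" using bk by simp
      then show False using w by (simp add: Moebius_function_of_zero)
    qed
    ultimately show ?thesis by simp
  qed
  show ?thesis
  proof (cases "z = a")
    case True
    have "isCont k a"
      using k a by (intro continuous_on_interior[OF holomorphic_on_imp_continuous_on]) auto
    then have lim: "((\<lambda>w. norm (k w)) \<longlongrightarrow> norm (k a)) (at a)"
      by (intro tendsto_norm) (simp add: isCont_def)
    have "\<forall>\<^sub>F w in at a. w \<in> ball 0 1 - {a}"
      using a by (intro eventually_at_in_open) auto
    then have "\<forall>\<^sub>F w in at a. norm (k w) \<le> 1"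
      by eventually_elim (use key in auto)
    then show ?thesis using tendsto_upperbound[OF lim] True by simp
  qed (use key z in auto)
qed

text \<open>Dividing \<open>g\<close> by a Blaschke factor at a zero in \<open>ball 0 \<rho>\<close> raises \<open>norm (g 0)\<close> by at least \<open>1 / \<rho>\<close>,
  so after at most \<open>n\<close> divisions \<open>g\<close> is zero-free there and Harnack's inequality applies to \<open>ln g\<close>.\<close>
lemma quotient_bound_disc:
  fixes f g :: "complex \<Rightarrow> complex"
  assumes \<rho>: "0 < \<rho>" "\<rho> < 1" and w: "norm w < \<rho>"
    and f: "f holomorphic_on ball 0 1" and g: "g holomorphic_on ball 0 1"
    and g1: "\<And>z. norm z < 1 \<Longrightarrow> norm (g z) \<le> 1"
    and fg1: "\<And>z. norm z < 1 \<Longrightarrow> norm (f z * g z) \<le> 1"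
    and n: "norm (g 0) > \<rho> ^ n"
  shows "norm (f w) \<le> exp ((\<rho> + norm w) / (\<rho> - norm w) * (- ln (norm (g 0))))"
  using g g1 fg1 n
proof (induction n arbitrary: g)
  \<comment> \<open>Here \<open>norm (g 0) > 1\<close> contradicts the bound on
    \<open>g\<close>.\<close>
  case 0
  from 0(2)[of 0] 0(4) show ?case by simp
next
  case (Suc n)
  have g0: "g 0 \<noteq> 0" using Suc.prems(4) \<rho> by (metis norm_zero not_less order_less_imp_le zero_less_power)
  let ?t = "(\<rho> + norm w) / (\<rho> - norm w)"
  have t: "?t \<ge> 0" using w \<rho> by simp
  show ?case
  proof (cases "\<exists>a. norm a < \<rho> \<and> g a = 0")
    case False
    then have "\<And>z. z \<in> ball 0 \<rho> \<Longrightarrow> g z \<noteq> 0" by auto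
    moreover have "g holomorphic_on ball 0 \<rho>"
      using Suc.prems(1) by (rule holomorphic_on_subset) (use \<rho> in auto)
    ultimately obtain q where q: "q holomorphic_on ball 0 \<rho>" "\<And>z. z \<in> ball 0 \<rho> \<Longrightarrow> g z = exp (q z)"
      using contractible_imp_holomorphic_log[of g "ball 0 \<rho>"] convex_imp_contractible by (metis convex_ball)
    have Re: "Re (q z) \<le> 0" if "z \<in> ball 0 \<rho>" for z
      using Suc.prems(2)[of z] q(2)[OF that] that \<rho> by auto
    have q0: "Re (q 0) = ln (norm (g 0))" using q(2)[of 0] \<rho> by simp
    \<comment> \<open>Removing a constant imaginary part makes the value at 0 equal to ln |g 0|, so
      the Harnack bound depends on \<open>g\<close> through that number alone.\<close>
    have "norm (q w - \<i> * Im (q 0)) * (\<rho> - dist 0 w) \<le> norm (q 0 - \<i> * Im (q 0)) * (\<rho> + dist 0 w)"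
      by (rule Harnack_ball[where q = "\<lambda>z. q z - \<i> * Im (q 0)"])
         (use q Re w in \<open>auto intro!: holomorphic_intros\<close>)
    moreover have "q 0 - \<i> * Im (q 0) = of_real (Re (q 0))"
      by (simp add: complex_eq_iff)
    ultimately have "norm (q w - \<i> * Im (q 0)) * (\<rho> - norm w) \<le> - Re (q 0) * (\<rho> + norm w)"
      using Re[of 0] \<rho> by simp
    then have "norm (q w - \<i> * Im (q 0)) \<le> ?t * (- ln (norm (g 0)))"
      using w by (simp add: field_simps q0)
    moreover have "- Re (q w) \<le> norm (q w - \<i> * Im (q 0))"
      using abs_Re_le_cmod[of "q w - \<i> * Im (q 0)"] by simp
    ultimately have *: "- Re (q w) \<le> ?t * (- ln (norm (g 0)))" by linarith
    have "norm (f w) * norm (g w) \<le> 1" using Suc.prems(3)[of w] w \<rho> by (simp add: norm_mult)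
    moreover have "norm (g w) = exp (Re (q w))" using q(2)[of w] w by simp
    ultimately have "norm (f w) \<le> exp (- Re (q w))" by (simp add: exp_minus field_simps)
    with * show ?thesis by (meson exp_le_cancel_iff order_trans)
  next
    case True
    then obtain a where a: "norm a < \<rho>" "g a = 0" by blast
    have a1: "norm a < 1" using a \<rho> by simp
    have a0: "a \<noteq> 0" using g0 a by auto
    define G where "G z = (if z = a then deriv g a else (g z - g a) / (z - a))" for z
    have G: "G holomorphic_on ball 0 1"
      unfolding G_def by (rule pole_lemma_open[OF Suc.prems(1)]) simp
    define g' where "g' z = G z * (1 - cnj a * z)" for z
    have g': "g' holomorphic_on ball 0 1"
      unfolding g'_def using G by (intro holomorphic_intros) auto
    have nz: "1 - cnj a * z \<noteq> 0" if "norm z < 1" for z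
    proof
      assume "1 - cnj a * z = 0"
      then have "norm (cnj a * z) = 1" by (metis eq_iff_diff_eq_0 norm_one)
      moreover have "norm (cnj a * z) < 1"
        using mult_strict_mono'[of "norm a" 1 "norm z" 1] a1 that by (simp add: norm_mult)
      ultimately show False by simp
    qed
    have fac: "g z = g' z * Moebius_function 0 a z" if "norm z < 1" for z
      using nz[OF that] a by (simp add: g'_def G_def Moebius_function_simple)
    have b1: "norm (g' z) \<le> 1" if "norm z < 1" for z
      by (rule Blaschke_factor_divide_bound[OF g' a1 _ that]) (use Suc.prems(2) fac in auto)
    \<comment> \<open>The Blaschke factor of \<open>g\<close> is also a factor of
      \<open>f * g\<close>, so both bounds survive the division while \<open>f\<close> stays
      unchanged.\<close>
    have b2: "norm (f z * g' z) \<le> 1" if "norm z < 1" for z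
      by (rule Blaschke_factor_divide_bound[where k = "\<lambda>z. f z * g' z", OF _ a1 _ that])
         (use Suc.prems(3) fac f g' in \<open>auto intro!: holomorphic_intros simp: mult.assoc\<close>)
    have g'0: "norm (g 0) = norm (g' 0) * norm a"
      using fac[of 0] by (simp add: Moebius_function_of_zero norm_mult)
    have "\<rho> ^ n * norm a \<le> \<rho> ^ Suc n" using a \<rho> by (simp add: mult.commute mult_left_mono)
    then have "\<rho> ^ n * norm a < norm (g' 0) * norm a" using Suc.prems(4) g'0 by linarith
    then have n': "\<rho> ^ n < norm (g' 0)" using a0 by simp
    have ge: "norm (g 0) \<le> norm (g' 0)" using g'0 a1 by (simp add: mult_left_le)
    have "norm (f w) \<le> exp (?t * (- ln (norm (g' 0))))"
      by (rule Suc.IH[OF g' b1 b2 n'])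
    also have "\<dots> \<le> exp (?t * (- ln (norm (g 0))))"
      using ge g0 t ln_mono[of "norm (g 0)" "norm (g' 0)"] 
      by (intro iffD2[OF exp_le_cancel_iff] mult_left_mono) auto
    finally show ?thesis .
  qed
qed

text \<open>In the disc a quotient of bounded functions is at most exp (C / (1 - |w|)). Under a
  Moebius map to the half-plane, 1 / (1 - |w|) is at most a constant times (1 + |z|^2) / Im z. The
  resulting class is stable under sums, products and primitives.\<close>

definition hp_growth :: "(complex \<Rightarrow> complex) \<Rightarrow> bool" where
  "hp_growth f \<longleftrightarrow> (\<exists>C. \<forall>z. Im z > 0 \<longrightarrow> norm (f z) \<le> exp (C * ((1 + (norm z)\<^sup>2) / Im z)))"

text \<open>Numerator and denominator are scaled by a common \<open>B\<close> to modulus at most 1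
  and moved to the disc, with a point \<open>z0\<close> where the denominator is non-zero at the
  centre. The disc estimate is then rewritten by means of 1 - |w|^2 = 4 Im z Im z0 / |z - cnj
  z0|^2.\<close>

lemma bounded_type_imp_hp_growth:
  assumes bt: "bounded_type h" and hol: "h holomorphic_on UHP"
  shows "hp_growth h"
proof -
  obtain f g where f: "f holomorphic_on UHP" "bounded (f ` UHP)"
    and g: "g holomorphic_on UHP" "bounded (g ` UHP)" and "\<exists>z\<in>UHP. g z \<noteq> 0"
    and hg: "\<And>z. z \<in> UHP \<Longrightarrow> h z * g z = f z"
    using bt unfolding bounded_type_def by blast
  then obtain z0 where z0: "Im z0 > 0" "g z0 \<noteq> 0" by (auto simp: UHP_def)
  obtain B1 where B1: "\<And>z. z \<in> UHP \<Longrightarrow> norm (f z) \<le> B1" using f(2) by (auto simp: bounded_iff)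
  obtain B2 where B2: "\<And>z. z \<in> UHP \<Longrightarrow> norm (g z) \<le> B2" using g(2) by (auto simp: bounded_iff)
  define B where "B = max (max B1 B2) 1"
  have B: "B \<ge> 1" "\<And>z. z \<in> UHP \<Longrightarrow> norm (f z) \<le> B" "\<And>z. z \<in> UHP \<Longrightarrow> norm (g z) \<le> B"
    using B1 B2 by (force simp: B_def)+
  \<comment> \<open>The inverse of z -> (z - z0) / (z - cnj z0); it sends 0 to \<open>z0\<close> and
    1 to infinity.\<close>
  define T where "T w = (z0 - cnj z0 * w) / (1 - w)" for w
  have T: "T w \<in> UHP" if "norm w < 1" for w
  proof -
    have w1: "w \<noteq> 1" using that by auto
    have "Im (T w) = Im ((z0 - cnj z0 * w) * cnj (1 - w)) / (norm (1 - w))\<^sup>2"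
      unfolding T_def by (subst complex_div_cnj) (simp add: Im_divide_of_real)
    also have "Im ((z0 - cnj z0 * w) * cnj (1 - w)) = Im z0 * (1 - (norm w)\<^sup>2)"
      unfolding cmod_power2 by (simp add: power2_eq_square algebra_simps)
    finally have "Im (T w) = Im z0 * (1 - (norm w)\<^sup>2) / (norm (1 - w))\<^sup>2" .
    moreover have "(norm w)\<^sup>2 < 1" using that by (simp add: abs_square_less_1)
    ultimately show ?thesis using z0 w1 by (simp add: UHP_def)
  qed
  have Thol: "T holomorphic_on ball 0 1" unfolding T_def by (intro holomorphic_intros) auto
  have comp: "(\<lambda>w. k (T w)) holomorphic_on ball 0 1" if "k holomorphic_on UHP" for k
    by (rule holomorphic_on_compose_gen[OF Thol that, unfolded o_def]) (use T in auto)
  define L where "L = - ln (norm (g z0) / B)"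
  have L: "L \<ge> 0" using B(3)[of z0] z0 B(1) by (auto simp: L_def UHP_def field_simps ln_le_zero_iff)
  define C where "C = 4 * L * (1 + (norm z0)\<^sup>2) / Im z0"
  have "norm (h z) \<le> exp (C * ((1 + (norm z)\<^sup>2) / Im z))" if z: "Im z > 0" for z
  proof -
    define w where "w = (z - z0) / (z - cnj z0)"
    have zz: "z - cnj z0 \<noteq> 0" using z z0 by (auto simp: complex_eq_iff)
    have "(norm (z - cnj z0))\<^sup>2 - (norm (z - z0))\<^sup>2 = 4 * Im z * Im z0"
      unfolding cmod_power2 by (simp add: power2_eq_square algebra_simps)
    then have w2: "1 - (norm w)\<^sup>2 = 4 * Im z * Im z0 / (norm (z - cnj z0))\<^sup>2"
      using zz by (simp add: w_def norm_divide power_divide diff_divide_eq_iff)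
    have "1 - (norm w)\<^sup>2 > 0" unfolding w2 using z z0 zz by simp
    then have w1: "norm w < 1" by (simp add: abs_square_less_1)
    have Tw: "T w = z"
    proof -
      have "1 - w = (z0 - cnj z0) / (z - cnj z0)" using zz by (simp add: w_def field_simps)
      moreover have "z0 - cnj z0 * w = z * (z0 - cnj z0) / (z - cnj z0)"
        using zz by (simp add: w_def field_simps)
      moreover have "z0 - cnj z0 \<noteq> 0" using z0 by (auto simp: complex_eq_iff)
      ultimately show ?thesis using zz by (simp add: T_def)
    qed
    \<comment> \<open>The disc estimate asks for |w| < \<rho> < 1; the midpoint keeps (\<rho> + |w|)
      / (\<rho> - |w|) of order 1 / (1 - |w|).\<close>
    define \<rho> where "\<rho> = (1 + norm w) / 2"
    have \<rho>: "0 < \<rho>" "\<rho> < 1" "norm w < \<rho>" using w1 by (auto simp: \<rho>_def add_pos_nonneg)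
    have T0: "T 0 = z0" by (simp add: T_def)
    obtain n where n: "\<rho> ^ n < norm (g z0) / B"
      using real_arch_pow_inv[of "norm (g z0) / B" \<rho>] z0 B \<rho> by auto
    have "norm (h (T w)) \<le> exp ((\<rho> + norm w) / (\<rho> - norm w) * (- ln (norm (g (T 0) / of_real B))))"
    proof (rule quotient_bound_disc[where f = "\<lambda>w. h (T w)" and g = "\<lambda>w. g (T w) / of_real B"])
      show "norm (g (T v) / of_real B) \<le> 1" if "norm v < 1" for v
        using B(1) B(3)[OF T[OF that]] by (simp add: norm_divide)
      show "norm (h (T v) * (g (T v) / of_real B)) \<le> 1" if "norm v < 1" for v
        using B(1) B(2)[OF T[OF that]] hg[OF T[OF that]] by (simp add: norm_divide)
      show "\<rho> ^ n < norm (g (T 0) / of_real B)" using n B T0 by (simp add: norm_divide)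
    qed (use \<rho> comp hol g B in \<open>auto intro!: holomorphic_intros\<close>)
    also have "- ln (norm (g (T 0) / of_real B)) = L" using B by (simp add: T0 L_def norm_divide)
    finally have "norm (h z) \<le> exp ((\<rho> + norm w) / (\<rho> - norm w) * L)" by (simp add: Tw)
    also have "\<dots> \<le> exp (C * ((1 + (norm z)\<^sup>2) / Im z))"
    proof -
      have "(\<rho> + norm w) / (\<rho> - norm w) = (1 + 3 * norm w) / (1 - norm w)"
        using w1 by (simp add: \<rho>_def field_simps)
      also have "\<dots> = (1 + 3 * norm w) * (1 + norm w) / (1 - (norm w)\<^sup>2)"
      proof -
        have "1 - (norm w)\<^sup>2 = (1 - norm w) * (1 + norm w)" by (simp add: power2_eq_square algebra_simps)
        then show ?thesis using norm_ge_zero[of w] by (simp add: add_nonneg_eq_0_iff)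
      qed
      also have "\<dots> \<le> 8 / (1 - (norm w)\<^sup>2)"
      proof -
        have "(1 + 3 * norm w) * (1 + norm w) \<le> 4 * 2" using w1 by (intro mult_mono) auto
        then show ?thesis using \<open>1 - (norm w)\<^sup>2 > 0\<close> by (simp add: divide_right_mono)
      qed
      also have "\<dots> = 2 * (norm (z - cnj z0))\<^sup>2 / (Im z * Im z0)"
        unfolding w2 using z z0 zz by (simp add: field_simps)
      also have "\<dots> \<le> 2 * (2 * (1 + (norm z0)\<^sup>2) * (1 + (norm z)\<^sup>2)) / (Im z * Im z0)"
      proof -
        have "norm (z - cnj z0) \<le> norm z + norm z0" using norm_triangle_ineq4[of z "cnj z0"] by simp
        then have "(norm (z - cnj z0))\<^sup>2 \<le> (norm z + norm z0)\<^sup>2" by (simp add: power_mono)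
        also have "\<dots> \<le> 2 * (norm z)\<^sup>2 + 2 * (norm z0)\<^sup>2"
          using sum_squares_bound[of "norm z" "norm z0"] by (simp add: power2_sum)
        also have "\<dots> \<le> 2 * (1 + (norm z0)\<^sup>2) * (1 + (norm z)\<^sup>2)" by (simp add: algebra_simps)
        finally show ?thesis using z z0 by (intro divide_right_mono) auto
      qed
      finally have "(\<rho> + norm w) / (\<rho> - norm w) * L
          \<le> 2 * (2 * (1 + (norm z0)\<^sup>2) * (1 + (norm z)\<^sup>2)) / (Im z * Im z0) * L"
        using L by (rule mult_right_mono)
      also have "\<dots> = C * ((1 + (norm z)\<^sup>2) / Im z)"
        using z z0 by (simp add: C_def field_simps)
      finally show ?thesis by simp
    qed
    finally show ?thesis .
  qed
  then show ?thesis unfolding hp_growth_def by blast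
qed

subsection \<open>A Phragmen-Lindelof principle in a quadrant\<close>

text \<open>The maximum principle is applied to \<open>f ^ n * (z - a) * (z - b)\<close>, and \<open>n\<close> tends to infinity.\<close>
lemma maximum_modulus_two_exceptional_points:
  fixes f :: "complex \<Rightarrow> complex"
  assumes V: "open V" "bounded V" "a \<notin> V" "b \<notin> V"
    and hol: "f holomorphic_on V" and cont: "continuous_on (closure V - {a, b}) f"
    and bdd: "\<And>z. z \<in> closure V - {a, b} \<Longrightarrow> norm (f z) \<le> B"
    and fr: "\<And>z. z \<in> frontier V - {a, b} \<Longrightarrow> norm (f z) \<le> S"
    and S: "S > 0" and z: "z \<in> V"
  shows "norm (f z) \<le> S"
proof (rule ccontr)
  assume neg: "\<not> norm (f z) \<le> S"
  have "compact (closure V)" using V by (simp add: compact_closure)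
  then have "bounded ((\<lambda>w. (w - a) * (w - b)) ` closure V)"
    by (intro compact_imp_bounded compact_continuous_image continuous_intros)
  then obtain D where D: "D > 0" "\<And>w. w \<in> closure V \<Longrightarrow> norm ((w - a) * (w - b)) \<le> D"
    unfolding bounded_pos by auto
  have main: "(norm (f z) / S) ^ n * norm ((z - a) * (z - b)) \<le> D" for n
  proof -
    \<comment> \<open>Nothing is known of \<open>f\<close> at \<open>a\<close> and \<open>b\<close>
      themselves, so \<open>k\<close> is set to 0 there. As \<open>f\<close> is bounded nearby, the
      factor (w - a)(w - b) makes \<open>G\<close> continuous at both points.\<close>
    define k where "k w = (if w \<in> {a, b} then 0 else (f w / S) ^ n)" for w
    define G where "G w = k w * ((w - a) * (w - b))" for w
    have kb: "norm (k w) \<le> max 0 ((\<bar>B\<bar> / S) ^ n)" if "w \<in> closure V" for w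
    proof (cases "w \<in> {a, b}")
      case False
      then have "norm (f w) / S \<le> \<bar>B\<bar> / S" using bdd[of w] that S by (intro divide_right_mono) auto
      then have "(norm (f w) / S) ^ n \<le> (\<bar>B\<bar> / S) ^ n" using S by (intro power_mono) auto
      then show ?thesis using False S by (simp add: k_def norm_divide norm_power)
    qed (simp add: k_def)
    have "norm (G z) \<le> D"
    proof (rule maximum_modulus_frontier[where f = G and S = V])
      have "G holomorphic_on V \<longleftrightarrow> (\<lambda>w. (f w / S) ^ n * ((w - a) * (w - b))) holomorphic_on V"
        by (rule holomorphic_cong) (use V in \<open>auto simp: G_def k_def\<close>)
      then show "G holomorphic_on interior V"
        using hol V S by (auto simp: interior_open intro!: holomorphic_intros)
      show "continuous_on (closure V) G"
        unfolding continuous_on_eq_continuous_within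
      proof
        fix x assume x: "x \<in> closure V"
        show "continuous (at x within closure V) G"
        proof (cases "x \<in> {a, b}")
          case True
          then have Gx: "G x = 0" by (simp add: G_def k_def)
          have "((\<lambda>w. max 0 ((\<bar>B\<bar> / S) ^ n) * norm ((w - a) * (w - b))) \<longlongrightarrow>
              max 0 ((\<bar>B\<bar> / S) ^ n) * norm ((x - a) * (x - b))) (at x within closure V)"
            by (intro tendsto_intros)
          then have lim: "((\<lambda>w. max 0 ((\<bar>B\<bar> / S) ^ n) * norm ((w - a) * (w - b))) \<longlongrightarrow> 0)
              (at x within closure V)" using True by auto
          have "\<forall>\<^sub>F w in at x within closure V. norm (G w) \<le> max 0 ((\<bar>B\<bar> / S) ^ n) * norm ((w - a) * (w - b))"
            unfolding eventually_at_filter G_def norm_mult[of "k _"]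
            by (intro always_eventually allI impI mult_right_mono kb) auto
          then show ?thesis
            unfolding continuous_within Gx by (rule Lim_null_comparison[OF _ lim])
        next
          case False
          have "continuous_on (closure V - {a, b}) (\<lambda>w. (f w / S) ^ n * ((w - a) * (w - b)))"
            using S by (intro continuous_intros cont) auto
          then have "continuous_on (closure V - {a, b}) G"
            by (rule continuous_on_eq) (auto simp: G_def k_def)
          then have "continuous (at x within closure V - {a, b}) G"
            using False x by (auto simp: continuous_on_eq_continuous_within)
          moreover have "at x within closure V - {a, b} = at x within closure V"
            using False by (intro at_within_nhd[where S = "- {a, b}"]) auto
          ultimately show ?thesis by simp
        qed
      qed
      show "norm (G w) \<le> D" if w: "w \<in> frontier V" for w
      proof (cases "w \<in> {a, b}")
        case False
        then have "(norm (f w) / S) ^ n \<le> 1 ^ n" using fr[of w] S w by (intro power_mono) auto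
        then have "norm (k w) \<le> 1" using False S by (simp add: k_def norm_divide norm_power)
        then have "norm (k w) * norm ((w - a) * (w - b)) \<le> 1 * norm ((w - a) * (w - b))"
          by (intro mult_right_mono) auto
        also have "\<dots> \<le> D" using D w by (simp add: frontier_def)
        finally show ?thesis by (simp add: G_def norm_mult)
      qed (use D in \<open>simp add: G_def k_def\<close>)
    qed (use V z in auto)
    moreover have "z \<notin> {a, b}" using V z by auto
    ultimately show ?thesis using S by (simp add: G_def k_def norm_mult norm_power norm_divide)
  qed
  have gt: "norm (f z) / S > 1" using neg S by simp
  have pos: "norm ((z - a) * (z - b)) > 0" using V z by auto
  obtain n where "D / norm ((z - a) * (z - b)) < (norm (f z) / S) ^ n"
    using real_arch_pow[OF gt] by blast
  then show False using main[of n] pos by (simp add: field_simps)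
qed

text \<open>With \<open>w = z\<^sup>2\<close>, the multiplier \<open>exp (- \<i> M (1 / (w - R\<^sup>2) + 1 / (w + R\<^sup>2)))\<close> has modulus at most 1 in the quadrant and
  exactly \<open>exp (- M / Im w)\<close> on the arc \<open>|z| = R\<close>, which compensates the growth there.\<close>
lemma Phragmen_Lindelof_quadrant:
  fixes g :: "complex \<Rightarrow> complex"
  assumes cont: "continuous_on {z. 0 \<le> Re z \<and> 0 \<le> Im z} g"
    and hol: "g holomorphic_on {z. 0 < Re z \<and> 0 < Im z}"
    and real: "\<And>x. 0 \<le> x \<Longrightarrow> norm (g (complex_of_real x)) \<le> S"
    and imag: "\<And>y. 0 \<le> y \<Longrightarrow> norm (g (\<i> * complex_of_real y)) \<le> S"
    and growth: "\<And>z. 0 < Re z \<Longrightarrow> 0 < Im z \<Longrightarrow>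
      norm (g z) \<le> exp (C * (1 + (norm z)\<^sup>2) * norm z / (Re z * Im z))"
    and S: "S \<ge> 1" and C: "C \<ge> 0" and z: "0 < Re z" "0 < Im z"
  shows "norm (g z) \<le> S"
proof -
  define q where "q = Im (z\<^sup>2)"
  have q: "q > 0" using z by (simp add: q_def power2_eq_square)
  have bound: "norm (g z) \<le> S * exp (16 * C * q / R)" if R: "R \<ge> 1" "R > 2 * norm z" for R
  proof -
    have R0: "R > 0" "norm z < R" using R norm_ge_zero[of z] by linarith+
    \<comment> \<open>On the arc the growth bound is exp (C (1 + R^2) R / (Re w Im w)) and the
      multiplier has modulus exp (- M / (2 Re w Im w)); this \<open>M\<close> makes their product
      1.\<close>
    define M where "M = 2 * C * (1 + R\<^sup>2) * R"
    have M: "M \<ge> 0" using C R by (simp add: M_def)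
    define V where "V = {w. 0 < Re w \<and> 0 < Im w \<and> norm w < R}"
    define Q where "Q = {w. 0 \<le> Re w \<and> 0 \<le> Im w \<and> norm w \<le> R}"
    define m where "m w = exp (- \<i> * M * (1 / (w\<^sup>2 - R\<^sup>2) + 1 / (w\<^sup>2 + R\<^sup>2)))" for w :: complex
    define s where "s w = 1 / (norm (w\<^sup>2 - R\<^sup>2))\<^sup>2 + 1 / (norm (w\<^sup>2 + R\<^sup>2))\<^sup>2" for w :: complex
    have nm: "norm (m w) = exp (- (M * Im (w\<^sup>2) * s w))" for w
    proof -
      have *: "Im (1 / u) = - Im u / (norm u)\<^sup>2" for u :: complex
        by (simp add: Im_divide cmod_power2)
      have r: "Re (- \<i> * M * u) = M * Im u" for u by simp
      have "Im (w\<^sup>2 - R\<^sup>2) = Im (w\<^sup>2)" "Im (w\<^sup>2 + R\<^sup>2) = Im (w\<^sup>2)"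
        by (simp_all flip: of_real_power)
      then show ?thesis
        unfolding m_def norm_exp_eq_Re r plus_complex.simps * s_def
        by (simp add: algebra_simps)
    qed
    have Im2: "Im (w\<^sup>2) = 2 * Re w * Im w" for w by (simp add: power2_eq_square)
    have s0: "s w \<ge> 0" for w by (simp add: s_def)
    have m1: "norm (m w) \<le> 1" if "0 \<le> Re w" "0 \<le> Im w" for w
      using M s0[of w] that by (simp add: nm Im2)
    have arc: "M * Im (w\<^sup>2) * s w = C * (1 + R\<^sup>2) * R / (Re w * Im w)"
      if w: "0 < Re w" "0 < Im w" "norm w = R" for w
    proof -
      define p where "p = Re (w\<^sup>2)"
      define r where "r = Im (w\<^sup>2)"
      have r: "r > 0" using w by (simp add: r_def Im2)
      have nw: "p\<^sup>2 + r\<^sup>2 = (R\<^sup>2)\<^sup>2"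
        using w by (simp add: p_def r_def cmod_power2[symmetric] norm_power)
      have cc: "w\<^sup>2 = Complex p r" by (simp add: p_def r_def)
      \<comment> \<open>For |w| = R both squared distances are linear in p, and (R^2 - p)(R^2 + p) =
        r^2; this is why \<open>s w\<close> collapses to 1 / r^2.\<close>
      have e1: "(norm (w\<^sup>2 - R\<^sup>2))\<^sup>2 = 2 * R\<^sup>2 * (R\<^sup>2 - p)"
        using nw unfolding cc cmod_power2 by (simp flip: of_real_power add: power2_eq_square algebra_simps)
      have e2: "(norm (w\<^sup>2 + R\<^sup>2))\<^sup>2 = 2 * R\<^sup>2 * (R\<^sup>2 + p)"
        using nw unfolding cc cmod_power2 by (simp flip: of_real_power add: power2_eq_square algebra_simps)
      have prod: "(R\<^sup>2 - p) * (R\<^sup>2 + p) = r\<^sup>2" using nw by (simp add: power2_eq_square algebra_simps)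
      then have nz: "R\<^sup>2 - p \<noteq> 0" "R\<^sup>2 + p \<noteq> 0" using r by auto
      have "s w = (1 / (R\<^sup>2 - p) + 1 / (R\<^sup>2 + p)) / (2 * R\<^sup>2)"
        unfolding s_def e1 e2 using R0 by (simp add: add_divide_distrib mult.commute)
      also have "1 / (R\<^sup>2 - p) + 1 / (R\<^sup>2 + p) = 2 * R\<^sup>2 / r\<^sup>2"
        using nz unfolding prod[symmetric] by (simp add: divide_simps)
      finally have sw: "s w = 1 / r\<^sup>2" using R0 by simp
      have "M * Im (w\<^sup>2) * s w = M / r"
        unfolding sw r_def[symmetric] using r by (simp add: power2_eq_square)
      also have "\<dots> = C * (1 + R\<^sup>2) * R / (Re w * Im w)"
        unfolding r_def Im2 M_def by simp
      finally show ?thesis .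
    qed
    have Vo: "open V"
      unfolding V_def by (intro open_Collect_conj open_Collect_less continuous_intros)
    have "closed Q"
      unfolding Q_def by (intro closed_Collect_conj closed_Collect_le continuous_intros)
    moreover have "bounded Q" unfolding Q_def bounded_iff by auto
    ultimately have "compact Q" by (simp add: compact_eq_bounded_closed)
    have VQ: "V \<subseteq> Q" by (auto simp: V_def Q_def)
    have clQ: "closure V \<subseteq> Q" using \<open>closed Q\<close> VQ by (rule closure_minimal[rotated])
    have contQ: "continuous_on Q g" by (rule continuous_on_subset[OF cont]) (auto simp: Q_def)
    obtain B where B: "\<And>w. w \<in> Q \<Longrightarrow> norm (g w) \<le> B"
      using compact_imp_bounded[OF compact_continuous_image[OF contQ \<open>compact Q\<close>]]
      by (auto simp: bounded_iff)
    have nz: "w\<^sup>2 - R\<^sup>2 \<noteq> 0 \<and> w\<^sup>2 + R\<^sup>2 \<noteq> 0" if w: "w \<in> Q - {complex_of_real R, \<i> * R}" for w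
    proof
      show "w\<^sup>2 - R\<^sup>2 \<noteq> 0"
      proof
        assume "w\<^sup>2 - R\<^sup>2 = 0"
        then have "(w - R) * (w + R) = 0" by (simp add: power2_eq_square algebra_simps)
        then have "w = R \<or> w = - R" by (auto simp: add_eq_0_iff2)
        then show False using w R0 by (auto simp: Q_def)
      qed
      show "w\<^sup>2 + R\<^sup>2 \<noteq> 0"
      proof
        assume "w\<^sup>2 + R\<^sup>2 = 0"
        then have "(w - \<i> * R) * (w + \<i> * R) = 0" by (simp add: power2_eq_square algebra_simps)
        then have "w = \<i> * R \<or> w = - \<i> * R" by (auto simp: add_eq_0_iff2)
        then show False using w R0 by (auto simp: Q_def)
      qed
    qed
    have "norm (g z * m z) \<le> S"
    proof (rule maximum_modulus_two_exceptional_points[where f = "\<lambda>z. g z * m z" and V = V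
          and a = "complex_of_real R" and b = "\<i> * R" and B = B])
      show "bounded V" using bounded_subset[OF \<open>bounded Q\<close> VQ] .
      have VQ': "V \<subseteq> Q - {complex_of_real R, \<i> * R}" using R0 by (auto simp: V_def Q_def)
      show "(\<lambda>z. g z * m z) holomorphic_on V"
        unfolding m_def using nz VQ'
        by (intro holomorphic_intros holomorphic_on_subset[OF hol]) (auto simp: V_def)
      show "continuous_on (closure V - {complex_of_real R, \<i> * R}) (\<lambda>z. g z * m z)"
        unfolding m_def using nz clQ
        by (intro continuous_intros continuous_on_subset[OF contQ]) auto
      show "norm (g w * m w) \<le> B" if "w \<in> closure V - {complex_of_real R, \<i> * R}" for w
      proof -
        have w: "w \<in> Q" using that clQ by auto
        have "norm (g w) * norm (m w) \<le> norm (g w) * 1"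
          using m1[of w] w by (intro mult_left_mono) (auto simp: Q_def)
        also have "\<dots> \<le> B" using B[OF w] by simp
        finally show ?thesis by (simp add: norm_mult)
      qed
      show "norm (g w * m w) \<le> S" if "w \<in> frontier V - {complex_of_real R, \<i> * R}" for w
      proof -
        have w: "w \<in> Q" "w \<notin> V" using that clQ Vo by (auto simp: frontier_def interior_open)
        have mm: "norm (m w) \<le> 1" using m1[of w] w by (auto simp: Q_def)
        consider "Re w = 0" "Im w \<ge> 0" | "Im w = 0" "Re w \<ge> 0" | "norm w = R" "0 < Re w" "0 < Im w"
          using w by (force simp: V_def Q_def)
        then show ?thesis
        proof cases
          case 1
          then have "\<i> * of_real (Im w) = w" by (simp add: complex_eq_iff)
          then have "norm (g w) \<le> S" using imag[OF 1(2)] by simp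
          then have "norm (g w) * norm (m w) \<le> S * 1" using mm S by (intro mult_mono) auto
          then show ?thesis by (simp add: norm_mult)
        next
          case 2
          then have "of_real (Re w) = w" by (simp add: complex_eq_iff)
          then have "norm (g w) \<le> S" using real[OF 2(2)] by simp
          then have "norm (g w) * norm (m w) \<le> S * 1" using mm S by (intro mult_mono) auto
          then show ?thesis by (simp add: norm_mult)
        next
          case 3
          have "norm (g w * m w) \<le> exp (C * (1 + R\<^sup>2) * R / (Re w * Im w)) * norm (m w)"
            unfolding norm_mult using growth[of w] 3 by (intro mult_right_mono) auto
          also have "\<dots> = 1" unfolding nm arc[OF 3(2,3,1)] by (simp flip: exp_add)
          finally show ?thesis using S by simp
        qed
      qed
    qed (use Vo z R0 S in \<open>auto simp: V_def\<close>)
    then have "norm (g z) \<le> S * exp (M * Im (z\<^sup>2) * s z)"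
      by (simp add: norm_mult nm exp_minus field_simps)
    \<comment> \<open>\<open>M\<close> grows like R^3 while \<open>s z\<close> decays like R^-4, so
      at a fixed z the exponent lost by undoing the multiplier is O(1 / R).\<close>
    also have "M * Im (z\<^sup>2) * s z \<le> 16 * C * q / R"
    proof -
      have z2: "norm (z\<^sup>2) \<le> R\<^sup>2 / 4"
        using power_mono[of "2 * norm z" R 2] R by (simp add: norm_power power_mult_distrib)
      have R2: "norm (complex_of_real R ^ 2) = R\<^sup>2" by (simp add: norm_power)
      have a1: "norm (z\<^sup>2 - R\<^sup>2) \<ge> 3/4 * R\<^sup>2"
        using norm_triangle_ineq2[of "complex_of_real R ^ 2" "z\<^sup>2"] z2 R2 by (simp add: norm_minus_commute)
      have a2: "norm (z\<^sup>2 + R\<^sup>2) \<ge> 3/4 * R\<^sup>2"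
        using norm_triangle_ineq2[of "complex_of_real R ^ 2" "- z\<^sup>2"] z2 R2 by (simp add: add.commute)
      have inv: "1 / t\<^sup>2 \<le> 2 / R^4" if "t \<ge> 3/4 * R\<^sup>2" for t
      proof -
        have "(3/4 * R\<^sup>2)\<^sup>2 \<le> t\<^sup>2" using that R0 by (intro power_mono) auto
        moreover have "(3/4 * R\<^sup>2)\<^sup>2 = 9/16 * R^4" by (simp add: power2_eq_square power4_eq_xxxx)
        ultimately have *: "R^4 \<le> 2 * t\<^sup>2" using zero_le_power2[of t] by linarith
        have "R^4 > 0" using R0 by simp
        then have "t\<^sup>2 > 0" using * by linarith
        then show ?thesis using * \<open>R^4 > 0\<close> by (simp add: field_simps)
      qed
      have "s z \<le> 4 / R^4" unfolding s_def using inv[OF a1] inv[OF a2] by simp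
      then have "M * q * s z \<le> M * q * (4 / R^4)" using M q by (intro mult_left_mono) auto
      also have "\<dots> \<le> (2 * C * (2 * R\<^sup>2) * R) * q * (4 / R^4)"
      proof -
        have "M \<le> 2 * C * (2 * R\<^sup>2) * R"
          unfolding M_def using C R by (intro mult_right_mono mult_left_mono) (auto simp: one_le_power)
        then show ?thesis using q R0 by (intro mult_right_mono) auto
      qed
      also have "\<dots> = 16 * C * q / R" using R0 by (simp add: field_simps power2_eq_square power4_eq_xxxx)
      finally show ?thesis by (simp add: q_def)
    qed
    finally show ?thesis using S by simp
  qed
  have "((\<lambda>R. S * exp (16 * C * q / R)) \<longlongrightarrow> S * exp 0) at_top"
    by (intro tendsto_intros tendsto_divide_0[OF tendsto_const] filterlim_at_top_imp_at_infinity filterlim_ident)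
  moreover have "\<forall>\<^sub>F R in at_top. norm (g z) \<le> S * exp (16 * C * q / R)"
    using eventually_ge_at_top[of 1] eventually_gt_at_top[of "2 * norm z"]
    by eventually_elim (use bound in auto)
  ultimately have "norm (g z) \<le> S * exp 0" by (rule tendsto_lowerbound) simp
  then show ?thesis by simp
qed

subsection \<open>Vanishing integrals in the upper half-plane\<close>

text \<open>Lets constants and linear factors be absorbed into the exponent of
  \<open>hp_growth\<close>.\<close>

lemma hp_scale_ge:
  assumes "Im z > 0"
  shows "1 \<le> (1 + (norm z)\<^sup>2) / Im z" "norm z \<le> (1 + (norm z)\<^sup>2) / Im z"
proof -
  have y: "Im z \<le> norm z" using abs_Im_le_cmod[of z] by simp
  have "2 * norm z \<le> 1 + (norm z)\<^sup>2" using sum_squares_bound[of 1 "norm z"] by simp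
  then show "1 \<le> (1 + (norm z)\<^sup>2) / Im z" using y assms by (simp add: field_simps)
  have "norm z * Im z \<le> norm z * norm z" using y by (intro mult_left_mono) auto
  then show "norm z \<le> (1 + (norm z)\<^sup>2) / Im z" using assms by (simp add: field_simps power2_eq_square)
qed

section \<open>Closure properties of the two growth classes\<close>

lemma hp_growthE:
  assumes "hp_growth f"
  obtains C where "C \<ge> 0" "\<And>z. Im z > 0 \<Longrightarrow> norm (f z) \<le> exp (C * ((1 + (norm z)\<^sup>2) / Im z))"
proof -
  obtain C where C: "\<And>z. Im z > 0 \<Longrightarrow> norm (f z) \<le> exp (C * ((1 + (norm z)\<^sup>2) / Im z))"
    using assms unfolding hp_growth_def by blast
  have "norm (f z) \<le> exp (max C 0 * ((1 + (norm z)\<^sup>2) / Im z))" if "Im z > 0" for z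
  proof -
    have "C * ((1 + (norm z)\<^sup>2) / Im z) \<le> max C 0 * ((1 + (norm z)\<^sup>2) / Im z)"
      using that by (intro mult_right_mono) auto
    then show ?thesis using C[OF that] by (meson exp_le_cancel_iff order_trans)
  qed
  then show thesis using that[of "max C 0"] by simp
qed

lemma hp_growth_mult:
  assumes "hp_growth f" "hp_growth g"
  shows "hp_growth (\<lambda>z. f z * g z)"
proof -
  obtain C where C: "C \<ge> 0" "\<And>z. Im z > 0 \<Longrightarrow> norm (f z) \<le> exp (C * ((1 + (norm z)\<^sup>2) / Im z))"
    using hp_growthE[OF assms(1)] by blast
  obtain D where D: "D \<ge> 0" "\<And>z. Im z > 0 \<Longrightarrow> norm (g z) \<le> exp (D * ((1 + (norm z)\<^sup>2) / Im z))"
    using hp_growthE[OF assms(2)] by blast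
  have "norm (f z * g z) \<le> exp ((C + D) * ((1 + (norm z)\<^sup>2) / Im z))" if "Im z > 0" for z
    unfolding norm_mult distrib_right exp_add using C(2) D(2) that by (intro mult_mono) auto
  then show ?thesis unfolding hp_growth_def by blast
qed

lemma hp_growth_linear_bound:
  assumes "\<And>z. Im z > 0 \<Longrightarrow> norm (f z) \<le> B * (1 + norm z)"
  shows "hp_growth f"
proof -
  have "norm (f z) \<le> exp ((\<bar>B\<bar> + 1) * ((1 + (norm z)\<^sup>2) / Im z))" if "Im z > 0" for z
  proof -
    note T = hp_scale_ge[OF that]
    have "norm (f z) \<le> \<bar>B\<bar> * (1 + norm z)"
      using assms[OF that] by (rule order_trans) (intro mult_right_mono, auto)
    also have "\<dots> \<le> exp \<bar>B\<bar> * exp (norm z)"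
    proof (intro mult_mono)
      show "\<bar>B\<bar> \<le> exp \<bar>B\<bar>" using exp_ge_add_one_self[of "\<bar>B\<bar>"] by linarith
    qed auto
    also have "\<dots> = exp (\<bar>B\<bar> * 1 + norm z)" by (simp add: exp_add)
    also have "\<dots> \<le> exp (\<bar>B\<bar> * ((1 + (norm z)\<^sup>2) / Im z) + (1 + (norm z)\<^sup>2) / Im z)"
      using T by (intro iffD2[OF exp_le_cancel_iff] add_mono mult_left_mono) auto
    finally show ?thesis unfolding distrib_right[of "\<bar>B\<bar>"] by simp
  qed
  then show ?thesis unfolding hp_growth_def by blast
qed

lemma hp_growth_add:
  assumes "hp_growth f" "hp_growth g"
  shows "hp_growth (\<lambda>z. f z + g z)"
proof -
  obtain C where C: "C \<ge> 0" "\<And>z. Im z > 0 \<Longrightarrow> norm (f z) \<le> exp (C * ((1 + (norm z)\<^sup>2) / Im z))"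
    using hp_growthE[OF assms(1)] by blast
  obtain D where D: "D \<ge> 0" "\<And>z. Im z > 0 \<Longrightarrow> norm (g z) \<le> exp (D * ((1 + (norm z)\<^sup>2) / Im z))"
    using hp_growthE[OF assms(2)] by blast
  have "norm (f z + g z) \<le> exp ((C + D + 1) * ((1 + (norm z)\<^sup>2) / Im z))" if z: "Im z > 0" for z
  proof -
    let ?T = "(1 + (norm z)\<^sup>2) / Im z"
    have T: "?T \<ge> 1" using hp_scale_ge[OF z] by simp
    have "norm (f z + g z) \<le> exp (C * ?T) + exp (D * ?T)"
      using norm_triangle_ineq[of "f z" "g z"] C(2)[OF z] D(2)[OF z] by linarith
    also have "\<dots> \<le> exp ((C + D) * ?T) + exp ((C + D) * ?T)"
      using C(1) D(1) T by (intro add_mono iffD2[OF exp_le_cancel_iff] mult_right_mono) auto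
    also have "\<dots> = 2 * exp ((C + D) * ?T)" by simp
    also have "\<dots> \<le> exp ?T * exp ((C + D) * ?T)"
    proof (intro mult_right_mono)
      show "2 \<le> exp ?T" using exp_ge_add_one_self[of ?T] T by linarith
    qed auto
    finally show ?thesis by (simp add: exp_add[symmetric] algebra_simps add_divide_distrib)
  qed
  then show ?thesis unfolding hp_growth_def by blast
qed

text \<open>Non-positive mean type freed from the logarithm: in this form sums and products stay in
  the class, and zeros on the imaginary axis are harmless.\<close>

definition subexp_imag :: "(complex \<Rightarrow> complex) \<Rightarrow> bool" where
  "subexp_imag f \<longleftrightarrow>
     (\<forall>\<epsilon>>0. \<forall>\<^sub>F y in at_top. norm (f (\<i> * complex_of_real y)) \<le> exp (\<epsilon> * y))"

lemma subexp_imag_mult: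
  assumes "subexp_imag f" "subexp_imag g"
  shows "subexp_imag (\<lambda>z. f z * g z)"
  unfolding subexp_imag_def
proof (intro allI impI)
  fix \<epsilon> :: real assume "\<epsilon> > 0"
  then have h: "\<epsilon> / 2 > 0" by simp
  show "\<forall>\<^sub>F y in at_top. norm (f (\<i> * complex_of_real y) * g (\<i> * complex_of_real y)) \<le> exp (\<epsilon> * y)"
    using assms[unfolded subexp_imag_def, rule_format, OF h]
  proof eventually_elim
    case (elim y)
    have "norm (f (\<i> * complex_of_real y)) * norm (g (\<i> * complex_of_real y)) \<le> exp (\<epsilon>/2 * y) * exp (\<epsilon>/2 * y)"
      using elim by (intro mult_mono) auto
    then show ?case by (simp add: norm_mult flip: exp_add)
  qed
qed

lemma subexp_imag_linear_bound:
  assumes "\<And>z. Im z > 0 \<Longrightarrow> norm (f z) \<le> B * (1 + norm z)"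
  shows "subexp_imag f"
  unfolding subexp_imag_def
proof (intro allI impI)
  fix \<epsilon> :: real assume "\<epsilon> > 0"
  then have "\<forall>\<^sub>F y in at_top. B * (1 + y) \<le> exp (\<epsilon> * y)" by real_asymp
  then show "\<forall>\<^sub>F y in at_top. norm (f (\<i> * complex_of_real y)) \<le> exp (\<epsilon> * y)"
    using eventually_gt_at_top[of 0]
  proof eventually_elim
    case (elim y)
    then show ?case using assms[of "\<i> * complex_of_real y"] by (simp add: norm_mult)
  qed
qed

lemma subexp_imag_add:
  assumes "subexp_imag f" "subexp_imag g"
  shows "subexp_imag (\<lambda>z. f z + g z)"
  unfolding subexp_imag_def
proof (intro allI impI)
  fix \<epsilon> :: real assume e: "\<epsilon> > 0"
  then have h: "\<epsilon> / 2 > 0" by simp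
  have "\<forall>\<^sub>F y in at_top. 2 * exp (\<epsilon> / 2 * y) \<le> exp (\<epsilon> * y)" using e by real_asymp
  then show "\<forall>\<^sub>F y in at_top. norm (f (\<i> * complex_of_real y) + g (\<i> * complex_of_real y)) \<le> exp (\<epsilon> * y)"
    using assms[unfolded subexp_imag_def, rule_format, OF h]
  proof eventually_elim
    case (elim y)
    then show ?case
      using norm_triangle_ineq[of "f (\<i> * complex_of_real y)" "g (\<i> * complex_of_real y)"] by linarith
  qed
qed

lemma mean_type_nonpos_imp_subexp_imag:
  assumes "mean_type_nonpos h"
  shows "subexp_imag h"
  unfolding subexp_imag_def
proof (intro allI impI)
  fix \<epsilon> :: real assume e: "\<epsilon> > 0"
  have "Limsup at_top (\<lambda>y::real. ereal (ln (norm (h (\<i> * complex_of_real y))) / y)) < ereal \<epsilon>"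
    using assms e unfolding mean_type_nonpos_def by (simp add: le_less_trans)
  then have "\<forall>\<^sub>F y in at_top. ereal (ln (norm (h (\<i> * complex_of_real y))) / y) < ereal \<epsilon>"
    by (rule Limsup_lessD)
  then show "\<forall>\<^sub>F y in at_top. norm (h (\<i> * complex_of_real y)) \<le> exp (\<epsilon> * y)"
    using eventually_gt_at_top[of 0]
  proof eventually_elim
    case (elim y)
    then have "ln (norm (h (\<i> * complex_of_real y))) < \<epsilon> * y" by (simp add: field_simps)
    \<comment> \<open>At a zero of \<open>h\<close> the logarithm carries no information, but there
      the bound is trivial.\<close>
    then show ?case
      by (cases "h (\<i> * complex_of_real y) = 0")
         (auto, metis exp_le_cancel_iff exp_ln less_imp_le zero_less_norm_iff)
  qed
qed

section \<open>Primitives on the closed upper half-plane\<close>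

text \<open>The half-plane is convex, so a primitive exists. Differentiating within the closed
  half-plane lets the same primitive serve for the fundamental theorem on the real line and for
  estimates inside.\<close>

lemma Im_ge_0_primitive:
  assumes cont: "continuous_on {z. 0 \<le> Im z} f" and hol: "f holomorphic_on {z. 0 < Im z}"
  obtains U where "U 0 = 0" "\<And>z. 0 \<le> Im z \<Longrightarrow> (U has_field_derivative f z) (at z within {z. 0 \<le> Im z})"
proof -
  have "f field_differentiable at x" if "x \<in> interior {z. 0 \<le> Im z} - {}" for x
  proof -
    have "interior {z. 0 \<le> Im z} = {z. 0 < Im z}"
      using interior_halfspace_ge[of "\<i>" 0] by (simp add: inner_complex_def)
    moreover have "open {z. 0 < Im z}" by (rule open_halfspace_Im_gt)
    ultimately show ?thesis using hol that by (auto simp: holomorphic_on_imp_differentiable_at)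
  qed
  then obtain g where g: "\<And>x. x \<in> {z. 0 \<le> Im z} \<Longrightarrow> (g has_field_derivative f x) (at x within {z. 0 \<le> Im z})"
    using holomorphic_convex_primitive[OF convex_halfspace_Im_ge finite.emptyI cont] by metis
  have "((\<lambda>z. g z - g 0) has_field_derivative f z) (at z within {z. 0 \<le> Im z})" if "0 \<le> Im z" for z
    using DERIV_diff[OF g DERIV_const, of z "g 0"] that by simp
  then show thesis using that[of "\<lambda>z. g z - g 0"] by simp
qed

lemma Im_ge_0_FTC_real:
  assumes U: "\<And>z. 0 \<le> Im z \<Longrightarrow> (U has_field_derivative u z) (at z within {z. 0 \<le> Im z})" and "a \<le> b"
  shows "((\<lambda>x. u (complex_of_real x)) has_integral (U b - U a)) {a..b}"
proof (rule fundamental_theorem_of_calculus[OF \<open>a \<le> b\<close>])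
  fix x assume "x \<in> {a..b}"
  have "(complex_of_real has_vector_derivative 1) (at x within {a..b})"
    using has_vector_derivative_of_real[OF DERIV_ident] by simp
  moreover have "(U has_field_derivative u (complex_of_real x)) (at (complex_of_real x) within complex_of_real ` {a..b})"
    by (rule has_field_derivative_subset[OF U]) auto
  ultimately have "((U \<circ> complex_of_real) has_vector_derivative (1 * u (complex_of_real x))) (at x within {a..b})"
    by (rule field_vector_diff_chain_within)
  then show "((\<lambda>x. U (complex_of_real x)) has_vector_derivative u (complex_of_real x)) (at x within {a..b})"
    by (simp add: o_def)
qed

text \<open>\<open>U z\<close> is estimated along the segment from 0. At the point t z the scale is
  (1 / t + t |z|^2) / Im z, which blows up for small t. Outside the unit disc, however, 1 / t \<le>
  |z|, so the scale at most doubles; inside the unit disc continuity up to the boundary bounds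
  \<open>f\<close>.\<close>

lemma Im_ge_0_primitive_growth:
  assumes cont: "continuous_on {z. 0 \<le> Im z} f" and gr: "hp_growth f"
    and U: "\<And>z. 0 \<le> Im z \<Longrightarrow> (U has_field_derivative f z) (at z within {z. 0 \<le> Im z})" and U0: "U 0 = 0"
  shows "hp_growth U"
proof -
  obtain C where C: "C \<ge> 0" "\<And>z. Im z > 0 \<Longrightarrow> norm (f z) \<le> exp (C * ((1 + (norm z)\<^sup>2) / Im z))"
    using hp_growthE[OF gr] by blast
  define D where "D = {z. 0 \<le> Im z} \<inter> cball 0 1"
  have "compact D" unfolding D_def by (intro closed_Int_compact closed_halfspace_Im_ge) auto
  moreover have "continuous_on D f" by (rule continuous_on_subset[OF cont]) (auto simp: D_def)
  ultimately have "bounded (f ` D)" by (intro compact_imp_bounded compact_continuous_image)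
  then obtain K where K: "K > 0" "\<And>z. z \<in> D \<Longrightarrow> norm (f z) \<le> K" unfolding bounded_pos by auto
  have "norm (U z) \<le> (K + 1) * (1 + norm z) * exp (2 * C * ((1 + (norm z)\<^sup>2) / Im z))"
    if z: "Im z > 0" for z
  proof -
    let ?T = "(1 + (norm z)\<^sup>2) / Im z"
    let ?B = "(K + 1) * exp (2 * C * ?T)"
    have T: "?T \<ge> 1" using hp_scale_ge[OF z] by simp
    have "0 \<le> 2 * C * ?T" using C(1) T by (intro mult_nonneg_nonneg) auto
    then have e1: "1 \<le> exp (2 * C * ?T)" by simp
    have seg: "closed_segment 0 z \<subseteq> {z. 0 \<le> Im z}"
      using z by (intro closed_segment_subset convex_halfspace_Im_ge) auto
    have fb: "norm (f w) \<le> ?B" if w: "w \<in> closed_segment 0 z" for w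
    proof (cases "norm w \<le> 1")
      case True
      then have "norm (f w) \<le> K" using K w seg by (auto simp: D_def)
      also have "\<dots> \<le> (K + 1) * 1" by simp
      also have "\<dots> \<le> ?B" using K e1 by (intro mult_left_mono) auto
      finally show ?thesis .
    next
      case False
      obtain t where t: "0 \<le> t" "t \<le> 1" "w = t *\<^sub>R z" using w by (auto simp: closed_segment_def)
      have t0: "t > 0" using t False by (cases "t = 0") auto
      have nw: "norm w = t * norm z" "Im w = t * Im z" using t by auto
      have "1 \<le> t * norm z" using False nw by simp
      then have "1 / t \<le> norm z" using t0 by (simp add: field_simps)
      moreover have "norm z \<le> 1 + (norm z)\<^sup>2" using sum_squares_bound[of 1 "norm z"] norm_ge_zero[of z] by (simp add: power2_eq_square) (smt (verit) norm_ge_zero)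
      moreover have "t * (norm z)\<^sup>2 \<le> 1 * (norm z)\<^sup>2" using t by (intro mult_right_mono) auto
      ultimately have "1 / t + t * (norm z)\<^sup>2 \<le> 2 * (1 + (norm z)\<^sup>2)" by simp
      then have "(1 / t + t * (norm z)\<^sup>2) / Im z \<le> 2 * (1 + (norm z)\<^sup>2) / Im z"
        using z by (intro divide_right_mono) auto
      moreover have "(1 + (norm w)\<^sup>2) / Im w = (1 / t + t * (norm z)\<^sup>2) / Im z"
        unfolding nw using t0 z by (simp add: field_simps power2_eq_square)
      ultimately have "(1 + (norm w)\<^sup>2) / Im w \<le> 2 * ?T" by simp
      then have "C * ((1 + (norm w)\<^sup>2) / Im w) \<le> C * (2 * ?T)" using C(1) by (rule mult_left_mono)
      also have "C * (2 * ?T) = 2 * C * ?T" by (simp only: mult.assoc mult.left_commute)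
      finally have "exp (C * ((1 + (norm w)\<^sup>2) / Im w)) \<le> exp (2 * C * ?T)"
        by (simp only: exp_le_cancel_iff)
      moreover have "norm (f w) \<le> exp (C * ((1 + (norm w)\<^sup>2) / Im w))"
        using C(2)[of w] nw t0 z by simp
      moreover have "1 * exp (2 * C * ?T) \<le> ?B" using K by (intro mult_right_mono) auto
      ultimately show ?thesis by linarith
    qed
    have "norm (U z - U 0) \<le> ?B * norm (z - 0)"
      by (rule field_differentiable_bound[OF convex_closed_segment[of 0 z] _ fb])
         (use seg in \<open>auto intro!: has_field_derivative_subset[OF U]\<close>)
    then have "norm (U z) \<le> ?B * norm z" by (simp add: U0)
    also have "\<dots> \<le> ?B * (1 + norm z)" using K by (intro mult_left_mono) auto
    finally show ?thesis by (simp add: mult_ac)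
  qed
  moreover have "hp_growth (\<lambda>z. of_real ((K + 1) * (1 + norm z)) * of_real (exp (2 * C * ((1 + (norm z)\<^sup>2) / Im z))))"
  proof (rule hp_growth_mult)
    show "hp_growth (\<lambda>z. of_real ((K + 1) * (1 + norm z)))"
      using K by (intro hp_growth_linear_bound[where B = "K + 1"]) (auto simp del: of_real_mult of_real_add)
    show "hp_growth (\<lambda>z. of_real (exp (2 * C * ((1 + (norm z)\<^sup>2) / Im z))))"
      unfolding hp_growth_def by (intro exI[of _ "2 * C"]) auto
  qed
  ultimately show ?thesis
    using K unfolding hp_growth_def norm_mult norm_of_real
    by (auto simp: abs_mult) (metis (no_types, opaque_lifting) order_trans)
qed

text \<open>Half of the exponent is kept in reserve to absorb the length y of the segment of
  integration; the initial range, where the subexponential bound need not hold yet, is covered by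
  compactness.\<close>

lemma Im_ge_0_primitive_subexp:
  assumes cont: "continuous_on {z. 0 \<le> Im z} f" and se: "subexp_imag f" and \<epsilon>: "\<epsilon> > 0"
    and U: "\<And>z. 0 \<le> Im z \<Longrightarrow> (U has_field_derivative f z) (at z within {z. 0 \<le> Im z})" and U0: "U 0 = 0"
  obtains K where "\<And>y. 0 \<le> y \<Longrightarrow> norm (U (\<i> * complex_of_real y)) \<le> K * exp (\<epsilon> * y)"
proof -
  define \<delta> where "\<delta> = \<epsilon> / 2"
  have \<delta>: "\<delta> > 0" using \<epsilon> by (simp add: \<delta>_def)
  obtain Y where Y: "\<And>y. y \<ge> Y \<Longrightarrow> norm (f (\<i> * complex_of_real y)) \<le> exp (\<delta> * y)"
    using se \<delta> unfolding subexp_imag_def eventually_at_top_linorder by blast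
  have "bounded ((\<lambda>y. f (\<i> * complex_of_real y)) ` {0..Y})"
    by (intro compact_imp_bounded compact_continuous_image continuous_on_compose2[OF cont] continuous_intros) auto
  then obtain K where K: "K > 0" "\<And>y. y \<in> {0..Y} \<Longrightarrow> norm (f (\<i> * complex_of_real y)) \<le> K"
    unfolding bounded_pos by auto
  have fb: "norm (f (\<i> * complex_of_real y)) \<le> (K + 1) * exp (\<delta> * y)" if y: "0 \<le> y" for y
  proof (cases "y \<le> Y")
    case True
    have "K * 1 \<le> (K + 1) * exp (\<delta> * y)" using K \<delta> y by (intro mult_mono) auto
    then show ?thesis using K(2)[of y] True y by auto
  next
    case False
    have "1 * exp (\<delta> * y) \<le> (K + 1) * exp (\<delta> * y)" using K by (intro mult_right_mono) auto
    moreover have "norm (f (\<i> * complex_of_real y)) \<le> exp (\<delta> * y)" using Y[of y] False by simp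
    ultimately show ?thesis by linarith
  qed
  have "norm (U (\<i> * complex_of_real y)) \<le> (K + 1) / \<delta> * exp (\<epsilon> * y)" if y: "0 \<le> y" for y
  proof -
    let ?S = "closed_segment 0 (\<i> * complex_of_real y)"
    have seg: "?S \<subseteq> {z. 0 \<le> Im z}"
      using y by (intro closed_segment_subset convex_halfspace_Im_ge) auto
    have "norm (f w) \<le> (K + 1) * exp (\<delta> * y)" if w: "w \<in> ?S" for w
    proof -
      obtain t where t: "0 \<le> t" "t \<le> 1" "w = t *\<^sub>R (\<i> * complex_of_real y)" using w by (auto simp: closed_segment_def)
      then have "w = \<i> * complex_of_real (t * y)" by (simp add: scaleR_conv_of_real)
      then have "norm (f w) \<le> (K + 1) * exp (\<delta> * (t * y))" using fb[of "t * y"] t y by simp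
      also have "\<dots> \<le> (K + 1) * exp (\<delta> * y)"
        using K \<delta> t y by (intro mult_left_mono) (auto simp: mult_left_le_one_le)
      finally show ?thesis .
    qed
    then have "norm (U (\<i> * complex_of_real y) - U 0) \<le> ((K + 1) * exp (\<delta> * y)) * norm (\<i> * complex_of_real y - 0)"
      by (intro field_differentiable_bound[OF convex_closed_segment[of 0 "\<i> * complex_of_real y"]])
         (use seg in \<open>auto intro!: has_field_derivative_subset[OF U]\<close>)
    then have "norm (U (\<i> * complex_of_real y)) \<le> (K + 1) * exp (\<delta> * y) * y"
      using y by (simp add: U0 norm_mult)
    also have "\<dots> \<le> (K + 1) * exp (\<delta> * y) * (exp (\<delta> * y) / \<delta>)"
    proof -
      have "\<delta> * y \<le> exp (\<delta> * y)" using exp_ge_add_one_self[of "\<delta> * y"] by linarith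
      then have "y \<le> exp (\<delta> * y) / \<delta>" using \<delta> by (simp add: field_simps)
      then show ?thesis using K by (intro mult_left_mono) auto
    qed
    also have "\<dots> = (K + 1) / \<delta> * (exp (\<delta> * y) * exp (\<delta> * y))" by simp
    also have "exp (\<delta> * y) * exp (\<delta> * y) = exp (\<epsilon> * y)"
      by (simp add: \<delta>_def flip: exp_add)
    finally show ?thesis .
  qed
  then show thesis using that by blast
qed

lemma norm_integral_real_segment_le:
  fixes f :: "complex \<Rightarrow> complex"
  assumes int: "integrable lborel (\<lambda>x::real. f (complex_of_real x))"
    and U: "\<And>z. 0 \<le> Im z \<Longrightarrow> (U has_field_derivative f z) (at z within {z. 0 \<le> Im z})" and "a \<le> b"
  shows "norm (U (complex_of_real b) - U (complex_of_real a)) \<le> (LINT x|lborel. norm (f (complex_of_real x)))"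
proof -
  have si: "set_integrable lborel {a..b} (\<lambda>x. f (complex_of_real x))"
    unfolding set_integrable_def using int by (rule integrable_mult_indicator[rotated]) simp
  have "U (complex_of_real b) - U (complex_of_real a) = (LINT x:{a..b}|lborel. f (complex_of_real x))"
    using set_borel_integral_eq_integral(2)[OF si] Im_ge_0_FTC_real[OF U \<open>a \<le> b\<close>] by (simp add: integral_unique)
  also have "norm \<dots> \<le> (LINT x|lborel. norm (indicator {a..b} x *\<^sub>R f (complex_of_real x)))"
    unfolding set_lebesgue_integral_def by (rule integral_norm_bound)
  also have "\<dots> \<le> (LINT x|lborel. norm (f (complex_of_real x)))"
    using si int unfolding set_integrable_def
    by (intro integral_mono integrable_norm) (auto simp: indicator_def)
  finally show ?thesis .
qed

section \<open>Vanishing of the integral by a cutoff\<close>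

text \<open>The factor |z| / |Re z| \<ge> 1 weakens the growth bound to one that is symmetric in Re
  and Im, as in the quadrant principle. The second quadrant is reached by w -> i w, which exchanges
  the roles of the two boundary bounds.\<close>

lemma bounded_of_quadrant_bounds:
  assumes cont: "continuous_on {z. 0 \<le> Im z} g" and hol: "g holomorphic_on {z. 0 < Im z}"
    and gr: "hp_growth g"
    and real: "\<And>x. norm (g (complex_of_real x)) \<le> S"
    and imag: "\<And>y. 0 \<le> y \<Longrightarrow> norm (g (\<i> * complex_of_real y)) \<le> S"
    and S: "S \<ge> 1" and z: "0 \<le> Im z"
  shows "norm (g z) \<le> S"
proof -
  obtain C where C: "C \<ge> 0" "\<And>z. Im z > 0 \<Longrightarrow> norm (g z) \<le> exp (C * ((1 + (norm z)\<^sup>2) / Im z))"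
    using hp_growthE[OF gr] by blast
  have scale: "C * ((1 + (norm w)\<^sup>2) / Im w) \<le> C * (1 + (norm w)\<^sup>2) * norm w / (\<bar>Re w\<bar> * Im w)"
    if "Re w \<noteq> 0" "Im w > 0" for w
  proof -
    have "C * ((1 + (norm w)\<^sup>2) / Im w) * 1 \<le> C * ((1 + (norm w)\<^sup>2) / Im w) * (norm w / \<bar>Re w\<bar>)"
      using that C abs_Re_le_cmod[of w] by (intro mult_left_mono) (auto simp: field_simps)
    then show ?thesis by (simp add: field_simps)
  qed
  consider "Re z = 0" | "Im z = 0" | "Re z > 0" "Im z > 0" | "Re z < 0" "Im z > 0" using z by linarith
  then show ?thesis
  proof cases
    case 1
    then have "\<i> * of_real (Im z) = z" by (simp add: complex_eq_iff)
    then show ?thesis using imag[OF z] by simp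
  next
    case 2
    then have "of_real (Re z) = z" by (simp add: complex_eq_iff)
    then show ?thesis using real[of "Re z"] by simp
  next
    case 3
    show ?thesis
    proof (rule Phragmen_Lindelof_quadrant[OF _ _ real imag _ S C(1) 3])
      show "continuous_on {z. 0 \<le> Re z \<and> 0 \<le> Im z} g"
        by (rule continuous_on_subset[OF cont]) auto
      show "g holomorphic_on {z. 0 < Re z \<and> 0 < Im z}"
        by (rule holomorphic_on_subset[OF hol]) auto
      show "norm (g w) \<le> exp (C * (1 + (norm w)\<^sup>2) * norm w / (Re w * Im w))"
        if "0 < Re w" "0 < Im w" for w
        using order_trans[OF C(2)[of w] iffD2[OF exp_le_cancel_iff scale[of w]]] that by simp
    qed
  next
    case 4
    have "norm (g (\<i> * (- \<i> * z))) \<le> S"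
    proof (rule Phragmen_Lindelof_quadrant[where g = "\<lambda>w. g (\<i> * w)", OF _ _ imag _ _ S C(1)])
      show "continuous_on {z. 0 \<le> Re z \<and> 0 \<le> Im z} (\<lambda>w. g (\<i> * w))"
        by (rule continuous_on_compose2[OF cont]) (auto intro!: continuous_intros)
      show "(\<lambda>w. g (\<i> * w)) holomorphic_on {z. 0 < Re z \<and> 0 < Im z}"
        by (rule holomorphic_on_compose_gen[OF _ hol, unfolded o_def]) (auto intro!: holomorphic_intros)
      show "norm (g (\<i> * w)) \<le> exp (C * (1 + (norm w)\<^sup>2) * norm w / (Re w * Im w))"
        if "0 < Re w" "0 < Im w" for w
        using order_trans[OF C(2)[of "\<i> * w"] iffD2[OF exp_le_cancel_iff scale[of "\<i> * w"]]] that
        by (simp add: norm_mult mult.commute)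
      show "norm (g (\<i> * (\<i> * complex_of_real y))) \<le> S" for y
        using real[of "- y"] by (simp flip: mult.assoc)
    qed (use 4 in auto)
    then show ?thesis by (simp flip: mult.assoc)
  qed
qed

text \<open>The form is chosen so that each summand is O(\<epsilon> / |1 - i \<epsilon> z|^2) in the
  closed upper half-plane, where |1 - i \<epsilon> z| \<ge> 1.\<close>

lemma has_field_derivative_cutoff:
  assumes "1 - \<i> * \<epsilon> * z \<noteq> 0"
  shows "((\<lambda>z. exp (2 * \<i> * \<epsilon> * z) / (1 - \<i> * \<epsilon> * z)\<^sup>2) has_field_derivative
     exp (2 * \<i> * \<epsilon> * z) * (2 * \<i> * \<epsilon> / (1 - \<i> * \<epsilon> * z)\<^sup>2 + 2 * \<i> * \<epsilon> / (1 - \<i> * \<epsilon> * z) ^ 3)) (at z within S)"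
proof -
  let ?e = "exp (2 * \<i> * \<epsilon> * z)" and ?d = "1 - \<i> * \<epsilon> * z"
  have deriv: "((\<lambda>z. exp (2 * \<i> * \<epsilon> * z) / (1 - \<i> * \<epsilon> * z)\<^sup>2) has_field_derivative
     (?e * (2 * \<i> * \<epsilon>) * ?d\<^sup>2 - ?e * (2 * ?d * (- (\<i> * \<epsilon>)))) / (?d\<^sup>2 * ?d\<^sup>2)) (at z within S)"
    by (rule DERIV_divide) (use assms in \<open>auto intro!: derivative_eq_intros\<close>)
  have alg: "(e * a * d\<^sup>2 - e * (2 * d * (- b))) / (d\<^sup>2 * d\<^sup>2) = e * (a / d\<^sup>2 + a / d ^ 3)"
    if "d \<noteq> 0" "a = 2 * b" for e a b d :: complex
    using that by (simp add: field_simps power2_eq_square power3_eq_cube)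
  have two: "2 * \<i> * \<epsilon> = 2 * (\<i> * \<epsilon>)" by simp
  from deriv show ?thesis unfolding alg[OF assms two] .
qed

text \<open>The primitive \<open>U\<close> of \<open>f\<close> is bounded on the real line and \<open>O(exp (\<epsilon> y))\<close> on the imaginary axis, so
  \<open>U z * exp (\<i> \<epsilon> z)\<close> is bounded. Integration by parts moves the derivative to the cutoff.\<close>
lemma integral_eq_0_cutoff:
  assumes cont: "continuous_on {z. 0 \<le> Im z} f" and hol: "f holomorphic_on {z. 0 < Im z}"
    and gr: "hp_growth f" and se: "subexp_imag f"
    and int: "integrable lborel (\<lambda>x::real. f (complex_of_real x))"
    and e: "\<epsilon> > 0"
  shows "(LINT x|lborel. f (complex_of_real x) *
     (exp (2 * \<i> * complex_of_real \<epsilon> * x) / (1 - \<i> * complex_of_real \<epsilon> * x)\<^sup>2)) = 0"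
proof -
  let ?H = "{z. 0 \<le> Im z}"
  obtain U where U0: "U 0 = 0" and U: "\<And>z. 0 \<le> Im z \<Longrightarrow> (U has_field_derivative f z) (at z within ?H)"
    using Im_ge_0_primitive[OF cont hol] by blast
  have contU: "continuous_on ?H U"
    using U by (auto simp: continuous_on_eq_continuous_within intro: has_field_derivative_imp_has_derivative has_derivative_continuous)
  have op: "open {z. 0 < Im z}" by (rule open_halfspace_Im_gt)
  have holU: "U holomorphic_on {z. 0 < Im z}"
    unfolding holomorphic_on_def field_differentiable_def
    using U by (auto intro!: exI has_field_derivative_subset[OF U])
  have grU: "hp_growth U" by (rule Im_ge_0_primitive_growth[OF cont gr U U0])
  define N where "N = (LINT x|lborel. norm (f (complex_of_real x)))"
  have N: "norm (U (complex_of_real x)) \<le> N" for x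
    using norm_integral_real_segment_le[OF int U, of 0 x] norm_integral_real_segment_le[OF int U, of x 0]
    by (cases "x \<ge> 0") (auto simp: N_def U0)
  obtain K where K: "\<And>y. 0 \<le> y \<Longrightarrow> norm (U (\<i> * complex_of_real y)) \<le> K * exp (\<epsilon> * y)"
    using Im_ge_0_primitive_subexp[OF cont se e U U0] by blast
  define S where "S = max 1 (max N K)"
  have ne: "norm (exp (\<i> * complex_of_real \<epsilon> * z)) = exp (- \<epsilon> * Im z)" for z by simp
  have ne1: "norm (exp (\<i> * complex_of_real \<epsilon> * z)) \<le> 1" if "0 \<le> Im z" for z
    unfolding ne using e that by simp
  have bd: "norm (U z * exp (\<i> * complex_of_real \<epsilon> * z)) \<le> S" if "0 \<le> Im z" for z
  proof (rule bounded_of_quadrant_bounds[OF _ _ _ _ _ _ that])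
    show "continuous_on ?H (\<lambda>z. U z * exp (\<i> * complex_of_real \<epsilon> * z))"
      by (intro continuous_intros contU)
    show "(\<lambda>z. U z * exp (\<i> * complex_of_real \<epsilon> * z)) holomorphic_on {z. 0 < Im z}"
      by (intro holomorphic_intros holU)
    have "hp_growth (\<lambda>z. exp (\<i> * complex_of_real \<epsilon> * z))"
    proof (rule hp_growth_linear_bound[where B = 1])
      show "norm (exp (\<i> * complex_of_real \<epsilon> * z)) \<le> 1 * (1 + norm z)" if "Im z > 0" for z
        using order_trans[OF ne1[OF less_imp_le[OF that]], of "1 * (1 + norm z)"] by simp
    qed
    then show "hp_growth (\<lambda>z. U z * exp (\<i> * complex_of_real \<epsilon> * z))"
      by (rule hp_growth_mult[OF grU])
    show "norm (U (complex_of_real x) * exp (\<i> * complex_of_real \<epsilon> * complex_of_real x)) \<le> S" for x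
      using N[of x] by (simp add: norm_mult S_def)
    show "norm (U (\<i> * complex_of_real y) * exp (\<i> * complex_of_real \<epsilon> * (\<i> * complex_of_real y))) \<le> S"
      if "0 \<le> y" for y
    proof -
      have "norm (U (\<i> * complex_of_real y)) * exp (- \<epsilon> * y) \<le> K * exp (\<epsilon> * y) * exp (- \<epsilon> * y)"
        using K[OF that] by (intro mult_right_mono) auto
      also have "\<dots> = K" by (simp add: exp_minus)
      finally show ?thesis unfolding norm_mult ne by (simp add: S_def)
    qed
  qed (simp add: S_def)
  have S1: "S \<ge> 1" by (simp add: S_def)
  \<comment> \<open>One factor exp (i \<epsilon> z) makes \<open>U\<close> bounded, the other has
    modulus at most 1, and the squared denominator supplies decay of order |z|^-2. Hence
    \<open>U * k\<close> vanishes at infinity, and \<open>U * k'\<close> beats the length of a large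
    semicircle.\<close>
  define k where "k z = exp (2 * \<i> * complex_of_real \<epsilon> * z) / (1 - \<i> * complex_of_real \<epsilon> * z)\<^sup>2" for z
  define k' where "k' z = exp (2 * \<i> * complex_of_real \<epsilon> * z) *
      (2 * \<i> * \<epsilon> / (1 - \<i> * complex_of_real \<epsilon> * z)\<^sup>2 + 2 * \<i> * \<epsilon> / (1 - \<i> * complex_of_real \<epsilon> * z) ^ 3)" for z
  have den: "1 + (\<epsilon> * norm z)\<^sup>2 \<le> (norm (1 - \<i> * complex_of_real \<epsilon> * z))\<^sup>2" if "0 \<le> Im z" for z
  proof -
    have "(norm (1 - \<i> * complex_of_real \<epsilon> * z))\<^sup>2 = 1 + (\<epsilon> * norm z)\<^sup>2 + 2 * \<epsilon> * Im z"
      unfolding power_mult_distrib cmod_power2 by (simp add: power2_eq_square algebra_simps)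
    then show ?thesis using that e by simp
  qed
  have den1: "1 \<le> norm (1 - \<i> * complex_of_real \<epsilon> * z)" if "0 \<le> Im z" for z
  proof -
    have "1\<^sup>2 \<le> (norm (1 - \<i> * complex_of_real \<epsilon> * z))\<^sup>2" 
      unfolding one_power2 using den[OF that] zero_le_power2[of "\<epsilon> * norm z"] by linarith
    then show ?thesis by (rule power2_le_imp_le) simp
  qed
  have nz: "1 - \<i> * complex_of_real \<epsilon> * z \<noteq> 0" if "0 \<le> Im z" for z using den1[OF that] by auto
  have e2: "exp (2 * \<i> * complex_of_real \<epsilon> * z) = exp (\<i> * complex_of_real \<epsilon> * z) * exp (\<i> * complex_of_real \<epsilon> * z)" for z
    unfolding exp_add[symmetric] by (simp only: mult_2[symmetric] mult.assoc)
  have bd2: "norm (U z * exp (2 * \<i> * complex_of_real \<epsilon> * z)) \<le> S" if "0 \<le> Im z" for z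
  proof -
    have "norm (U z * exp (\<i> * complex_of_real \<epsilon> * z)) * norm (exp (\<i> * complex_of_real \<epsilon> * z)) \<le> S * 1"
      using bd[OF that] ne1[OF that] S1 by (intro mult_mono) auto
    then show ?thesis unfolding e2 by (simp add: norm_mult mult.assoc)
  qed
  have k: "(k has_field_derivative k' z) (at z within ?H)" if "0 \<le> Im z" for z
    unfolding k_def k'_def by (rule has_field_derivative_cutoff[OF nz[OF that]])
  have bk: "norm (U z * k z) \<le> S / (1 + (\<epsilon> * norm z)\<^sup>2)" if "0 \<le> Im z" for z
  proof -
    have "norm (U z * k z) = norm (U z * exp (2 * \<i> * complex_of_real \<epsilon> * z)) / (norm (1 - \<i> * complex_of_real \<epsilon> * z))\<^sup>2"
      by (simp add: k_def norm_mult norm_divide norm_power)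
    also have "\<dots> \<le> S / (1 + (\<epsilon> * norm z)\<^sup>2)"
      using bd2[OF that] den[OF that] S1 by (intro frac_le) (auto simp: add_pos_nonneg)
    finally show ?thesis .
  qed
  have bk': "norm (U z * k' z) \<le> 4 * \<epsilon> * S / (1 + (\<epsilon> * norm z)\<^sup>2)" if z: "0 \<le> Im z" for z
  proof -
    let ?d = "1 - \<i> * complex_of_real \<epsilon> * z"
    have "norm (2 * \<i> * complex_of_real \<epsilon> / ?d\<^sup>2 + 2 * \<i> * \<epsilon> / ?d ^ 3)
        \<le> 2 * \<epsilon> / (norm ?d)\<^sup>2 + 2 * \<epsilon> / (norm ?d) ^ 3"
      using norm_triangle_ineq[of "2 * \<i> * complex_of_real \<epsilon> / ?d\<^sup>2" "2 * \<i> * \<epsilon> / ?d ^ 3"] e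
      by (simp add: norm_mult norm_divide norm_power)
    also have "2 * \<epsilon> / (norm ?d) ^ 3 \<le> 2 * \<epsilon> / (norm ?d)\<^sup>2"
      using den1[OF z] e by (intro divide_left_mono power_increasing) (auto intro!: mult_pos_pos zero_less_power less_le_trans[OF zero_less_one])
    finally have "norm (2 * \<i> * complex_of_real \<epsilon> / ?d\<^sup>2 + 2 * \<i> * \<epsilon> / ?d ^ 3) \<le> 4 * \<epsilon> / (norm ?d)\<^sup>2"
      by simp
    also have "\<dots> \<le> 4 * \<epsilon> / (1 + (\<epsilon> * norm z)\<^sup>2)"
      using den[OF z] e by (intro frac_le) (auto simp: add_pos_nonneg)
    finally have "norm (U z * exp (2 * \<i> * complex_of_real \<epsilon> * z)) * norm (2 * \<i> * complex_of_real \<epsilon> / ?d\<^sup>2 + 2 * \<i> * \<epsilon> / ?d ^ 3)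
        \<le> S * (4 * \<epsilon> / (1 + (\<epsilon> * norm z)\<^sup>2))"
      using bd2[OF z] S1 by (intro mult_mono) auto
    then show ?thesis by (simp add: k'_def norm_mult mult_ac)
  qed
  have cont': "continuous_on ?H (\<lambda>z. U z * k' z)"
    unfolding k'_def using nz by (intro continuous_intros contU) auto
  have hol': "(\<lambda>z. U z * k' z) holomorphic_on {z. 0 < Im z}"
    unfolding k'_def using nz by (intro holomorphic_intros holU) auto
  \<comment> \<open>Integration by parts in terms of primitives: U k - Y is a primitive of f k. The
    increment of \<open>Y\<close> depends on the end points alone, so it can be estimated along the
    upper semicircle instead of the real segment.\<close>
  obtain Y where Y: "\<And>z. 0 \<le> Im z \<Longrightarrow> (Y has_field_derivative U z * k' z) (at z within ?H)"
    using Im_ge_0_primitive[OF cont' hol'] by blast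
  have W: "((\<lambda>z. U z * k z - Y z) has_field_derivative f z * k z) (at z within ?H)" if "0 \<le> Im z" for z
    using DERIV_diff[OF DERIV_mult[OF U[OF that] k[OF that]] Y[OF that]] by (simp add: algebra_simps)
  have nk: "norm (k (complex_of_real x)) \<le> 1" for x
  proof -
    have "(1::real) \<le> (norm (1 - \<i> * complex_of_real \<epsilon> * x))\<^sup>2"
      using den1[of "complex_of_real x"] by (simp add: one_le_power)
    then show ?thesis by (simp add: k_def norm_divide norm_power divide_le_eq)
  qed
  have meask: "(\<lambda>x. k (complex_of_real x)) \<in> borel_measurable lborel"
    unfolding k_def measurable_lborel2 using nz
    by (intro borel_measurable_continuous_onI continuous_intros) auto
  have bddk: "AE x in lborel. norm (f (complex_of_real x) * k (complex_of_real x)) \<le> norm (f (complex_of_real x))"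
    using nk by (intro AE_I2) (auto simp: norm_mult mult_left_le)
  have intk: "integrable lborel (\<lambda>x. f (complex_of_real x) * k (complex_of_real x))"
    by (rule Bochner_Integration.integrable_bound[OF int _ bddk])
       (intro borel_measurable_times meask borel_measurable_integrable[OF int])
  define J where "J n = (LINT x|lborel. indicator {- real n..real n} x *\<^sub>R (f (complex_of_real x) * k (complex_of_real x)))" for n
  have lim1: "J \<longlonglongrightarrow> (LINT x|lborel. f (complex_of_real x) * k (complex_of_real x))"
    unfolding J_def
  proof (rule integral_dominated_convergence[where w = "\<lambda>x. norm (f (complex_of_real x) * k (complex_of_real x))"])
    show "AE x in lborel. (\<lambda>n. indicator {- real n..real n} x *\<^sub>R (f (complex_of_real x) * k (complex_of_real x)))
       \<longlonglongrightarrow> f (complex_of_real x) * k (complex_of_real x)"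
    proof (intro AE_I2 tendsto_eventually)
      fix x :: real
      obtain m :: nat where m: "\<bar>x\<bar> \<le> real m" using real_arch_simple by blast
      show "\<forall>\<^sub>F n in sequentially. indicator {- real n..real n} x *\<^sub>R (f (complex_of_real x) * k (complex_of_real x))
          = f (complex_of_real x) * k (complex_of_real x)"
        using eventually_ge_at_top[of m]
      proof eventually_elim
        case (elim n)
        then have "\<bar>x\<bar> \<le> real n" using m by linarith
        then show ?case by (auto simp: indicator_def abs_le_iff)
      qed
    qed
  qed (use intk in \<open>auto simp: indicator_def borel_measurable_integrable intro!: AE_I2 borel_measurable_scaleR borel_measurable_indicator\<close>)
  have Jb: "norm (J n) \<le> (2 * S + 4 * \<epsilon> * S * real n * pi) / (1 + (\<epsilon> * real n)\<^sup>2)" if n: "n > 0" for n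
  proof -
    have si: "set_integrable lborel {- real n..real n} (\<lambda>x. f (complex_of_real x) * k (complex_of_real x))"
      unfolding set_integrable_def using intk by (rule integrable_mult_indicator[rotated]) simp
    let ?p = "part_circlepath 0 (real n) 0 pi"
    have Jn: "J n = (U (real n) * k (real n) - Y (real n)) - (U (- real n) * k (- real n) - Y (- real n))"
      using set_borel_integral_eq_integral(2)[OF si] integral_unique[OF Im_ge_0_FTC_real[OF W, of "- real n" "real n"]]
      by (simp add: J_def set_lebesgue_integral_def)
    have pim: "path_image ?p \<subseteq> ?H"
      by (auto simp: path_image_part_circlepath' closed_segment_eq_real_ivl Im_exp sin_ge_zero)
    have "((\<lambda>z. U z * k' z) has_contour_integral (Y (pathfinish ?p) - Y (pathstart ?p))) ?p"
      by (rule contour_integral_primitive[OF _ _ pim]) (use Y in auto)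
    then have "norm (Y (pathfinish ?p) - Y (pathstart ?p)) \<le> 4 * \<epsilon> * S / (1 + (\<epsilon> * real n)\<^sup>2) * real n * (pi - 0)"
    proof (rule has_contour_integral_bound_part_circlepath)
      show "norm (U z * k' z) \<le> 4 * \<epsilon> * S / (1 + (\<epsilon> * real n)\<^sup>2)" if "z \<in> path_image ?p" for z
      proof -
        have "norm z = real n" using path_image_part_circlepath_subset'[of "real n" 0 0 pi] that by auto
        then show ?thesis using bk'[of z] pim that by auto
      qed
    qed (use n e S1 in auto)
    moreover have "pathfinish ?p = - real n" "pathstart ?p = real n" by simp_all
    ultimately have Yb: "norm (Y (- real n) - Y (real n)) \<le> 4 * \<epsilon> * S / (1 + (\<epsilon> * real n)\<^sup>2) * real n * pi" by simp
    have u1: "norm (U (real n) * k (real n)) \<le> S / (1 + (\<epsilon> * real n)\<^sup>2)"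
      using bk[of "complex_of_real (real n)"] by simp
    have u2: "norm (U (- real n) * k (- real n)) \<le> S / (1 + (\<epsilon> * real n)\<^sup>2)"
      using bk[of "- complex_of_real (real n)"] by simp
    have "J n = U (real n) * k (real n) - U (- real n) * k (- real n) + (Y (- real n) - Y (real n))"
      unfolding Jn by simp
    then have "norm (J n) \<le> norm (U (real n) * k (real n)) + norm (U (- real n) * k (- real n)) + norm (Y (- real n) - Y (real n))"
      using norm_triangle_ineq[of "U (real n) * k (real n) - U (- real n) * k (- real n)" "Y (- real n) - Y (real n)"]
        norm_triangle_ineq4[of "U (real n) * k (real n)" "U (- real n) * k (- real n)"] by simp
    also have "\<dots> \<le> S / (1 + (\<epsilon> * real n)\<^sup>2) + S / (1 + (\<epsilon> * real n)\<^sup>2) + 4 * \<epsilon> * S / (1 + (\<epsilon> * real n)\<^sup>2) * real n * pi"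
      using u1 u2 Yb by linarith
    also have "\<dots> = (2 * S + 4 * \<epsilon> * S * real n * pi) / (1 + (\<epsilon> * real n)\<^sup>2)"
      by (simp add: add_divide_distrib)
    finally show ?thesis .
  qed
  have "(\<lambda>n. (2 * S + 4 * \<epsilon> * S * real n * pi) / (1 + (\<epsilon> * real n)\<^sup>2)) \<longlonglongrightarrow> 0"
    using e by real_asymp
  then have "J \<longlonglongrightarrow> 0"
    by (rule Lim_null_comparison[rotated]) (rule eventually_mono[OF eventually_gt_at_top[of 0] Jb])
  then show ?thesis using LIMSEQ_unique[OF lim1] by (simp add: k_def)
qed

text \<open>On the real line the cutoff has modulus at most 1 and tends to 1 as \<epsilon> tends to
  0, so dominated convergence removes it.\<close>

theorem integral_eq_0_upper_half_plane:
  assumes cont: "continuous_on {z. 0 \<le> Im z} f" and hol: "f holomorphic_on {z. 0 < Im z}"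
    and gr: "hp_growth f" and se: "subexp_imag f"
    and int: "integrable lborel (\<lambda>x::real. f (complex_of_real x))"
  shows "(LINT x|lborel. f (complex_of_real x)) = 0"
proof -
  define k where "k n x = exp (2 * \<i> * complex_of_real (1 / real (Suc n)) * complex_of_real x) /
     (1 - \<i> * complex_of_real (1 / real (Suc n)) * complex_of_real x)\<^sup>2" for n x
  have re: "Re (1 - \<i> * complex_of_real e * complex_of_real x) = 1" for e x :: real by simp
  have nz: "1 - \<i> * complex_of_real e * complex_of_real x \<noteq> 0" for e x
    using re[of e x] by (metis zero_complex.simps(1) zero_neq_one)
  have n1: "norm (k n x) \<le> 1" for n x
  proof -
    have "1 \<le> norm (1 - \<i> * complex_of_real (1 / real (Suc n)) * complex_of_real x)"
      using complex_Re_le_cmod[of "1 - \<i> * complex_of_real (1 / real (Suc n)) * complex_of_real x"] re by simp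
    then have "(1::real) \<le> (norm (1 - \<i> * complex_of_real (1 / real (Suc n)) * complex_of_real x))\<^sup>2"
      by (simp add: one_le_power)
    then show ?thesis by (simp add: k_def norm_divide norm_power divide_le_eq)
  qed
  have "(\<lambda>n. LINT x|lborel. f (complex_of_real x) * k n x) \<longlonglongrightarrow> (LINT x|lborel. f (complex_of_real x))"
  proof (rule integral_dominated_convergence[where w = "\<lambda>x. norm (f (complex_of_real x))"])
    show "AE x in lborel. (\<lambda>n. f (complex_of_real x) * k n x) \<longlonglongrightarrow> f (complex_of_real x)"
    proof (rule AE_I2)
      fix x :: real
      have l: "(\<lambda>n. complex_of_real (1 / real (Suc n))) \<longlonglongrightarrow> complex_of_real 0"
        by (intro tendsto_of_real LIMSEQ_inverse_real_of_nat[unfolded inverse_eq_divide])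
      have "(\<lambda>n. f (complex_of_real x) * k n x) \<longlonglongrightarrow> f (complex_of_real x) *
         (exp (2 * \<i> * complex_of_real 0 * complex_of_real x) / (1 - \<i> * complex_of_real 0 * complex_of_real x)\<^sup>2)"
        unfolding k_def using nz[of 0 x] by (intro tendsto_intros l) auto
      then show "(\<lambda>n. f (complex_of_real x) * k n x) \<longlonglongrightarrow> f (complex_of_real x)" by simp
    qed
    show "(\<lambda>x. f (complex_of_real x) * k n x) \<in> borel_measurable lborel" for n
    proof (intro borel_measurable_times borel_measurable_integrable[OF int])
      show "k n \<in> borel_measurable lborel"
        unfolding k_def[abs_def] measurable_lborel2 using nz
        by (intro borel_measurable_continuous_onI continuous_intros) auto
    qed
  qed (use int n1 in \<open>auto simp: norm_mult mult_left_le intro!: AE_I2\<close>)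
  moreover have "(LINT x|lborel. f (complex_of_real x) * k n x) = 0" for n
    unfolding k_def using integral_eq_0_cutoff[OF cont hol gr se int, of "1 / real (Suc n)"] by simp
  ultimately show ?thesis using LIMSEQ_unique tendsto_const by (metis (no_types, lifting) ext)
qed

subsection \<open>Poisson quadrature\<close>

lemma star_fun_holomorphic:
  assumes "F holomorphic_on UNIV"
  shows "star_fun F holomorphic_on UNIV"
proof -
  have "(cnj \<circ> F \<circ> cnj) holomorphic_on UNIV"
    by (rule holomorphic_on_compose_cnj_cnj) (use assms in auto)
  then show ?thesis by (simp add: star_fun_def[abs_def] o_def)
qed

lemma integrable_inverse_1_plus_square_UNIV: "integrable lborel (\<lambda>x::real. 1 / (1 + x\<^sup>2))"
  using integrable_inverse_1_plus_square by (simp add: set_integrable_def inverse_eq_divide)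

text \<open>The hypotheses on E are expressed through E(-z): since \<open>star_fun E\<close> at z is
  E(-z), the modulus of E at cnj z equals |E(-z)|, which gives the inequality its present
  form.\<close>

locale rotated_hermite_biehler =
  fixes E :: "complex \<Rightarrow> complex"
  assumes E_holomorphic: "E holomorphic_on UNIV"
    and E_star: "cnj (E (cnj z)) = E (- z)"
    and E_less: "Im z > 0 \<Longrightarrow> norm (E (- z)) < norm (E z)"
    and E_real_nonzero: "E (complex_of_real x) \<noteq> 0"
begin

lemma E_holomorphic_on: "E holomorphic_on S"
  using E_holomorphic by (rule holomorphic_on_subset) simp

lemma E_minus_holomorphic_on: "(\<lambda>z. E (- z)) holomorphic_on S"
  by (rule holomorphic_on_compose_gen[OF _ E_holomorphic, unfolded o_def]) (auto intro!: holomorphic_intros)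

lemma E_minus_real: "E (- complex_of_real x) = cnj (E (complex_of_real x))"
  using E_star[of "complex_of_real x"] by simp

lemma E_nonzero: "0 \<le> Im z \<Longrightarrow> E z \<noteq> 0"
proof (cases "Im z = 0")
  case True
  then have "of_real (Re z) = z" by (simp add: complex_eq_iff)
  then show ?thesis using E_real_nonzero[of "Re z"] by simp
next
  case False
  assume "0 \<le> Im z"
  then have "norm (E (- z)) < norm (E z)" using False by (intro E_less) auto
  then show ?thesis by auto
qed

definition \<Theta> :: "complex \<Rightarrow> complex" where "\<Theta> z = E (- z) / E z"

lemma norm_\<Theta>_real: "norm (\<Theta> (complex_of_real x)) = 1"
  using E_real_nonzero[of x] by (simp add: \<Theta>_def norm_divide E_minus_real)

lemma norm_\<Theta>_le: "0 \<le> Im z \<Longrightarrow> norm (\<Theta> z) \<le> 1"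
proof (cases "Im z = 0")
  case True
  then have "of_real (Re z) = z" by (simp add: complex_eq_iff)
  then show ?thesis using norm_\<Theta>_real[of "Re z"] by simp
next
  case False
  assume "0 \<le> Im z"
  then have "norm (E (- z)) < norm (E z)" using False by (intro E_less) auto
  then show ?thesis by (simp add: \<Theta>_def norm_divide divide_le_eq)
qed

definition A :: "complex \<Rightarrow> complex" where "A z = (E z + E (- z)) / 2"

lemma A_minus: "A (- z) = A z"
  by (simp add: A_def add.commute)

lemma A_cnj: "cnj (A (cnj z)) = A z"
  using E_star[of z] E_star[of "- z"] by (simp add: A_def add.commute)

lemma A_holomorphic_on: "A holomorphic_on S"
  unfolding A_def by (intro holomorphic_intros E_holomorphic_on E_minus_holomorphic_on) auto

lemma A_nonzero: "Im z > 0 \<Longrightarrow> A z \<noteq> 0"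
  using E_less[of z] by (auto simp: A_def add_eq_0_iff)

lemma norm_A_over_E_le: "0 \<le> Im z \<Longrightarrow> norm (A z / E z) \<le> 1"
proof -
  assume z: "0 \<le> Im z"
  have eq: "A z / E z = (1 + \<Theta> z) / 2"
    using E_nonzero[OF z] by (simp add: A_def \<Theta>_def field_simps)
  show ?thesis unfolding eq using norm_triangle_ineq[of 1 "\<Theta> z"] norm_\<Theta>_le[OF z] by (simp add: norm_divide)
qed

definition admissible :: "(complex \<Rightarrow> complex) \<Rightarrow> bool" where
  "admissible G \<longleftrightarrow> G holomorphic_on UNIV \<and> hp_growth (\<lambda>z. G z / E z) \<and> subexp_imag (\<lambda>z. G z / E z)"

definition wt :: "(complex \<Rightarrow> complex) \<Rightarrow> real \<Rightarrow> real" where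
  "wt F x = (norm (F (complex_of_real x) / E (complex_of_real x)))\<^sup>2"

text \<open>Stands for the domain of multiplication by z, with bounded type and mean type relaxed to
  \<open>hp_growth\<close> and \<open>subexp_imag\<close>; closure under linear combinations is then
  inherited from these classes.\<close>

definition Dom :: "(complex \<Rightarrow> complex) set" where
  "Dom = {F. admissible F \<and> admissible (star_fun F) \<and> integrable lborel (\<lambda>x. (1 + x\<^sup>2) * wt F x)}"

lemma wt_nonneg: "wt F x \<ge> 0"
  by (simp add: wt_def)

lemma continuous_on_compose_of_real:
  "F holomorphic_on UNIV \<Longrightarrow> continuous_on S (\<lambda>x::real. F (complex_of_real x))"
  by (rule continuous_on_compose2[OF holomorphic_on_imp_continuous_on]) (auto intro!: continuous_intros)

lemma continuous_on_of_real_quotient: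
  "F holomorphic_on UNIV \<Longrightarrow> continuous_on S (\<lambda>x::real. F (complex_of_real x) / E (complex_of_real x))"
  using E_real_nonzero by (intro continuous_on_divide continuous_on_compose_of_real E_holomorphic) auto

lemma continuous_on_wt: "F holomorphic_on UNIV \<Longrightarrow> continuous_on S (wt F)"
  unfolding wt_def[abs_def] by (intro continuous_on_power continuous_on_norm continuous_on_of_real_quotient)

lemma measurable_wt: "F holomorphic_on UNIV \<Longrightarrow> wt F \<in> borel_measurable lborel"
  unfolding measurable_lborel2 by (intro borel_measurable_continuous_onI continuous_on_wt)

lemma Dom_holomorphic: "F \<in> Dom \<Longrightarrow> F holomorphic_on UNIV"
  by (simp add: Dom_def admissible_def)

lemma quotient_holomorphic_on:
  assumes "G holomorphic_on UNIV"
  shows "(\<lambda>z. G z / E z) holomorphic_on {z. 0 < Im z}"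
  by (rule holomorphic_on_divide[OF holomorphic_on_subset[OF assms] E_holomorphic_on])
     (use E_nonzero in auto)

lemma quotient_continuous_on:
  assumes "G holomorphic_on UNIV"
  shows "continuous_on {z. 0 \<le> Im z} (\<lambda>z. G z / E z)"
  by (rule continuous_on_divide[OF holomorphic_on_imp_continuous_on[OF holomorphic_on_subset[OF assms]]
        holomorphic_on_imp_continuous_on[OF E_holomorphic_on]]) (use E_nonzero in auto)

section \<open>The Poisson kernel of \<Theta> and the quadrature identity\<close>

definition Pois :: "real \<Rightarrow> real \<Rightarrow> real" where
  "Pois r x = (1 - r\<^sup>2) / (norm (1 + r * \<Theta> (complex_of_real x)))\<^sup>2"

lemma norm_1_r\<Theta>_ge: "0 \<le> r \<Longrightarrow> 0 \<le> Im z \<Longrightarrow> 1 - r \<le> norm (1 + complex_of_real r * \<Theta> z)"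
proof -
  assume r: "0 \<le> r" and z: "0 \<le> Im z"
  have "norm (complex_of_real r * \<Theta> z) \<le> r * 1"
    using norm_\<Theta>_le[OF z] r by (simp add: norm_mult mult_left_le)
  then show ?thesis using norm_triangle_ineq2[of 1 "- (complex_of_real r * \<Theta> z)"] by simp
qed

lemma Pois_nonneg: "0 \<le> r \<Longrightarrow> r < 1 \<Longrightarrow> Pois r x \<ge> 0"
  unfolding Pois_def by (intro divide_nonneg_nonneg) (auto simp: power_le_one_iff)

text \<open>As |\<Theta>| = 1 on the line, |1 + r \<Theta>|^2 = 1 + 2 r Re \<Theta> + r^2. So the
  kernel differs from 1 by the real part of a function that is analytic in the upper
  half-plane.\<close>

lemma Pois_eq:
  assumes r: "0 \<le> r" "r < 1"
  shows "Pois r x = 1 - 2 * r * Re (\<Theta> (complex_of_real x) / (1 + r * \<Theta> (complex_of_real x)))"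
proof -
  let ?t = "\<Theta> (complex_of_real x)"
  let ?d = "1 + complex_of_real r * ?t"
  have d: "?d \<noteq> 0" using norm_1_r\<Theta>_ge[of r "complex_of_real x"] r by auto
  have n: "(Re ?t)\<^sup>2 + (Im ?t)\<^sup>2 = 1" using norm_\<Theta>_real[of x] by (simp add: cmod_power2[symmetric])
  have dn: "(norm ?d)\<^sup>2 = 1 + 2 * r * Re ?t + r\<^sup>2"
  proof -
    have "(norm ?d)\<^sup>2 = 1 + 2 * r * Re ?t + r\<^sup>2 * ((Re ?t)\<^sup>2 + (Im ?t)\<^sup>2)"
      unfolding cmod_power2 by (simp add: power2_eq_square algebra_simps)
    then show ?thesis by (simp add: n)
  qed
  have "Re (?t / ?d) = Re (?t * cnj ?d) / (norm ?d)\<^sup>2"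
    by (subst complex_div_cnj) (simp add: Re_divide_of_real)
  also have "Re (?t * cnj ?d) = Re ?t + r * ((Re ?t)\<^sup>2 + (Im ?t)\<^sup>2)"
    by (simp add: power2_eq_square algebra_simps)
  finally have "Re (?t / ?d) = (Re ?t + r) / (norm ?d)\<^sup>2" by (simp add: n)
  moreover have "(norm ?d)\<^sup>2 > 0" using d by simp
  moreover have "(1 - r\<^sup>2) / D = 1 - 2 * r * ((Re ?t + r) / D)"
    if "D > 0" "D = 1 + 2 * r * Re ?t + r\<^sup>2" for D
  proof -
    have "D - 2 * r * (Re ?t + r) = 1 - r\<^sup>2" using that(2) by (simp add: power2_eq_square algebra_simps)
    then show ?thesis using that(1) by (simp add: divide_simps)
  qed
  ultimately show ?thesis unfolding Pois_def using dn by simp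
qed

text \<open>Quantifies the concentration: away from the zeros of \<open>A\<close> the kernel is O(1
  - r). Indeed A / E = (1 + \<Theta>) / 2, and |1 + \<Theta>| \<le> |1 + r \<Theta>| + (1 - r) \<le>
  2 |1 + r \<Theta>|.\<close>

lemma Pois_mult_A_le:
  assumes r: "0 \<le> r" "r < 1"
  shows "Pois r x * (norm (A x / E x))\<^sup>2 \<le> 1 - r\<^sup>2"
proof -
  let ?t = "\<Theta> (complex_of_real x)"
  let ?d = "norm (1 + complex_of_real r * ?t)"
  have d: "1 - r \<le> ?d" using norm_1_r\<Theta>_ge[of r "complex_of_real x"] r by simp
  have d0: "?d > 0" using d r by linarith
  have "1 + ?t = (1 + complex_of_real r * ?t) + complex_of_real (1 - r) * ?t" by (simp add: algebra_simps)
  then have "norm (1 + ?t) \<le> ?d + norm (complex_of_real (1 - r) * ?t)" using norm_triangle_ineq by metis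
  also have "norm (complex_of_real (1 - r) * ?t) = 1 - r"
    using r by (simp add: norm_mult norm_\<Theta>_real del: of_real_diff)
  finally have "norm (1 + ?t) \<le> 2 * ?d" using d by linarith
  moreover have "norm (A x / E x) = norm (1 + ?t) / 2"
    using E_real_nonzero[of x] by (simp add: A_def \<Theta>_def norm_divide field_simps flip: norm_mult)
  ultimately have "(norm (A x / E x))\<^sup>2 \<le> ?d\<^sup>2" by (intro power_mono) auto
  then have "(1 - r\<^sup>2) * (norm (A x / E x))\<^sup>2 \<le> (1 - r\<^sup>2) * ?d\<^sup>2"
    using r by (intro mult_left_mono) (auto simp: power_le_one_iff)
  then show ?thesis using d0 by (simp add: Pois_def field_simps)
qed

lemma Pois_le: "0 \<le> r \<Longrightarrow> r < 1 \<Longrightarrow> Pois r x \<le> 1 / (1 - r)\<^sup>2"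
  unfolding Pois_def using norm_1_r\<Theta>_ge[of r "complex_of_real x"]
  by (intro frac_le power_mono) auto

lemma measurable_Pois:
  assumes "0 \<le> r" "r < 1"
  shows "Pois r \<in> borel_measurable lborel"
proof -
  have "1 + r * \<Theta> (complex_of_real x) \<noteq> 0" for x
    using norm_1_r\<Theta>_ge[of r "complex_of_real x"] assms by auto
  moreover have "continuous_on UNIV (\<lambda>x. \<Theta> (complex_of_real x))"
    unfolding \<Theta>_def by (rule continuous_on_of_real_quotient[OF E_minus_holomorphic_on])
  ultimately have "continuous_on UNIV (Pois r)"
    unfolding Pois_def[abs_def] by (intro continuous_intros) auto
  then show ?thesis unfolding measurable_lborel2 by (rule borel_measurable_continuous_onI)
qed

lemma quadratic_le: "\<bar>a + b * x + c * x\<^sup>2\<bar> \<le> (\<bar>a\<bar> + \<bar>b\<bar> + \<bar>c\<bar>) * (1 + x\<^sup>2)" for a b c x :: real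
proof -
  have "\<bar>x\<bar> \<le> 1 + x\<^sup>2" using sum_squares_bound[of 1 "\<bar>x\<bar>"] abs_ge_zero[of x]
    unfolding power2_abs one_power2 by linarith
  then have "\<bar>b\<bar> * \<bar>x\<bar> \<le> \<bar>b\<bar> * (1 + x\<^sup>2)" by (intro mult_left_mono) auto
  moreover have "\<bar>a + b * x + c * x\<^sup>2\<bar> \<le> \<bar>a\<bar> + \<bar>b\<bar> * \<bar>x\<bar> + \<bar>c\<bar> * x\<^sup>2"
    using abs_triangle_ineq[of "a + b * x" "c * x\<^sup>2"] abs_triangle_ineq[of a "b * x"] by (simp add: abs_mult)
  moreover have "\<bar>a\<bar> \<le> \<bar>a\<bar> * (1 + x\<^sup>2)" "\<bar>c\<bar> * x\<^sup>2 \<le> \<bar>c\<bar> * (1 + x\<^sup>2)" by (auto simp: algebra_simps)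
  ultimately show ?thesis unfolding distrib_right by linarith
qed

lemma integrable_wt_bound:
  assumes F: "F \<in> Dom" and m: "g \<in> borel_measurable lborel" and b: "\<And>x. \<bar>g x\<bar> \<le> B * (1 + x\<^sup>2)"
  shows "integrable lborel (\<lambda>x. g x * wt F x)"
proof (rule Bochner_Integration.integrable_bound)
  show "integrable lborel (\<lambda>x. B * ((1 + x\<^sup>2) * wt F x))" using F by (simp add: Dom_def)
  show "(\<lambda>x. g x * wt F x) \<in> borel_measurable lborel"
    using m measurable_wt[OF Dom_holomorphic[OF F]] by (rule borel_measurable_times)
  have "\<bar>g x\<bar> * wt F x \<le> B * (1 + x\<^sup>2) * wt F x" for x
    using b wt_nonneg by (rule mult_right_mono)
  then have "\<bar>g x * wt F x\<bar> \<le> \<bar>B * ((1 + x\<^sup>2) * wt F x)\<bar>" for x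
    using abs_ge_self[of "B * ((1 + x\<^sup>2) * wt F x)"] wt_nonneg[of F x]
    by (simp only: abs_mult[of "g x"] abs_of_nonneg mult.assoc[of B]) (rule order_trans)
  then show "AE x in lborel. norm (g x * wt F x) \<le> norm (B * ((1 + x\<^sup>2) * wt F x))"
    by (intro AE_I2) simp
qed

lemma integrable_quadratic_wt:
  "F \<in> Dom \<Longrightarrow> integrable lborel (\<lambda>x. (a + b * x + c * x\<^sup>2) * wt F x)"
  by (rule integrable_wt_bound[where B = "\<bar>a\<bar> + \<bar>b\<bar> + \<bar>c\<bar>"]) (auto intro: quadratic_le)

lemma integrable_quadratic_wt_Pois:
  assumes "F \<in> Dom" "0 \<le> r" "r < 1"
  shows "integrable lborel (\<lambda>x. (a + b * x + c * x\<^sup>2) * Pois r x * wt F x)"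
proof (rule integrable_wt_bound[OF assms(1), where B = "(\<bar>a\<bar> + \<bar>b\<bar> + \<bar>c\<bar>) * (1 / (1 - r)\<^sup>2)"])
  show "(\<lambda>x. (a + b * x + c * x\<^sup>2) * Pois r x) \<in> borel_measurable lborel"
    using measurable_Pois[OF assms(2,3)] by simp
  fix x
  have "\<bar>a + b * x + c * x\<^sup>2\<bar> * \<bar>Pois r x\<bar> \<le> (\<bar>a\<bar> + \<bar>b\<bar> + \<bar>c\<bar>) * (1 + x\<^sup>2) * (1 / (1 - r)\<^sup>2)"
    using quadratic_le Pois_le[OF assms(2,3)] Pois_nonneg[OF assms(2,3)]
    by (intro mult_mono) auto
  then show "\<bar>(a + b * x + c * x\<^sup>2) * Pois r x\<bar> \<le> (\<bar>a\<bar> + \<bar>b\<bar> + \<bar>c\<bar>) * (1 / (1 - r)\<^sup>2) * (1 + x\<^sup>2)"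
    by (simp add: abs_mult mult_ac)
qed

lemma Poisson_quadrature:
  assumes F: "F \<in> Dom" and r: "0 \<le> r" "r < 1"
  shows "(LINT x|lborel. (a + b * x + c * x\<^sup>2) * Pois r x * wt F x)
       = (LINT x|lborel. (a + b * x + c * x\<^sup>2) * wt F x)"
proof -
  define p where "p z = complex_of_real a + complex_of_real b * z + complex_of_real c * (z * z)" for z
  define s where "s z = 1 / (1 + complex_of_real r * \<Theta> z)" for z
  define f where "f z = p z * s z * (F z / E z * (star_fun F z / E z))" for z
  have ad: "admissible F" "admissible (star_fun F)" using F by (auto simp: Dom_def)
  have hol: "F holomorphic_on UNIV" "star_fun F holomorphic_on UNIV" using ad by (auto simp: admissible_def)
  have dnz: "1 + complex_of_real r * \<Theta> z \<noteq> 0" if "0 \<le> Im z" for z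
    using norm_1_r\<Theta>_ge[OF r(1) that] r by auto
  have s_le: "norm (s z) \<le> 1 / (1 - r)" if "0 \<le> Im z" for z
    using norm_1_r\<Theta>_ge[OF r(1) that] r by (simp add: s_def norm_divide frac_le)
  have c\<Theta>: "continuous_on {z. 0 \<le> Im z} \<Theta>"
    unfolding \<Theta>_def[abs_def] by (rule quotient_continuous_on[OF E_minus_holomorphic_on])
  have h\<Theta>: "\<Theta> holomorphic_on {z. 0 < Im z}"
    unfolding \<Theta>_def[abs_def] by (rule quotient_holomorphic_on[OF E_minus_holomorphic_on])
  have "continuous_on {z. 0 \<le> Im z} s"
    unfolding s_def by (intro continuous_intros c\<Theta>) (use dnz in auto)
  moreover have "continuous_on {z. 0 \<le> Im z} p"
    unfolding p_def by (intro continuous_intros)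
  ultimately have cont: "continuous_on {z. 0 \<le> Im z} f"
    unfolding f_def by (intro continuous_on_mult quotient_continuous_on hol)
  have "s holomorphic_on {z. 0 < Im z}"
    unfolding s_def by (intro holomorphic_intros h\<Theta>) (use dnz in auto)
  moreover have "p holomorphic_on {z. 0 < Im z}"
    unfolding p_def by (intro holomorphic_intros)
  ultimately have holf: "f holomorphic_on {z. 0 < Im z}"
    unfolding f_def by (intro holomorphic_on_mult quotient_holomorphic_on hol)
  have lin: "norm z \<le> 1 * (1 + norm z)" for z :: complex by simp
  have cst: "norm d \<le> norm d * (1 + norm z)" for z d :: complex by (simp add: distrib_left)
  \<comment> \<open>The bound on \<open>s\<close> is relaxed to a linear one, which is the form that
    yields membership in both growth classes.\<close>
  have sl: "norm (s z) \<le> 1 / (1 - r) * (1 + norm z)" if "0 < Im z" for z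
  proof -
    have "1 / (1 - r) * 1 \<le> 1 / (1 - r) * (1 + norm z)" using r by (intro mult_left_mono) auto
    then show ?thesis using s_le[of z] that by simp
  qed
  have g0: "hp_growth p"
    unfolding p_def
    by (intro hp_growth_add hp_growth_mult hp_growth_linear_bound[OF lin] hp_growth_linear_bound[OF cst])
  have g1: "hp_growth s" by (rule hp_growth_linear_bound[OF sl])
  have gr: "hp_growth f"
    unfolding f_def using ad by (intro hp_growth_mult g0 g1) (auto simp: admissible_def)
  have e0: "subexp_imag p"
    unfolding p_def
    by (intro subexp_imag_add subexp_imag_mult subexp_imag_linear_bound[OF lin] subexp_imag_linear_bound[OF cst])
  have e1: "subexp_imag s" by (rule subexp_imag_linear_bound[OF sl])
  have se: "subexp_imag f"
    unfolding f_def using ad by (intro subexp_imag_mult e0 e1) (auto simp: admissible_def)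
  have real: "f (complex_of_real x) = (a + b * x + c * x\<^sup>2) * wt F x *
      (\<Theta> (complex_of_real x) / (1 + r * \<Theta> (complex_of_real x)))" for x
  proof -
    let ?e = "E (complex_of_real x)" and ?g = "F (complex_of_real x)"
    have "?g / ?e * (star_fun F (complex_of_real x) / ?e) = (?g * cnj ?g) / (?e * cnj ?e) * (cnj ?e / ?e)"
      using E_real_nonzero[of x] by (simp add: star_fun_def)
    also have "\<dots> = wt F x * \<Theta> (complex_of_real x)"
      by (simp only: complex_norm_square[symmetric] wt_def \<Theta>_def E_minus_real norm_divide power_divide of_real_divide)
    finally show ?thesis by (simp add: f_def p_def s_def power2_eq_square)
  qed
  \<comment> \<open>For fixed r < 1 the denominator has modulus at least 1 - r, so \<open>f\<close>
    is dominated by a multiple of the integrable quadratic weight.\<close>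
  have int: "integrable lborel (\<lambda>x. f (complex_of_real x))"
  proof (rule Bochner_Integration.integrable_bound)
    show "integrable lborel (\<lambda>x. 1 / (1 - r) * ((a + b * x + c * x\<^sup>2) * wt F x))"
      using integrable_quadratic_wt[OF F] by simp
    have "continuous_on UNIV (\<lambda>x. f (complex_of_real x))"
      by (rule continuous_on_compose2[OF cont]) (auto intro!: continuous_intros)
    then show "(\<lambda>x. f (complex_of_real x)) \<in> borel_measurable lborel"
      unfolding measurable_lborel2 by (rule borel_measurable_continuous_onI)
    have "norm (f (complex_of_real x)) \<le> norm (1 / (1 - r) * ((a + b * x + c * x\<^sup>2) * wt F x))" for x
    proof -
      have "norm (\<Theta> (complex_of_real x) / (1 + r * \<Theta> (complex_of_real x))) \<le> 1 / (1 - r)"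
        using s_le[of "complex_of_real x"] by (simp add: norm_divide s_def norm_\<Theta>_real)
      then have "norm (complex_of_real ((a + b * x + c * x\<^sup>2) * wt F x)) * norm (\<Theta> (complex_of_real x) / (1 + r * \<Theta> (complex_of_real x)))
          \<le> norm (complex_of_real ((a + b * x + c * x\<^sup>2) * wt F x)) * (1 / (1 - r))"
        by (intro mult_left_mono) auto
      moreover have "norm (f (complex_of_real x)) = norm (complex_of_real ((a + b * x + c * x\<^sup>2) * wt F x)) * norm (\<Theta> (complex_of_real x) / (1 + r * \<Theta> (complex_of_real x)))"
        unfolding real norm_mult[symmetric] by (simp only: of_real_mult)
      ultimately show ?thesis using r by (simp only: norm_of_real norm_mult real_norm_def abs_mult) (simp add: mult_ac)
    qed
    then show "AE x in lborel. norm (f (complex_of_real x)) \<le> norm (1 / (1 - r) * ((a + b * x + c * x\<^sup>2) * wt F x))"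
      by (intro AE_I2)
  qed
  have "(LINT x|lborel. f (complex_of_real x)) = 0"
    by (rule integral_eq_0_upper_half_plane[OF cont holf gr se int])
  then have z: "(LINT x|lborel. Re (f (complex_of_real x))) = 0"
    using integral_Re[OF int] by simp
  \<comment> \<open>The weight is real, so Re f contains just the real part of \<Theta> / (1 + r
    \<Theta>), the quantity that separates \<open>Pois r\<close> from 1.\<close>
  have "(a + b * x + c * x\<^sup>2) * Pois r x * wt F x
      = (a + b * x + c * x\<^sup>2) * wt F x - 2 * r * Re (f (complex_of_real x))" for x
  proof -
    have "f (complex_of_real x) = complex_of_real ((a + b * x + c * x\<^sup>2) * wt F x) *
      (\<Theta> (complex_of_real x) / (1 + r * \<Theta> (complex_of_real x)))"
      unfolding real by (simp only: of_real_mult)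
    then have "Re (f (complex_of_real x)) = ((a + b * x + c * x\<^sup>2) * wt F x) *
        Re (\<Theta> (complex_of_real x) / (1 + r * \<Theta> (complex_of_real x)))"
      by (simp only: Re_complex_of_real times_complex.simps Im_complex_of_real mult_zero_left diff_zero)
    then show ?thesis unfolding Pois_eq[OF r] by (simp add: algebra_simps)
  qed
  then have "(LINT x|lborel. (a + b * x + c * x\<^sup>2) * Pois r x * wt F x)
      = (LINT x|lborel. (a + b * x + c * x\<^sup>2) * wt F x - 2 * r * Re (f (complex_of_real x)))"
    by simp
  also have "\<dots> = (LINT x|lborel. (a + b * x + c * x\<^sup>2) * wt F x) - (LINT x|lborel. 2 * r * Re (f (complex_of_real x)))"
    using int integrable_quadratic_wt[OF F] by (intro Bochner_Integration.integral_diff) auto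
  also have "(LINT x|lborel. 2 * r * Re (f (complex_of_real x))) = 0" using z by simp
  finally show ?thesis by simp
qed

section \<open>Linear structure of the domain\<close>

lemma admissible_add_scaled:
  assumes "admissible F" "admissible G"
  shows "admissible (\<lambda>z. F z + c * G z)"
proof -
  have cst: "norm c \<le> norm c * (1 + norm z)" for z :: complex by (simp add: distrib_left)
  have eq: "(\<lambda>z. (F z + c * G z) / E z) = (\<lambda>z. F z / E z + c * (G z / E z))"
    by (simp add: add_divide_distrib)
  show ?thesis using assms unfolding admissible_def eq
    by (intro conjI holomorphic_intros hp_growth_add hp_growth_mult subexp_imag_add subexp_imag_mult
        hp_growth_linear_bound[OF cst] subexp_imag_linear_bound[OF cst]) auto
qed

text \<open>Serves twice: dropping one term on the left dominates the weight of a sum, and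
  integration gives the parallelogram law for the energy.\<close>

lemma wt_parallelogram:
  "wt (\<lambda>z. F z + c * G z) x + wt (\<lambda>z. F z + - c * G z) x = 2 * wt F x + 2 * (norm c)\<^sup>2 * wt G x"
proof -
  have "(norm (u + v))\<^sup>2 + (norm (u - v))\<^sup>2 = 2 * (norm u)\<^sup>2 + 2 * (norm v)\<^sup>2" for u v :: complex
    unfolding cmod_power2 by (simp add: power2_eq_square algebra_simps)
  from this[of "F x / E x" "c * (G x / E x)"] show ?thesis
    by (simp add: wt_def add_divide_distrib diff_divide_distrib norm_mult norm_divide
        power_mult_distrib power_divide)
qed

lemma Dom_add_scaled:
  assumes F: "F \<in> Dom" and G: "G \<in> Dom"
  shows "(\<lambda>z. F z + c * G z) \<in> Dom"
proof -
  have st: "star_fun (\<lambda>z. F z + c * G z) = (\<lambda>z. star_fun F z + cnj c * star_fun G z)"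
    by (auto simp: star_fun_def)
  have ad: "admissible (\<lambda>z. F z + c * G z)" "admissible (star_fun (\<lambda>z. F z + c * G z))"
    unfolding st using F G by (auto intro!: admissible_add_scaled simp: Dom_def)
  have "integrable lborel (\<lambda>x. (1 + x\<^sup>2) * wt (\<lambda>z. F z + c * G z) x)"
  proof (rule Bochner_Integration.integrable_bound)
    show "integrable lborel (\<lambda>x. 2 * ((1 + x\<^sup>2) * wt F x) + 2 * (norm c)\<^sup>2 * ((1 + x\<^sup>2) * wt G x))"
      using F G by (auto simp: Dom_def)
    show "(\<lambda>x. (1 + x\<^sup>2) * wt (\<lambda>z. F z + c * G z) x) \<in> borel_measurable lborel"
      using measurable_wt[of "\<lambda>z. F z + c * G z"] ad by (simp add: admissible_def)
    have "(1 + x\<^sup>2) * wt (\<lambda>z. F z + c * G z) x \<le> 2 * ((1 + x\<^sup>2) * wt F x) + 2 * (norm c)\<^sup>2 * ((1 + x\<^sup>2) * wt G x)" for x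
    proof -
      have "wt (\<lambda>z. F z + c * G z) x \<le> 2 * wt F x + 2 * (norm c)\<^sup>2 * wt G x"
        using wt_parallelogram[of F c G x] wt_nonneg[of "\<lambda>z. F z + - c * G z" x] by linarith
      then have "(1 + x\<^sup>2) * wt (\<lambda>z. F z + c * G z) x \<le> (1 + x\<^sup>2) * (2 * wt F x + 2 * (norm c)\<^sup>2 * wt G x)"
        by (intro mult_left_mono) auto
      then show ?thesis by (simp add: algebra_simps)
    qed
    then show "AE x in lborel. norm ((1 + x\<^sup>2) * wt (\<lambda>z. F z + c * G z) x)
        \<le> norm (2 * ((1 + x\<^sup>2) * wt F x) + 2 * (norm c)\<^sup>2 * ((1 + x\<^sup>2) * wt G x))"
    proof (intro AE_I2)
      fix x :: real
      assume le: "\<And>x. (1 + x\<^sup>2) * wt (\<lambda>z. F z + c * G z) x \<le> 2 * ((1 + x\<^sup>2) * wt F x) + 2 * (norm c)\<^sup>2 * ((1 + x\<^sup>2) * wt G x)"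
      have "0 \<le> (1 + x\<^sup>2) * wt (\<lambda>z. F z + c * G z) x" by (intro mult_nonneg_nonneg wt_nonneg) simp
      then show "norm ((1 + x\<^sup>2) * wt (\<lambda>z. F z + c * G z) x)
        \<le> norm (2 * ((1 + x\<^sup>2) * wt F x) + 2 * (norm c)\<^sup>2 * ((1 + x\<^sup>2) * wt G x))"
        unfolding real_norm_def using le[of x] by linarith
    qed
  qed
  then show ?thesis using ad by (simp add: Dom_def)
qed

text \<open>A continuous non-negative integrand with integral 0 vanishes identically. The factor (x
  - a)^2 can hide a value of F at the single point a, which is recovered by analytic continuation
  from the half-line to its right.\<close>

lemma wt_integral_zero_imp_zero:
  assumes F: "F holomorphic_on UNIV" and z: "(\<integral>\<^sup>+ x. ennreal ((x - a)\<^sup>2 * wt F x) \<partial>lborel) = 0"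
  shows "F = (\<lambda>_. 0)"
proof
  fix w
  let ?g = "\<lambda>x. (x - a)\<^sup>2 * wt F x"
  have cont: "continuous_on UNIV ?g" 
    by (rule continuous_on_mult[OF _ continuous_on_wt[OF F]]) (intro continuous_intros)
  then have m: "?g \<in> borel_measurable lborel" unfolding measurable_lborel2 by (rule borel_measurable_continuous_onI)
  have "AE x in lborel. ennreal (?g x) = 0"
    using z nn_integral_0_iff_AE[OF measurable_compose[OF m measurable_ennreal]] by simp
  then have "AE x in lborel. \<not> (?g x \<noteq> 0)"
  proof eventually_elim
    case (elim x)
    have "0 \<le> ?g x" by (intro mult_nonneg_nonneg wt_nonneg) simp
    then show ?case using elim by (simp only: ennreal_eq_0_iff)
  qed
  moreover have op: "open {x. ?g x \<noteq> 0}" by (rule open_Collect_neq[OF cont continuous_on_const])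
  ultimately have "{x. ?g x \<noteq> 0} \<in> null_sets lborel"
    using op by (subst AE_iff_null_sets) simp_all
  then have "negligible {x. ?g x \<noteq> 0}"
    by (simp add: negligible_iff_null_sets null_sets_completionI)
  then have "{x. ?g x \<noteq> 0} = {}" using open_not_negligible[OF op] by blast
  then have zero: "F (complex_of_real x) = 0" if "x \<noteq> a" for x
    using that E_real_nonzero[of x] by (auto simp: wt_def)
  show "F w = 0"
  proof (rule analytic_continuation[OF F])
    have "complex_of_real a islimpt complex_of_real ` {a<..}"
      unfolding islimpt_approachable
    proof (intro allI impI)
      fix e :: real assume "e > 0"
      then show "\<exists>x'\<in>complex_of_real ` {a<..}. x' \<noteq> complex_of_real a \<and> dist x' (complex_of_real a) < e"
      proof (intro bexI[of _ "complex_of_real (a + e / 2)"])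
        show "complex_of_real (a + e / 2) \<in> complex_of_real ` {a<..}" using \<open>e > 0\<close> by (intro imageI) simp
      qed (auto simp: dist_norm)
    qed
    then show "complex_of_real a islimpt complex_of_real ` {a<..}" .
  qed (use zero in auto)
qed

end

subsection \<open>The ground state\<close>

context rotated_hermite_biehler
begin

text \<open>G / E equals \<kappa> (A / E) / (z^2 - \<xi>^2), where A / E is bounded. Dividing
  numerator and denominator by (z + i)^2 makes both bounded in the half-plane.\<close>

lemma A_quotient_bounded_type:
  fixes \<xi> :: real
  assumes G: "G holomorphic_on UNIV" and eq: "\<And>z. G z * (z\<^sup>2 - (complex_of_real \<xi>)\<^sup>2) = \<kappa> * A z"
  shows "bounded_type (\<lambda>z. G z / E z)"
  unfolding bounded_type_def
proof (intro exI conjI ballI)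
  let ?g = "\<lambda>z. (z\<^sup>2 - (complex_of_real \<xi>)\<^sup>2) / (z + \<i>)\<^sup>2" and ?f = "\<lambda>z. \<kappa> * (A z / E z) / (z + \<i>)\<^sup>2"
  have nz: "z + \<i> \<noteq> 0" if "z \<in> UHP" for z using that by (auto simp: UHP_def complex_eq_iff)
  have n1: "1 \<le> norm (z + \<i>)" "norm z \<le> norm (z + \<i>)" if "z \<in> UHP" for z
  proof -
    have y: "Im z > 0" using that by (simp add: UHP_def)
    have *: "(norm (z + \<i>))\<^sup>2 = (norm z)\<^sup>2 + 2 * Im z + 1"
      unfolding cmod_power2 by (simp add: power2_eq_square algebra_simps)
    have "1\<^sup>2 \<le> (norm (z + \<i>))\<^sup>2" using y unfolding * one_power2 by simp
    then show "1 \<le> norm (z + \<i>)" by (rule power2_le_imp_le) simp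
    have "(norm z)\<^sup>2 \<le> (norm (z + \<i>))\<^sup>2" using y unfolding * by simp
    then show "norm z \<le> norm (z + \<i>)" by (rule power2_le_imp_le) simp
  qed
  show "?f holomorphic_on UHP"
    using nz E_nonzero by (intro holomorphic_intros A_holomorphic_on E_holomorphic_on) (auto simp: UHP_def)
  show "?g holomorphic_on UHP" using nz by (intro holomorphic_intros) auto
  show "bounded (?f ` UHP)"
    unfolding bounded_iff
  proof (intro exI ballI)
    fix w assume "w \<in> ?f ` UHP"
    then obtain z where z: "z \<in> UHP" "w = ?f z" by auto
    have "norm w = norm \<kappa> * norm (A z / E z) / (norm (z + \<i>))\<^sup>2"
      by (simp add: z(2) norm_mult norm_divide norm_power)
    also have "\<dots> \<le> norm \<kappa> * 1 / 1"
      using norm_A_over_E_le[of z] n1(1)[OF z(1)] z(1)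
      by (intro frac_le mult_left_mono mult_nonneg_nonneg) (auto simp: UHP_def one_le_power)
    finally show "norm w \<le> norm \<kappa>" by simp
  qed
  show "bounded (?g ` UHP)"
    unfolding bounded_iff
  proof (intro exI ballI)
    fix w assume "w \<in> ?g ` UHP"
    then obtain z where z: "z \<in> UHP" "w = ?g z" by auto
    have p1: "1 \<le> (norm (z + \<i>))\<^sup>2" using n1[OF z(1)] by (simp add: one_le_power)
    have "norm (z\<^sup>2 - (complex_of_real \<xi>)\<^sup>2) \<le> (norm z)\<^sup>2 + \<xi>\<^sup>2"
      using norm_triangle_ineq4[of "z\<^sup>2" "(complex_of_real \<xi>)\<^sup>2"] by (simp add: norm_power)
    also have "(norm z)\<^sup>2 \<le> (norm (z + \<i>))\<^sup>2" using n1[OF z(1)] by (intro power_mono) auto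
    also have "\<xi>\<^sup>2 \<le> \<xi>\<^sup>2 * (norm (z + \<i>))\<^sup>2" using p1 by (simp add: mult_le_cancel_left1)
    finally have "norm (z\<^sup>2 - (complex_of_real \<xi>)\<^sup>2) \<le> (1 + \<xi>\<^sup>2) * (norm (z + \<i>))\<^sup>2" by (simp add: distrib_right)
    then show "norm w \<le> 1 + \<xi>\<^sup>2" using p1 by (simp add: z(2) norm_divide norm_power divide_le_eq)
  qed
  have iU: "\<i> * (\<bar>\<xi>\<bar> + 1) \<in> UHP" by (simp add: UHP_def)
  have "(\<i> * complex_of_real (\<bar>\<xi>\<bar> + 1))\<^sup>2 - (complex_of_real \<xi>)\<^sup>2 = complex_of_real (- ((\<bar>\<xi>\<bar> + 1)\<^sup>2 + \<xi>\<^sup>2))"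
    by (simp add: power_mult_distrib)
  moreover have "- ((\<bar>\<xi>\<bar> + 1)\<^sup>2 + \<xi>\<^sup>2) \<noteq> 0"
    using zero_less_power[of "\<bar>\<xi>\<bar> + 1" 2] zero_le_power2[of \<xi>] by linarith
  ultimately have "(\<i> * complex_of_real (\<bar>\<xi>\<bar> + 1))\<^sup>2 - (complex_of_real \<xi>)\<^sup>2 \<noteq> 0"
    by (simp only: of_real_eq_0_iff not_False_eq_True)
  then show "\<exists>z\<in>UHP. ?g z \<noteq> 0"
    using nz[OF iU] by (intro bexI[OF _ iU]) (simp only: divide_eq_0_iff power_eq_0_iff, simp)
  show "G z / E z * ?g z = ?f z" if "z \<in> UHP" for z
  proof -
    have "G z / E z * ?g z = (G z * (z\<^sup>2 - (complex_of_real \<xi>)\<^sup>2)) / E z / (z + \<i>)\<^sup>2" by simp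
    then show ?thesis unfolding eq by simp
  qed
qed

text \<open>At z = i y the divisor z^2 - \<xi>^2 has modulus y^2 + \<xi>^2, so |G / E| \<le> 1 as
  soon as y is at least 1 and at least |\<kappa>|.\<close>

lemma A_quotient_mean_type_nonpos:
  fixes \<xi> :: real
  assumes eq: "\<And>z. G z * (z\<^sup>2 - (complex_of_real \<xi>)\<^sup>2) = \<kappa> * A z"
  shows "mean_type_nonpos (\<lambda>z. G z / E z)"
  unfolding mean_type_nonpos_def
proof (rule Limsup_bounded)
  show "\<forall>\<^sub>F y in at_top. ereal (ln (norm (G (\<i> * complex_of_real y) / E (\<i> * complex_of_real y))) / y) \<le> 0"
    using eventually_ge_at_top[of "1 + norm \<kappa>"]
  proof eventually_elim
    case (elim y)
    have y: "y \<ge> 1" "norm \<kappa> \<le> y" using elim norm_ge_zero[of \<kappa>] by linarith+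
    let ?z = "\<i> * complex_of_real y"
    have "?z\<^sup>2 - (complex_of_real \<xi>)\<^sup>2 = complex_of_real (- (y\<^sup>2 + \<xi>\<^sup>2))" by (simp add: power_mult_distrib)
    then have d: "norm (?z\<^sup>2 - (complex_of_real \<xi>)\<^sup>2) = y\<^sup>2 + \<xi>\<^sup>2"
      by (simp only: norm_of_real abs_minus_cancel) (simp add: abs_of_nonneg)
    have "norm (G ?z / E ?z) * norm (?z\<^sup>2 - (complex_of_real \<xi>)\<^sup>2) = norm (G ?z * (?z\<^sup>2 - (complex_of_real \<xi>)\<^sup>2) / E ?z)"
      by (simp only: norm_mult norm_divide times_divide_eq_left)
    also have "\<dots> = norm \<kappa> * norm (A ?z / E ?z)" unfolding eq by (simp add: norm_mult norm_divide)
    also have "\<dots> \<le> norm \<kappa> * 1" using norm_A_over_E_le[of ?z] y by (intro mult_left_mono) auto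
    finally have "norm (G ?z / E ?z) * (y\<^sup>2 + \<xi>\<^sup>2) \<le> y" using y unfolding d by simp
    moreover have "y * 1 \<le> y * y" using y by (intro mult_left_mono) auto
    then have yy: "y \<le> y\<^sup>2 + \<xi>\<^sup>2" using zero_le_power2[of \<xi>] unfolding power2_eq_square[of y] by linarith
    ultimately have "norm (G ?z / E ?z) * (y\<^sup>2 + \<xi>\<^sup>2) \<le> 1 * (y\<^sup>2 + \<xi>\<^sup>2)"
      unfolding mult_1_left by (rule order_trans)
    then have le1: "norm (G ?z / E ?z) \<le> 1" by (rule mult_right_le_imp_le) (use yy y in linarith)
    then have "ln (norm (G ?z / E ?z)) \<le> 0"
      by (cases "norm (G ?z / E ?z) = 0") (auto simp: ln_le_zero_iff)
    then show ?case using y by (simp add: divide_nonpos_pos)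
  qed
qed

lemma A_quotient_admissible:
  fixes \<xi> :: real
  assumes G: "G holomorphic_on UNIV" and eq: "\<And>z. G z * (z\<^sup>2 - (complex_of_real \<xi>)\<^sup>2) = \<kappa> * A z"
  shows "admissible G"
proof -
  have "{z. 0 < Im z} = UHP" by (simp add: UHP_def)
  then show ?thesis
    using bounded_type_imp_hp_growth[OF A_quotient_bounded_type[OF G eq]] quotient_holomorphic_on[OF G]
      mean_type_nonpos_imp_subexp_imag[OF A_quotient_mean_type_nonpos[OF eq]] G
    unfolding admissible_def by simp
qed

end

text \<open>\<open>\<phi>\<close> is kept abstract and \<kappa> is left free, so that every non-zero
  multiple of \<open>\<phi>\<close> is again an instance. What is proved for \<open>\<phi>\<close>
  then covers the whole family of extremal functions.\<close>

locale ground_state = rotated_hermite_biehler +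
  fixes \<xi> :: real and \<phi> :: "complex \<Rightarrow> complex" and \<kappa> :: complex
  assumes xi_pos: "\<xi> > 0" and A_xi: "A (complex_of_real \<xi>) = 0"
    and A_less_xi: "0 < x \<Longrightarrow> x < \<xi> \<Longrightarrow> A (complex_of_real x) \<noteq> 0"
    and phi_holomorphic: "\<phi> holomorphic_on UNIV"
    and phi_eq: "\<phi> z * (z\<^sup>2 - (complex_of_real \<xi>)\<^sup>2) = \<kappa> * A z"
    and kappa_nonzero: "\<kappa> \<noteq> 0" and phi_minus: "\<phi> (- z) = \<phi> z"
begin

lemma star_phi_eq: "star_fun \<phi> z * (z\<^sup>2 - (complex_of_real \<xi>)\<^sup>2) = cnj \<kappa> * A z"
  using arg_cong[OF phi_eq[of "cnj z"], of cnj] by (simp add: star_fun_def A_cnj)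

lemma star_phi_holomorphic: "star_fun \<phi> holomorphic_on UNIV"
  by (rule star_fun_holomorphic[OF phi_holomorphic])

lemma wt_phi: "wt \<phi> x * (\<xi>\<^sup>2 - x\<^sup>2)\<^sup>2 = (norm \<kappa>)\<^sup>2 * (norm (A x / E x))\<^sup>2"
proof -
  have "norm (\<phi> x / E x) * \<bar>\<xi>\<^sup>2 - x\<^sup>2\<bar> = norm (\<phi> x * ((complex_of_real x)\<^sup>2 - (complex_of_real \<xi>)\<^sup>2) / E x)"
  proof -
    have "(complex_of_real x)\<^sup>2 - (complex_of_real \<xi>)\<^sup>2 = complex_of_real (- (\<xi>\<^sup>2 - x\<^sup>2))" by simp
    then have "norm ((complex_of_real x)\<^sup>2 - (complex_of_real \<xi>)\<^sup>2) = \<bar>\<xi>\<^sup>2 - x\<^sup>2\<bar>"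
      by (simp only: norm_of_real abs_minus_cancel)
    then show ?thesis by (simp add: norm_mult norm_divide)
  qed
  also have "\<dots> = norm \<kappa> * norm (A x / E x)" unfolding phi_eq by (simp add: norm_mult norm_divide)
  finally have "(norm (\<phi> x / E x) * \<bar>\<xi>\<^sup>2 - x\<^sup>2\<bar>)\<^sup>2 = (norm \<kappa> * norm (A x / E x))\<^sup>2" by simp
  then show ?thesis by (simp add: wt_def power_mult_distrib)
qed

text \<open>A Hopf-type boundary argument: \<open>(E(-z) - E z) / (2 A z)\<close> has non-positive real part in the upper half-plane,
  so by Harnack it is \<open>O(1/y)\<close> at \<open>\<xi> + \<i> y\<close> and the zero of \<open>A\<close> at \<open>\<xi>\<close> is simple.\<close>
lemma phi_xi_nonzero: "\<phi> (complex_of_real \<xi>) \<noteq> 0"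
proof
  assume zero: "\<phi> (complex_of_real \<xi>) = 0"
  define q where "q z = (E (- z) - E z) / (2 * A z)" for z
  \<comment> \<open>The unit disc around \<xi> + i lies in the upper half-plane and touches the real
    line at \<xi>. The point \<xi> + i y has distance 1 - y from the centre, so Harnack gives |q|
    \<le> 2 |q c| / y there.\<close>
  define c where "c = complex_of_real \<xi> + \<i>"
  have up: "Im z > 0" if "z \<in> ball c 1" for z
    using abs_Im_le_cmod[of "c - z"] that by (simp add: dist_norm c_def)
  have "\<forall>z\<in>ball c 1. Re (q z) \<le> 0"
  proof
    fix z assume "z \<in> ball c 1"
    then have z: "Im z > 0" by (rule up)
    let ?u = "E (- z)" and ?v = "E z"
    have "q z = (?u - ?v) * cnj (?v + ?u) / (norm (?v + ?u))\<^sup>2"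
    proof -
      have "2 * A z = ?v + ?u" by (simp add: A_def)
      then show ?thesis unfolding q_def by (simp only:) (subst complex_div_cnj, rule refl)
    qed
    moreover have "Re ((?u - ?v) * cnj (?v + ?u)) = (norm ?u)\<^sup>2 - (norm ?v)\<^sup>2"
      unfolding cmod_power2 by (simp add: power2_eq_square algebra_simps)
    moreover have "(norm ?u)\<^sup>2 \<le> (norm ?v)\<^sup>2" using E_less[OF z] by (intro power_mono) auto
    ultimately show "Re (q z) \<le> 0" by (simp add: Re_divide_of_real divide_nonpos_nonneg del: of_real_power)
  qed
  moreover have "q holomorphic_on ball c 1"
    unfolding q_def using A_nonzero up
    by (intro holomorphic_on_divide holomorphic_on_diff holomorphic_on_mult holomorphic_on_const
        E_minus_holomorphic_on E_holomorphic_on A_holomorphic_on) auto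
  ultimately have har: "norm (q z) * (1 - dist c z) \<le> norm (q c) * (1 + dist c z)" if "z \<in> ball c 1" for z
    using Harnack_ball[of q c 1 z] that by blast
  define M where "M = 4 * norm (q c) / norm \<kappa>"
  have ev: "norm (E (- (complex_of_real \<xi> + \<i> * complex_of_real y)) - E (complex_of_real \<xi> + \<i> * complex_of_real y))
      \<le> M * (norm (\<phi> (complex_of_real \<xi> + \<i> * complex_of_real y)) * norm (2 * complex_of_real \<xi> + \<i> * complex_of_real y))"
    if y: "0 < y" "y < 1" for y :: real
  proof -
    let ?z = "complex_of_real \<xi> + \<i> * complex_of_real y"
    have "c - ?z = \<i> * complex_of_real (1 - y)" by (simp add: c_def algebra_simps)
    then have d: "dist c ?z = 1 - y" using y unfolding dist_norm by (simp only: norm_mult norm_of_real norm_ii) simp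
    have Az: "A ?z \<noteq> 0" using y by (intro A_nonzero) simp
    have "norm (q ?z) * y \<le> norm (q c) * (2 - y)" using har[of ?z] d y by simp
    also have "\<dots> \<le> norm (q c) * 2" using y by (intro mult_left_mono) auto
    finally have "norm (q ?z) * y * (2 * norm (A ?z)) \<le> norm (q c) * 2 * (2 * norm (A ?z))"
      by (rule mult_right_mono) simp
    moreover have "norm (E (- ?z) - E ?z) = norm (q ?z) * (2 * norm (A ?z))"
      unfolding q_def norm_divide norm_mult using Az by simp
    ultimately have "norm (E (- ?z) - E ?z) * y \<le> 4 * norm (q c) * norm (A ?z)" by (simp only:) (simp add: mult_ac)
    also have "norm (A ?z) = norm (\<phi> ?z) * (y * norm (2 * complex_of_real \<xi> + \<i> * complex_of_real y)) / norm \<kappa>"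
    proof -
      have "?z\<^sup>2 - (complex_of_real \<xi>)\<^sup>2 = \<i> * complex_of_real y * (2 * complex_of_real \<xi> + \<i> * complex_of_real y)"
        by (simp add: power2_eq_square algebra_simps)
      then have "norm (\<kappa> * A ?z) = norm (\<phi> ?z) * (y * norm (2 * complex_of_real \<xi> + \<i> * complex_of_real y))"
        unfolding phi_eq[symmetric] using y by (simp add: norm_mult)
      then show ?thesis using kappa_nonzero by (simp add: norm_mult field_simps)
    qed
    finally have "norm (E (- ?z) - E ?z) * y \<le> (M * (norm (\<phi> ?z) * norm (2 * complex_of_real \<xi> + \<i> * complex_of_real y))) * y"
      by (simp add: M_def mult_ac)
    then show ?thesis using y by simp
  qed
  have evl: "\<forall>\<^sub>F y in at_right 0. norm (E (- (complex_of_real \<xi> + \<i> * complex_of_real y)) - E (complex_of_real \<xi> + \<i> * complex_of_real y))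
      \<le> M * (norm (\<phi> (complex_of_real \<xi> + \<i> * complex_of_real y)) * norm (2 * complex_of_real \<xi> + \<i> * complex_of_real y))"
    using eventually_at_right_real[OF zero_less_one] by (rule eventually_mono) (use ev in auto)
  have tz: "((\<lambda>y. complex_of_real \<xi> + \<i> * complex_of_real y) \<longlongrightarrow> complex_of_real \<xi> + \<i> * complex_of_real 0) (at_right 0)"
    by (intro tendsto_intros)
  have tE: "((\<lambda>y. G (f y)) \<longlongrightarrow> G l) (at_right 0)"
    if "G holomorphic_on UNIV" "(f \<longlongrightarrow> l) (at_right 0)" for G :: "complex \<Rightarrow> complex" and f :: "real \<Rightarrow> complex" and l
    using isCont_tendsto_compose[of l G f] that holomorphic_on_imp_continuous_on[OF that(1)]
    by (auto simp: continuous_on_eq_continuous_at)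
  have "norm (E (- (complex_of_real \<xi> + \<i> * complex_of_real 0)) - E (complex_of_real \<xi> + \<i> * complex_of_real 0))
      \<le> M * (norm (\<phi> (complex_of_real \<xi> + \<i> * complex_of_real 0)) * norm (2 * complex_of_real \<xi> + \<i> * complex_of_real 0))"
  proof (rule tendsto_le[OF _ _ _ evl])
    show "((\<lambda>y. M * (norm (\<phi> (complex_of_real \<xi> + \<i> * complex_of_real y)) * norm (2 * complex_of_real \<xi> + \<i> * complex_of_real y)))
       \<longlongrightarrow> M * (norm (\<phi> (complex_of_real \<xi> + \<i> * complex_of_real 0)) * norm (2 * complex_of_real \<xi> + \<i> * complex_of_real 0))) (at_right 0)"
      by (intro tendsto_mult tendsto_norm tE[OF phi_holomorphic tz] tendsto_const tendsto_add tendsto_of_real tendsto_ident_at)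
    show "((\<lambda>y. norm (E (- (complex_of_real \<xi> + \<i> * complex_of_real y)) - E (complex_of_real \<xi> + \<i> * complex_of_real y)))
       \<longlongrightarrow> norm (E (- (complex_of_real \<xi> + \<i> * complex_of_real 0)) - E (complex_of_real \<xi> + \<i> * complex_of_real 0))) (at_right 0)"
      by (intro tendsto_norm tendsto_diff tE[OF E_holomorphic tz] tE[OF E_holomorphic tendsto_minus[OF tz]])
  qed simp
  \<comment> \<open>In the limit a vanishing \<open>\<phi>\<close> forces E(-\<xi>) = E(\<xi>),
    whereas \<open>A\<close> vanishing at \<xi> means E(-\<xi>) = -E(\<xi>); together they give a
    real zero of E.\<close>
  then have "E (- complex_of_real \<xi>) = E (complex_of_real \<xi>)" using zero by simp
  then have "A (complex_of_real \<xi>) = E (complex_of_real \<xi>)" by (simp add: A_def)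
  then show False using A_xi E_real_nonzero[of \<xi>] by simp
qed

text \<open>This is where the minimality of \<xi> enters. At 0 one has A = E, and negative x follow
  from evenness.\<close>

lemma phi_nonzero: "\<bar>x\<bar> \<le> \<xi> \<Longrightarrow> \<phi> (complex_of_real x) \<noteq> 0"
proof -
  have *: "\<phi> (complex_of_real x) \<noteq> 0" if x: "0 \<le> x" "x \<le> \<xi>" for x
  proof (cases "x = \<xi>")
    case False
    have "A (complex_of_real x) \<noteq> 0"
    proof (cases "x = 0")
      case True
      then show ?thesis using E_real_nonzero[of 0] by (simp add: A_def)
    qed (use A_less_xi x False in auto)
    then show ?thesis using phi_eq[of "complex_of_real x"] kappa_nonzero by auto
  qed (use phi_xi_nonzero in simp)
  assume "\<bar>x\<bar> \<le> \<xi>"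
  then show ?thesis using *[of x] *[of "- x"] phi_minus[of "complex_of_real x"] by (cases "0 \<le> x") auto
qed

text \<open>On the line |A / E| \<le> 1, so \<open>wt \<phi>\<close> decays like x^-4. This puts
  \<open>\<phi>\<close> into \<open>Dom\<close> and also makes \<phi> / E itself integrable, which
  its zero energy relies on.\<close>

lemma wt_phi_bound:
  obtains C where "C \<ge> 0" "\<And>x. (1 + x\<^sup>2)\<^sup>2 * wt \<phi> x \<le> C"
proof -
  have cont: "continuous_on UNIV (\<lambda>x. (1 + x\<^sup>2)\<^sup>2 * wt \<phi> x)"
    by (rule continuous_on_mult[OF _ continuous_on_wt[OF phi_holomorphic]]) (intro continuous_intros)
  have "bounded ((\<lambda>x. (1 + x\<^sup>2)\<^sup>2 * wt \<phi> x) ` {- (2 * \<xi>)..2 * \<xi>})"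
    by (intro compact_imp_bounded compact_continuous_image continuous_on_subset[OF cont]) auto
  then obtain C1 where C1: "C1 > 0" "\<And>x. x \<in> {- (2 * \<xi>)..2 * \<xi>} \<Longrightarrow> norm ((1 + x\<^sup>2)\<^sup>2 * wt \<phi> x) \<le> C1"
    unfolding bounded_pos by auto
  \<comment> \<open>For |x| > 2 \<xi> the summand 1 / (4 \<xi>^2) absorbs the 1 in 1 + x^2; moreover
    x^2 \<le> 2 (x^2 - \<xi>^2) there.\<close>
  define t where "t = 1 / (4 * \<xi>\<^sup>2) + 2"
  have t: "t > 0" using xi_pos by (simp add: t_def add_pos_pos)
  have "(1 + x\<^sup>2)\<^sup>2 * wt \<phi> x \<le> C1 + (t * 2)\<^sup>2 * (norm \<kappa>)\<^sup>2" for x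
  proof (cases "\<bar>x\<bar> \<le> 2 * \<xi>")
    case True
    then have "(1 + x\<^sup>2)\<^sup>2 * wt \<phi> x \<le> C1" using C1(2)[of x] by (simp add: abs_le_iff)
    then show ?thesis by (simp add: add_increasing2)
  next
    case False
    then have "(2 * \<xi>)\<^sup>2 < \<bar>x\<bar>\<^sup>2" using xi_pos by (intro power_strict_mono) auto
    then have x: "4 * \<xi>\<^sup>2 < x\<^sup>2" by (simp add: power_mult_distrib)
    have "1 \<le> x\<^sup>2 / (4 * \<xi>\<^sup>2)" using x xi_pos by (simp add: field_simps)
    then have "1 + x\<^sup>2 \<le> t * x\<^sup>2" 
    proof -
      have "t * x\<^sup>2 = x\<^sup>2 / (4 * \<xi>\<^sup>2) + 2 * x\<^sup>2" by (simp add: t_def distrib_right)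
      then show ?thesis using \<open>1 \<le> x\<^sup>2 / (4 * \<xi>\<^sup>2)\<close> zero_le_power2[of x] by linarith
    qed
    also have "x\<^sup>2 \<le> 2 * (x\<^sup>2 - \<xi>\<^sup>2)"
    proof -
      have "b \<le> 2 * (b - a)" if "4 * a < b" "0 \<le> a" for a b :: real using that by simp
      from this[OF x zero_le_power2] show ?thesis .
    qed
    finally have "1 + x\<^sup>2 \<le> t * (2 * (x\<^sup>2 - \<xi>\<^sup>2))" using t by simp
    then have "(1 + x\<^sup>2)\<^sup>2 \<le> (t * 2 * (x\<^sup>2 - \<xi>\<^sup>2))\<^sup>2" by (intro power_mono) (auto simp: mult.assoc)
    then have "(1 + x\<^sup>2)\<^sup>2 * wt \<phi> x \<le> (t * 2 * (x\<^sup>2 - \<xi>\<^sup>2))\<^sup>2 * wt \<phi> x"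
      using wt_nonneg by (rule mult_right_mono)
    also have "\<dots> = (t * 2)\<^sup>2 * (wt \<phi> x * (\<xi>\<^sup>2 - x\<^sup>2)\<^sup>2)" by (simp only: power_mult_distrib power2_commute[of "x\<^sup>2" "\<xi>\<^sup>2"] mult_ac)
    also have "\<dots> = (t * 2)\<^sup>2 * (norm \<kappa>)\<^sup>2 * (norm (A x / E x))\<^sup>2" unfolding wt_phi by simp
    also have "\<dots> \<le> (t * 2)\<^sup>2 * (norm \<kappa>)\<^sup>2 * 1"
      using norm_A_over_E_le[of "complex_of_real x"] by (intro mult_left_mono power_le_one) auto
    finally show ?thesis using C1 by simp
  qed
  then show thesis using that[of "C1 + (t * 2)\<^sup>2 * (norm \<kappa>)\<^sup>2"] C1 by (simp add: add_nonneg_nonneg)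
qed

lemma phi_in_Dom: "\<phi> \<in> Dom"
proof -
  obtain C where C: "C \<ge> 0" "\<And>x. (1 + x\<^sup>2)\<^sup>2 * wt \<phi> x \<le> C" using wt_phi_bound by blast
  have "integrable lborel (\<lambda>x. (1 + x\<^sup>2) * wt \<phi> x)"
  proof (rule Bochner_Integration.integrable_bound)
    show "integrable lborel (\<lambda>x::real. C * (1 / (1 + x\<^sup>2)))"
      by (intro integrable_mult_right integrable_inverse_1_plus_square_UNIV)
    show "(\<lambda>x. (1 + x\<^sup>2) * wt \<phi> x) \<in> borel_measurable lborel" using measurable_wt[OF phi_holomorphic] by simp
    have "norm ((1 + x\<^sup>2) * wt \<phi> x) \<le> norm (C * (1 / (1 + x\<^sup>2)))" for x
    proof -
      have p: "1 + x\<^sup>2 > 0" by (simp add: add_pos_nonneg)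
      have "(1 + x\<^sup>2) * wt \<phi> x * (1 + x\<^sup>2) \<le> C" using C(2)[of x] by (simp add: power2_eq_square mult_ac)
      then have "(1 + x\<^sup>2) * wt \<phi> x \<le> C / (1 + x\<^sup>2)" using p by (simp add: pos_le_divide_eq)
      then show ?thesis using C(1) p wt_nonneg[of \<phi> x] by (simp add: abs_mult)
    qed
    then show "AE x in lborel. norm ((1 + x\<^sup>2) * wt \<phi> x) \<le> norm (C * (1 / (1 + x\<^sup>2)))" by (intro AE_I2)
  qed
  then show ?thesis
    using A_quotient_admissible[OF phi_holomorphic phi_eq] A_quotient_admissible[OF star_phi_holomorphic star_phi_eq]
    by (simp add: Dom_def)
qed

text \<open>The difference of the squared norm of z F and \<xi>^2 times the squared norm of F, so
  the lower bound on the ratio is non-negativity of this form.\<close>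

definition energy :: "(complex \<Rightarrow> complex) \<Rightarrow> real" where
  "energy F = (LINT x|lborel. (x\<^sup>2 - \<xi>\<^sup>2) * wt F x)"

text \<open>On the real line A = Re E, hence (x^2 - \<xi>^2) |\<phi> / E|^2 = |\<kappa>|^2 Re E /
  (x^2 - \<xi>^2) Re (1 / E) = Re (cnj \<kappa> \<phi> / E) off the points x = \<xi> and x = -\<xi>.
  The integral of \<phi> / E vanishes by analyticity in the half-plane.\<close>

lemma energy_phi: "energy \<phi> = 0"
proof -
  obtain C where C: "C \<ge> 0" "\<And>x. (1 + x\<^sup>2)\<^sup>2 * wt \<phi> x \<le> C" using wt_phi_bound by blast
  have int: "integrable lborel (\<lambda>x. \<phi> (complex_of_real x) / E (complex_of_real x))"
  proof (rule Bochner_Integration.integrable_bound)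
    show "integrable lborel (\<lambda>x::real. sqrt C * (1 / (1 + x\<^sup>2)))"
      by (intro integrable_mult_right integrable_inverse_1_plus_square_UNIV)
    show "(\<lambda>x. \<phi> (complex_of_real x) / E (complex_of_real x)) \<in> borel_measurable lborel"
      unfolding measurable_lborel2
      by (intro borel_measurable_continuous_onI continuous_on_of_real_quotient phi_holomorphic)
    have "norm (\<phi> (complex_of_real x) / E (complex_of_real x)) \<le> norm (sqrt C * (1 / (1 + x\<^sup>2)))" for x
    proof -
      have p: "1 + x\<^sup>2 > 0" by (simp add: add_pos_nonneg)
      have "((1 + x\<^sup>2) * norm (\<phi> (complex_of_real x) / E (complex_of_real x)))\<^sup>2 \<le> C"
        using C(2)[of x] by (simp add: wt_def power_mult_distrib)
      then have "(1 + x\<^sup>2) * norm (\<phi> (complex_of_real x) / E (complex_of_real x)) \<le> sqrt C"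
        by (rule real_le_rsqrt)
      then show ?thesis using C(1) p by (simp add: pos_le_divide_eq mult.commute)
    qed
    then show "AE x in lborel. norm (\<phi> (complex_of_real x) / E (complex_of_real x)) \<le> norm (sqrt C * (1 / (1 + x\<^sup>2)))"
      by (intro AE_I2)
  qed
  have ad: "admissible \<phi>" using phi_in_Dom by (simp add: Dom_def)
  have z: "(LINT x|lborel. \<phi> (complex_of_real x) / E (complex_of_real x)) = 0"
    by (rule integral_eq_0_upper_half_plane[OF quotient_continuous_on quotient_holomorphic_on _ _ int])
       (use ad phi_holomorphic in \<open>auto simp: admissible_def\<close>)
  have pt: "(x\<^sup>2 - \<xi>\<^sup>2) * wt \<phi> x = Re (cnj \<kappa> * (\<phi> (complex_of_real x) / E (complex_of_real x)))"
    if x: "x\<^sup>2 - \<xi>\<^sup>2 \<noteq> 0" for x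
  proof -
    let ?e = "E (complex_of_real x)" and ?p = "\<phi> (complex_of_real x)"
    define d where "d = x\<^sup>2 - \<xi>\<^sup>2"
    have d: "d \<noteq> 0" using x by (simp add: d_def)
    have Ax: "A (complex_of_real x) = complex_of_real (Re ?e)"
      by (simp add: A_def E_minus_real complex_eq_iff)
    have "?p * complex_of_real d = \<kappa> * complex_of_real (Re ?e)"
      using phi_eq[of "complex_of_real x"] by (simp add: Ax d_def)
    then have p: "?p = \<kappa> * complex_of_real (Re ?e / d)" using d by (simp add: field_simps)
    have "wt \<phi> x = (norm \<kappa>)\<^sup>2 * s\<^sup>2 / (norm ?e)\<^sup>2" if "s = Re ?e / d" for s
      unfolding wt_def p that[symmetric] by (simp add: norm_mult norm_divide power_mult_distrib power_divide)
    from this[OF refl] have "d * wt \<phi> x = (norm \<kappa>)\<^sup>2 * (Re ?e / d) * (Re ?e / (norm ?e)\<^sup>2)"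
      using d by (simp add: power2_eq_square[of "Re ?e / d"])
    also have "Re ?e / (norm ?e)\<^sup>2 = Re (1 / ?e)" by (simp add: Re_divide cmod_power2)
    also have "(norm \<kappa>)\<^sup>2 * (Re ?e / d) * Re (1 / ?e) = Re (complex_of_real ((norm \<kappa>)\<^sup>2 * (Re ?e / d)) * (1 / ?e))"
      by (simp only: Re_complex_of_real times_complex.simps Im_complex_of_real mult_zero_left diff_zero)
    also have "complex_of_real ((norm \<kappa>)\<^sup>2 * (Re ?e / d)) * (1 / ?e) = cnj \<kappa> * (?p / ?e)"
      unfolding p by (simp only: of_real_mult complex_norm_square) (simp add: mult_ac)
    finally show ?thesis by (simp add: d_def)
  qed
  have "energy \<phi> = (LINT x|lborel. Re (cnj \<kappa> * (\<phi> (complex_of_real x) / E (complex_of_real x))))"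
    unfolding energy_def
  proof (rule integral_cong_AE)
    show "(\<lambda>x. (x\<^sup>2 - \<xi>\<^sup>2) * wt \<phi> x) \<in> borel_measurable lborel" using measurable_wt[OF phi_holomorphic] by simp
    show "(\<lambda>x. Re (cnj \<kappa> * (\<phi> (complex_of_real x) / E (complex_of_real x)))) \<in> borel_measurable lborel"
      by (intro borel_measurable_integrable integrable_Re integrable_mult_right int)
    have "AE x in lborel. x \<noteq> \<xi>" "AE x in lborel. x \<noteq> - \<xi>" by (rule AE_lborel_singleton)+
    then show "AE x in lborel. (x\<^sup>2 - \<xi>\<^sup>2) * wt \<phi> x = Re (cnj \<kappa> * (\<phi> (complex_of_real x) / E (complex_of_real x)))"
      by eventually_elim (rule pt, simp add: power2_eq_iff)
  qed
  also have "\<dots> = Re (LINT x|lborel. cnj \<kappa> * (\<phi> (complex_of_real x) / E (complex_of_real x)))"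
    by (intro integral_Re integrable_mult_right int)
  also have "(LINT x|lborel. cnj \<kappa> * (\<phi> (complex_of_real x) / E (complex_of_real x))) = cnj \<kappa> * 0"
    unfolding z[symmetric] by (rule integral_mult_right_zero)
  finally show ?thesis by simp
qed

section \<open>The negative part and positivity of the energy\<close>

definition negpart :: "(complex \<Rightarrow> complex) \<Rightarrow> real \<Rightarrow> real \<Rightarrow> real" where
  "negpart F r x = indicator {-\<xi>..\<xi>} x * ((\<xi>\<^sup>2 - x\<^sup>2) * Pois r x * wt F x)"

lemma integrable_negpart:
  assumes F: "F \<in> Dom" and r: "0 \<le> r" "r < 1"
  shows "integrable lborel (negpart F r)"
proof -
  have "integrable lborel (\<lambda>x. indicator {-\<xi>..\<xi>} x *\<^sub>R ((\<xi>\<^sup>2 + 0 * x + (-1) * x\<^sup>2) * Pois r x * wt F x))"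
    by (rule integrable_mult_indicator[OF _ integrable_quadratic_wt_Pois[OF F r]]) simp
  then show ?thesis by (simp add: negpart_def[abs_def])
qed

text \<open>After integration the left-hand side is the energy plus twice the negative part, so for
  zero energy even the absolute integral of (x^2 - \<xi>^2) against the Poisson weight tends to
  0.\<close>

lemma negpart_sum: "\<bar>x\<^sup>2 - \<xi>\<^sup>2\<bar> * Pois r x * wt F x = (x\<^sup>2 - \<xi>\<^sup>2) * Pois r x * wt F x + 2 * negpart F r x"
proof (cases "x \<in> {-\<xi>..\<xi>}")
  case True
  then have "x\<^sup>2 \<le> \<xi>\<^sup>2" by (simp add: abs_le_square_iff[symmetric] abs_le_iff)
  then show ?thesis using True by (simp add: negpart_def abs_if algebra_simps)
next
  case False
  then have "\<not> x\<^sup>2 \<le> \<xi>\<^sup>2" using xi_pos by (simp add: abs_le_square_iff[symmetric] abs_le_iff) auto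
  then show ?thesis using False by (simp add: negpart_def abs_if)
qed

lemma integral_quadratic:
  assumes "F \<in> Dom" "0 \<le> r" "r < 1"
  shows "(LINT x|lborel. (x\<^sup>2 - \<xi>\<^sup>2) * Pois r x * wt F x) = energy F"
    "integrable lborel (\<lambda>x. (x\<^sup>2 - \<xi>\<^sup>2) * Pois r x * wt F x)"
  using Poisson_quadrature[OF assms, of "- \<xi>\<^sup>2" 0 1] integrable_quadratic_wt_Pois[OF assms, of "- \<xi>\<^sup>2" 0 1]
  by (auto simp: energy_def)

text \<open>On [-\<xi>, \<xi>] the weight of F is at most K times that of \<open>\<phi>\<close>.
  With u = \<xi>^2 - x^2, the mass of \<open>Pois r\<close> against \<open>wt \<phi>\<close> is
  independent of r, while with the extra factor u^2 it is at most |\<kappa>|^2 (1 - r^2) pointwise.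
  Setting r = 1 - \<eta>^2 balances the two bounds at order \<eta>.\<close>

lemma integral_negpart_bound:
  assumes F: "F \<in> Dom"
  obtains M where "M \<ge> 0"
    "\<And>\<eta>. 0 < \<eta> \<Longrightarrow> \<eta> \<le> 1 \<Longrightarrow> (LINT x|lborel. negpart F (1 - \<eta>\<^sup>2) x) \<le> M * \<eta>"
proof -
  let ?I = "{-\<xi>..\<xi>}"
  have wp: "wt \<phi> x > 0" if "x \<in> ?I" for x
    using phi_nonzero[of x] that E_real_nonzero[of x] by (auto simp: wt_def abs_le_iff)
  have "continuous_on ?I (\<lambda>x. wt F x / wt \<phi> x)"
    by (rule continuous_on_divide[OF continuous_on_wt[OF Dom_holomorphic[OF F]] continuous_on_wt[OF phi_holomorphic]])
       (use wp in force)
  then have "bounded ((\<lambda>x. wt F x / wt \<phi> x) ` ?I)"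
    by (intro compact_imp_bounded compact_continuous_image) auto
  then obtain K where K: "K > 0" "\<And>x. x \<in> ?I \<Longrightarrow> norm (wt F x / wt \<phi> x) \<le> K" unfolding bounded_pos by auto
  have wF: "wt F x \<le> K * wt \<phi> x" if "x \<in> ?I" for x
    using K(2)[OF that] wp[OF that] by (simp add: abs_le_iff divide_le_eq)
  define L where "L = (LINT x|lborel. wt \<phi> x)"
  have L: "L \<ge> 0" unfolding L_def by (intro integral_nonneg_AE) (simp add: wt_nonneg)
  define M where "M = K * L + K * (norm \<kappa>)\<^sup>2 * \<xi>"
  have "M \<ge> 0" using K L xi_pos by (simp add: M_def)
  moreover have "(LINT x|lborel. negpart F (1 - \<eta>\<^sup>2) x) \<le> M * \<eta>" if \<eta>: "0 < \<eta>" "\<eta> \<le> 1" for \<eta>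
  proof -
    define r where "r = 1 - \<eta>\<^sup>2"
    have r: "0 \<le> r" "r < 1" using \<eta> by (auto simp: r_def power_le_one)
    have r2: "1 - r\<^sup>2 \<le> 2 * \<eta>\<^sup>2"
    proof -
      have "1 - r\<^sup>2 = \<eta>\<^sup>2 * (2 - \<eta>\<^sup>2)" by (simp add: r_def power2_eq_square algebra_simps)
      also have "\<dots> \<le> \<eta>\<^sup>2 * 2" by (intro mult_left_mono) auto
      finally show ?thesis by simp
    qed
    have pt: "negpart F r x \<le> K * \<eta> * (Pois r x * wt \<phi> x) + K * (norm \<kappa>)\<^sup>2 * \<eta> / 2 * indicator ?I x" for x
    proof (cases "x \<in> ?I")
      case False
      then show ?thesis using K \<eta> Pois_nonneg[OF r] wt_nonneg[of \<phi> x] by (simp add: negpart_def)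
    next
      case True
      define u where "u = \<xi>\<^sup>2 - x\<^sup>2"
      have u: "u \<ge> 0" using True by (simp add: u_def abs_le_square_iff[symmetric] abs_le_iff)
      define P where "P = Pois r x * wt \<phi> x"
      have P: "P \<ge> 0" using Pois_nonneg[OF r] wt_nonneg by (simp add: P_def)
      have "u * Pois r x * wt F x \<le> u * Pois r x * (K * wt \<phi> x)"
        using wF[OF True] u Pois_nonneg[OF r, of x] by (intro mult_left_mono) auto
      also have "\<dots> = K * (u * P)" by (simp add: P_def)
      \<comment> \<open>The arithmetic-geometric mean inequality splits u into a constant, paid for
        by the fixed mass of P, and u^2, which turns \<open>wt \<phi>\<close> into |A /
        E|^2.\<close>
      also have "u * P \<le> (\<eta> + u\<^sup>2 / (4 * \<eta>)) * P"
      proof (intro mult_right_mono P)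
        have "0 \<le> (2 * \<eta> - u)\<^sup>2" by simp
        then have "4 * \<eta> * u \<le> 4 * \<eta>\<^sup>2 + u\<^sup>2" by (simp add: power2_eq_square algebra_simps)
        then show "u \<le> \<eta> + u\<^sup>2 / (4 * \<eta>)" using \<eta> by (simp add: field_simps power2_eq_square)
      qed
      also have "\<dots> = \<eta> * P + Pois r x * (wt \<phi> x * u\<^sup>2) / (4 * \<eta>)"
        by (simp add: P_def distrib_right)
      also have "Pois r x * (wt \<phi> x * u\<^sup>2) = (norm \<kappa>)\<^sup>2 * (Pois r x * (norm (A x / E x))\<^sup>2)"
        unfolding u_def wt_phi by simp
      also have "\<dots> \<le> (norm \<kappa>)\<^sup>2 * (2 * \<eta>\<^sup>2)"
        using Pois_mult_A_le[OF r, of x] r2 by (intro mult_left_mono) auto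
      finally have "u * Pois r x * wt F x \<le> K * (\<eta> * P + (norm \<kappa>)\<^sup>2 * (2 * \<eta>\<^sup>2) / (4 * \<eta>))"
        using K \<eta> by (simp add: divide_right_mono)
      also have "\<dots> = K * \<eta> * P + K * (norm \<kappa>)\<^sup>2 * \<eta> / 2"
        using \<eta> by (simp add: field_simps power2_eq_square)
      finally show ?thesis using True by (simp add: negpart_def u_def P_def)
    qed
    have i1: "integrable lborel (\<lambda>x. Pois r x * wt \<phi> x)"
      using integrable_quadratic_wt_Pois[OF phi_in_Dom r, of 1 0 0] by simp
    have L1: "(LINT x|lborel. Pois r x * wt \<phi> x) = L"
      using Poisson_quadrature[OF phi_in_Dom r, of 1 0 0] by (simp add: L_def)
    have i2: "integrable lborel (indicator ?I :: real \<Rightarrow> real)"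
      by (intro integrable_real_indicator) (auto simp: emeasure_lborel_Icc_eq)
    have "(LINT x|lborel. negpart F r x)
        \<le> (LINT x|lborel. K * \<eta> * (Pois r x * wt \<phi> x) + K * (norm \<kappa>)\<^sup>2 * \<eta> / 2 * indicator ?I x)"
      by (intro integral_mono integrable_negpart[OF F r] Bochner_Integration.integrable_add integrable_mult_right i1 i2 pt)
    also have "\<dots> = K * \<eta> * L + K * (norm \<kappa>)\<^sup>2 * \<eta> / 2 * (2 * \<xi>)"
      using xi_pos i1 i2 L1 by (subst Bochner_Integration.integral_add) auto
    also have "\<dots> = M * \<eta>" by (simp add: M_def algebra_simps)
    finally show ?thesis by (simp add: r_def)
  qed
  ultimately show thesis using that by blast
qed

lemma energy_nonneg:
  assumes F: "F \<in> Dom"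
  shows "energy F \<ge> 0"
proof -
  obtain M where M: "M \<ge> 0"
    "\<And>\<eta>. 0 < \<eta> \<Longrightarrow> \<eta> \<le> 1 \<Longrightarrow> (LINT x|lborel. negpart F (1 - \<eta>\<^sup>2) x) \<le> M * \<eta>"
    using integral_negpart_bound[OF F] by blast
  have ge: "energy F \<ge> - (M * \<eta>)" if \<eta>: "0 < \<eta>" "\<eta> \<le> 1" for \<eta>
  proof -
    have r: "0 \<le> 1 - \<eta>\<^sup>2" "1 - \<eta>\<^sup>2 < 1" using \<eta> by (auto simp: power_le_one)
    let ?r = "1 - \<eta>\<^sup>2"
    have "(LINT x|lborel. - negpart F ?r x) \<le> (LINT x|lborel. (x\<^sup>2 - \<xi>\<^sup>2) * Pois ?r x * wt F x)"
    proof (rule integral_mono)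
      show "- negpart F ?r x \<le> (x\<^sup>2 - \<xi>\<^sup>2) * Pois ?r x * wt F x" for x
      proof -
        have "\<bar>(x\<^sup>2 - \<xi>\<^sup>2) * Pois ?r x * wt F x\<bar> = (x\<^sup>2 - \<xi>\<^sup>2) * Pois ?r x * wt F x + 2 * negpart F ?r x"
          unfolding negpart_sum[symmetric] using Pois_nonneg[OF r, of x] wt_nonneg[of F x] by (simp add: abs_mult)
        then show ?thesis by linarith
      qed
    qed (use integrable_negpart[OF F r] integral_quadratic[OF F r] in auto)
    then show ?thesis using M(2)[OF \<eta>] integral_quadratic(1)[OF F r] by simp
  qed
  have lim: "((\<lambda>\<eta>. - (M * \<eta>)) \<longlongrightarrow> - (M * 0)) (at_right 0)" by (intro tendsto_intros)
  have "\<forall>\<^sub>F \<eta> in at_right 0. - (M * \<eta>) \<le> energy F"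
    using eventually_at_right_real[OF zero_less_one] by (rule eventually_mono) (use ge in auto)
  then have "- (M * 0) \<le> energy F" by (rule tendsto_upperbound[OF lim]) simp
  then show ?thesis by simp
qed

section \<open>The null space of the energy\<close>

text \<open>The polynomial (x + \<xi>)^2 vanishes doubly at -\<xi>, and the zero of F handles \<xi>:
  within distance \<epsilon> the weight of F is O(\<epsilon>^2) times that of \<open>\<phi>\<close>,
  whose Poisson mass is fixed. Elsewhere (x + \<xi>)^2 \<le> (1 + 2 \<xi> / \<epsilon>) |x^2 -
  \<xi>^2|, and with zero energy the Poisson integral of the right-hand side is governed by the
  negative part.\<close>

lemma zero_energy_vanishing_imp_zero:
  assumes F: "F \<in> Dom" and e0: "energy F = 0" and Fxi: "F (complex_of_real \<xi>) = 0"
  shows "F = (\<lambda>_. 0)"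
proof -
  note holF = Dom_holomorphic[OF F]
  obtain M where M: "M \<ge> 0"
    "\<And>\<eta>. 0 < \<eta> \<Longrightarrow> \<eta> \<le> 1 \<Longrightarrow> (LINT x|lborel. negpart F (1 - \<eta>\<^sup>2) x) \<le> M * \<eta>"
    using integral_negpart_bound[OF F] by blast
  define H where "H z = (if z = complex_of_real \<xi> then deriv F (complex_of_real \<xi>)
      else (F z - F (complex_of_real \<xi>)) / (z - complex_of_real \<xi>))" for z
  have holH: "H holomorphic_on UNIV" unfolding H_def by (rule pole_lemma_open[OF holF]) simp
  have FH: "F z = (z - complex_of_real \<xi>) * H z" for z by (simp add: H_def Fxi)
  have wH: "wt F x = (x - \<xi>)\<^sup>2 * wt H x" for x
  proof -
    have "complex_of_real x - complex_of_real \<xi> = complex_of_real (x - \<xi>)" by simp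
    then have "norm (complex_of_real x - complex_of_real \<xi>) = \<bar>x - \<xi>\<bar>" by (simp only: norm_of_real)
    then show ?thesis unfolding wt_def FH by (simp add: norm_mult norm_divide power_mult_distrib power_divide)
  qed
  have "continuous_on UNIV (wt \<phi>)" by (rule continuous_on_wt[OF phi_holomorphic])
  then have "isCont (wt \<phi>) \<xi>" by (simp add: continuous_on_eq_continuous_at)
  moreover have wp: "wt \<phi> \<xi> > 0" using phi_xi_nonzero E_real_nonzero[of \<xi>] by (simp add: wt_def)
  ultimately have "\<forall>\<^sub>F x in at \<xi>. wt \<phi> x > 0"
    by (intro order_tendstoD(1)[of "wt \<phi>" "wt \<phi> \<xi>"]) (auto simp: isCont_def)
  then obtain d where d: "d > 0" "\<And>x. x \<noteq> \<xi> \<Longrightarrow> dist x \<xi> < d \<Longrightarrow> wt \<phi> x > 0" unfolding eventually_at by auto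
  \<comment> \<open>The three bounds secure \<open>\<phi>\<close> non-zero on the interval, x +
    \<xi> \<le> 3 \<xi>, and \<epsilon>^2 \<le> 1 for \<epsilon> < \<delta>.\<close>
  define \<delta> where "\<delta> = min (min (d / 2) \<xi>) 1"
  have \<delta>: "\<delta> > 0" "\<delta> \<le> \<xi>" "\<delta> < d" "\<delta> \<le> 1" using d xi_pos by (auto simp: \<delta>_def)
  let ?I = "{\<xi> - \<delta>..\<xi> + \<delta>}"
  have wpos: "wt \<phi> x > 0" if "x \<in> ?I" for x
    using d(2)[of x] wp that \<delta> by (cases "x = \<xi>") (auto simp: dist_real_def abs_le_iff)
  have "continuous_on ?I (\<lambda>x. wt H x / wt \<phi> x)"
    by (rule continuous_on_divide[OF continuous_on_wt[OF holH] continuous_on_wt[OF phi_holomorphic]])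
       (use wpos in force)
  then have "bounded ((\<lambda>x. wt H x / wt \<phi> x) ` ?I)"
    by (intro compact_imp_bounded compact_continuous_image) auto
  then obtain K where K: "K > 0" "\<And>x. x \<in> ?I \<Longrightarrow> norm (wt H x / wt \<phi> x) \<le> K" unfolding bounded_pos by auto
  have wHK: "wt H x \<le> K * wt \<phi> x" if "x \<in> ?I" for x
    using K(2)[OF that] wpos[OF that] by (simp add: abs_le_iff divide_le_eq)
  define L where "L = (LINT x|lborel. wt \<phi> x)"
  define J where "J = (LINT x|lborel. (x + \<xi>)\<^sup>2 * wt F x)"
  have quad: "\<xi>\<^sup>2 + 2 * \<xi> * x + 1 * x\<^sup>2 = (x + \<xi>)\<^sup>2" for x by (simp add: power2_eq_square algebra_simps)
  have Jle: "J \<le> 9 * \<xi>\<^sup>2 * K * \<epsilon>\<^sup>2 * L + (1 + 2 * \<xi> / \<epsilon>) * (2 * (M * \<epsilon>\<^sup>2))" if \<epsilon>: "0 < \<epsilon>" "\<epsilon> < \<delta>" for \<epsilon>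
  proof -
    have \<eta>: "0 < \<epsilon>\<^sup>2" "\<epsilon>\<^sup>2 \<le> 1" using \<epsilon> \<delta> by (auto simp: power_le_one)
    \<comment> \<open>This is \<eta> = \<epsilon>^2 in the negative-part bound, small enough to beat
      the factor 1 / \<epsilon> from the region away from \<xi>.\<close>
    define r where "r = 1 - (\<epsilon>\<^sup>2)\<^sup>2"
    have "(\<epsilon>\<^sup>2)\<^sup>2 \<le> 1" by (rule power_le_one[OF less_imp_le[OF \<eta>(1)] \<eta>(2)])
    moreover have "0 < (\<epsilon>\<^sup>2)\<^sup>2" using \<eta>(1) by (rule zero_less_power)
    ultimately have r: "0 \<le> r" "r < 1" unfolding r_def by linarith+
    have pt: "(x + \<xi>)\<^sup>2 * Pois r x * wt F x \<le> 9 * \<xi>\<^sup>2 * K * \<epsilon>\<^sup>2 * (Pois r x * wt \<phi> x)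
        + (1 + 2 * \<xi> / \<epsilon>) * ((x\<^sup>2 - \<xi>\<^sup>2) * Pois r x * wt F x + 2 * negpart F r x)" for x
    proof -
      have P: "Pois r x \<ge> 0" by (rule Pois_nonneg[OF r])
      have "(x + \<xi>)\<^sup>2 * wt F x \<le> 9 * \<xi>\<^sup>2 * K * \<epsilon>\<^sup>2 * wt \<phi> x + (1 + 2 * \<xi> / \<epsilon>) * (\<bar>x\<^sup>2 - \<xi>\<^sup>2\<bar> * wt F x)"
      proof (cases "\<bar>x - \<xi>\<bar> < \<epsilon>")
        case True
        then have x: "x \<in> ?I" using \<epsilon> by auto
        have "(x + \<xi>)\<^sup>2 \<le> (3 * \<xi>)\<^sup>2" using True \<epsilon> \<delta> by (intro power_mono) auto
        moreover have "(x - \<xi>)\<^sup>2 \<le> \<epsilon>\<^sup>2" using True power_mono[of "\<bar>x - \<xi>\<bar>" \<epsilon> 2] by simp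
        ultimately have "(x + \<xi>)\<^sup>2 * ((x - \<xi>)\<^sup>2 * wt H x) \<le> (3 * \<xi>)\<^sup>2 * (\<epsilon>\<^sup>2 * (K * wt \<phi> x))"
          using wHK[OF x] wt_nonneg by (intro mult_mono) auto
        moreover have "0 \<le> (1 + 2 * \<xi> / \<epsilon>) * (\<bar>x\<^sup>2 - \<xi>\<^sup>2\<bar> * wt F x)"
          using xi_pos \<epsilon> wt_nonneg by (intro mult_nonneg_nonneg add_nonneg_nonneg) auto
        ultimately show ?thesis unfolding wH[of x] by (simp add: power_mult_distrib mult_ac)
      next
        case False
        then have ge: "\<bar>x - \<xi>\<bar> \<ge> \<epsilon>" by simp
        have "\<bar>x + \<xi>\<bar> \<le> \<bar>x - \<xi>\<bar> + 2 * \<xi>" using xi_pos by linarith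
        also have "2 * \<xi> \<le> 2 * \<xi> / \<epsilon> * \<bar>x - \<xi>\<bar>" using ge xi_pos \<epsilon> by (simp add: field_simps)
        finally have "\<bar>x + \<xi>\<bar> \<le> (1 + 2 * \<xi> / \<epsilon>) * \<bar>x - \<xi>\<bar>" by (simp add: distrib_right)
        then have "\<bar>x + \<xi>\<bar> * \<bar>x + \<xi>\<bar> \<le> (1 + 2 * \<xi> / \<epsilon>) * \<bar>x - \<xi>\<bar> * \<bar>x + \<xi>\<bar>" by (rule mult_right_mono) simp
        also have "\<bar>x + \<xi>\<bar> * \<bar>x + \<xi>\<bar> = (x + \<xi>)\<^sup>2" by (simp add: power2_eq_square)
        also have "(1 + 2 * \<xi> / \<epsilon>) * \<bar>x - \<xi>\<bar> * \<bar>x + \<xi>\<bar> = (1 + 2 * \<xi> / \<epsilon>) * \<bar>x\<^sup>2 - \<xi>\<^sup>2\<bar>"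
        proof -
          have "x\<^sup>2 - \<xi>\<^sup>2 = (x - \<xi>) * (x + \<xi>)" by (simp add: power2_eq_square algebra_simps)
          then show ?thesis by (simp add: abs_mult)
        qed
        finally have "(x + \<xi>)\<^sup>2 * wt F x \<le> (1 + 2 * \<xi> / \<epsilon>) * \<bar>x\<^sup>2 - \<xi>\<^sup>2\<bar> * wt F x"
          using wt_nonneg by (rule mult_right_mono)
        moreover have "0 \<le> 9 * \<xi>\<^sup>2 * K * \<epsilon>\<^sup>2 * wt \<phi> x" using K wt_nonneg by simp
        ultimately show ?thesis
          unfolding mult.assoc[of "1 + 2 * \<xi> / \<epsilon>"] by (rule add_increasing[rotated])
      qed
      then have "(x + \<xi>)\<^sup>2 * wt F x * Pois r x
          \<le> (9 * \<xi>\<^sup>2 * K * \<epsilon>\<^sup>2 * wt \<phi> x + (1 + 2 * \<xi> / \<epsilon>) * (\<bar>x\<^sup>2 - \<xi>\<^sup>2\<bar> * wt F x)) * Pois r x"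
        using P by (rule mult_right_mono)
      then show ?thesis unfolding negpart_sum[symmetric] by (simp add: algebra_simps)
    qed
    have i1: "integrable lborel (\<lambda>x. Pois r x * wt \<phi> x)"
      using integrable_quadratic_wt_Pois[OF phi_in_Dom r, of 1 0 0] by simp
    have L1: "(LINT x|lborel. Pois r x * wt \<phi> x) = L"
      using Poisson_quadrature[OF phi_in_Dom r, of 1 0 0] by (simp add: L_def)
    note i2 = integral_quadratic(2)[OF F r] and i3 = integrable_negpart[OF F r]
    have "J = (LINT x|lborel. (x + \<xi>)\<^sup>2 * Pois r x * wt F x)"
      unfolding J_def using Poisson_quadrature[OF F r, of "\<xi>\<^sup>2" "2 * \<xi>" 1] unfolding quad by simp
    also have "\<dots> \<le> (LINT x|lborel. 9 * \<xi>\<^sup>2 * K * \<epsilon>\<^sup>2 * (Pois r x * wt \<phi> x)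
        + (1 + 2 * \<xi> / \<epsilon>) * ((x\<^sup>2 - \<xi>\<^sup>2) * Pois r x * wt F x + 2 * negpart F r x))"
    proof (rule integral_mono[OF _ _ pt])
      show "integrable lborel (\<lambda>x. (x + \<xi>)\<^sup>2 * Pois r x * wt F x)"
        using integrable_quadratic_wt_Pois[OF F r, of "\<xi>\<^sup>2" "2 * \<xi>" 1] unfolding quad .
      show "integrable lborel (\<lambda>x. 9 * \<xi>\<^sup>2 * K * \<epsilon>\<^sup>2 * (Pois r x * wt \<phi> x)
        + (1 + 2 * \<xi> / \<epsilon>) * ((x\<^sup>2 - \<xi>\<^sup>2) * Pois r x * wt F x + 2 * negpart F r x))"
        by (intro Bochner_Integration.integrable_add integrable_mult_right i1 i2 i3)
    qed
    also have "\<dots> = (LINT x|lborel. 9 * \<xi>\<^sup>2 * K * \<epsilon>\<^sup>2 * (Pois r x * wt \<phi> x))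
        + (LINT x|lborel. (1 + 2 * \<xi> / \<epsilon>) * ((x\<^sup>2 - \<xi>\<^sup>2) * Pois r x * wt F x + 2 * negpart F r x))"
      by (intro Bochner_Integration.integral_add Bochner_Integration.integrable_add integrable_mult_right i1 i2 i3)
    also have "(LINT x|lborel. 9 * \<xi>\<^sup>2 * K * \<epsilon>\<^sup>2 * (Pois r x * wt \<phi> x)) = 9 * \<xi>\<^sup>2 * K * \<epsilon>\<^sup>2 * L"
      unfolding L1[symmetric] by (rule integral_mult_right_zero)
    also have "(LINT x|lborel. (1 + 2 * \<xi> / \<epsilon>) * ((x\<^sup>2 - \<xi>\<^sup>2) * Pois r x * wt F x + 2 * negpart F r x))
        = (1 + 2 * \<xi> / \<epsilon>) * (LINT x|lborel. (x\<^sup>2 - \<xi>\<^sup>2) * Pois r x * wt F x + 2 * negpart F r x)"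
      by (rule integral_mult_right_zero)
    also have "(LINT x|lborel. (x\<^sup>2 - \<xi>\<^sup>2) * Pois r x * wt F x + 2 * negpart F r x) = energy F + 2 * (LINT x|lborel. negpart F r x)"
      by (subst Bochner_Integration.integral_add[OF i2 integrable_mult_right[OF i3]]) (simp add: integral_quadratic(1)[OF F r])
    also have "\<dots> = 2 * (LINT x|lborel. negpart F r x)" by (simp add: e0)
    also have "(1 + 2 * \<xi> / \<epsilon>) * (2 * (LINT x|lborel. negpart F r x)) \<le> (1 + 2 * \<xi> / \<epsilon>) * (2 * (M * \<epsilon>\<^sup>2))"
      using M(2)[OF \<eta>] xi_pos \<epsilon> by (intro mult_left_mono add_nonneg_nonneg) (auto simp: r_def)
    finally show ?thesis by simp
  qed
  define c where "c = 9 * \<xi>\<^sup>2 * K * L"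
  have lim: "((\<lambda>\<epsilon>. c * \<epsilon>\<^sup>2 + (\<epsilon> + 2 * \<xi>) * (2 * (M * \<epsilon>))) \<longlongrightarrow> c * 0\<^sup>2 + (0 + 2 * \<xi>) * (2 * (M * 0))) (at_right 0)"
    by (intro tendsto_intros)
  have "\<forall>\<^sub>F \<epsilon> in at_right 0. J \<le> c * \<epsilon>\<^sup>2 + (\<epsilon> + 2 * \<xi>) * (2 * (M * \<epsilon>))"
    using eventually_at_right_real[OF \<delta>(1)]
  proof (rule eventually_mono)
    fix \<epsilon> assume "\<epsilon> \<in> {0<..<\<delta>}"
    then have e: "0 < \<epsilon>" "\<epsilon> < \<delta>" by auto
    have "(1 + 2 * \<xi> / \<epsilon>) * (2 * (M * \<epsilon>\<^sup>2)) = (\<epsilon> + 2 * \<xi>) * (2 * (M * \<epsilon>))"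
      using e by (simp add: field_simps power2_eq_square)
    moreover have "9 * \<xi>\<^sup>2 * K * \<epsilon>\<^sup>2 * L = c * \<epsilon>\<^sup>2" by (simp add: c_def mult_ac)
    ultimately show "J \<le> c * \<epsilon>\<^sup>2 + (\<epsilon> + 2 * \<xi>) * (2 * (M * \<epsilon>))"
      using Jle[OF e] by (simp only:)
  qed
  then have "J \<le> c * 0\<^sup>2 + (0 + 2 * \<xi>) * (2 * (M * 0))" by (rule tendsto_lowerbound[OF lim]) simp
  then have J0: "J \<le> 0" by simp
  have iJ: "integrable lborel (\<lambda>x. (x + \<xi>)\<^sup>2 * wt F x)"
    using integrable_quadratic_wt[OF F, of "\<xi>\<^sup>2" "2 * \<xi>" 1] unfolding quad .
  have "(\<integral>\<^sup>+ x. ennreal ((x - (- \<xi>))\<^sup>2 * wt F x) \<partial>lborel) = ennreal J"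
    unfolding J_def using nn_integral_eq_integral[OF iJ] wt_nonneg by simp
  also have "\<dots> = 0" using J0 by (simp add: ennreal_eq_0_iff)
  finally show ?thesis by (rule wt_integral_zero_imp_zero[OF holF])
qed

lemma energy_parallelogram:
  assumes F: "F \<in> Dom" and G: "G \<in> Dom"
  shows "energy (\<lambda>z. F z + c * G z) + energy (\<lambda>z. F z + - c * G z) = 2 * energy F + 2 * (norm c)\<^sup>2 * energy G"
proof -
  have int: "integrable lborel (\<lambda>x. (x\<^sup>2 - \<xi>\<^sup>2) * wt H x)" if "H \<in> Dom" for H
    using integrable_quadratic_wt[OF that, of "- \<xi>\<^sup>2" 0 1] by simp
  note i1 = int[OF Dom_add_scaled[OF F G, of c]] and i2 = int[OF Dom_add_scaled[OF F G, of "- c"]]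
  have "energy (\<lambda>z. F z + c * G z) + energy (\<lambda>z. F z + - c * G z)
      = (LINT x|lborel. (x\<^sup>2 - \<xi>\<^sup>2) * wt (\<lambda>z. F z + c * G z) x + (x\<^sup>2 - \<xi>\<^sup>2) * wt (\<lambda>z. F z + - c * G z) x)"
    unfolding energy_def by (rule Bochner_Integration.integral_add[OF i1 i2, symmetric])
  also have "\<dots> = (LINT x|lborel. 2 * ((x\<^sup>2 - \<xi>\<^sup>2) * wt F x) + 2 * (norm c)\<^sup>2 * ((x\<^sup>2 - \<xi>\<^sup>2) * wt G x))"
    unfolding distrib_left[symmetric] wt_parallelogram by (simp add: algebra_simps)
  also have "\<dots> = 2 * energy F + 2 * (norm c)\<^sup>2 * energy G"
    unfolding energy_def
    by (subst Bochner_Integration.integral_add[OF integrable_mult_right[OF int[OF F]] integrable_mult_right[OF int[OF G]]])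
       (simp only: integral_mult_right_zero)
  finally show ?thesis .
qed

text \<open>The energies of F + c \<phi> and F - c \<phi> are non-negative and add up to 0 by the
  parallelogram law, so both vanish. The constant c is chosen to make F - c \<phi> vanish at
  \<xi>.\<close>

lemma zero_energy_imp_multiple_of_phi:
  assumes F: "F \<in> Dom" and e0: "energy F = 0"
  obtains c where "F = (\<lambda>z. c * \<phi> z)"
proof -
  define c where "c = F (complex_of_real \<xi>) / \<phi> (complex_of_real \<xi>)"
  have "energy (\<lambda>z. F z + c * \<phi> z) + energy (\<lambda>z. F z + - c * \<phi> z) = 0"
    using energy_parallelogram[OF F phi_in_Dom, of c] e0 energy_phi by simp
  then have "energy (\<lambda>z. F z + - c * \<phi> z) = 0"
    using energy_nonneg[OF Dom_add_scaled[OF F phi_in_Dom, of c]]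
      energy_nonneg[OF Dom_add_scaled[OF F phi_in_Dom, of "- c"]] by linarith
  moreover have "F (complex_of_real \<xi>) + - c * \<phi> (complex_of_real \<xi>) = 0"
    using phi_xi_nonzero by (simp add: c_def)
  ultimately have "(\<lambda>z. F z + - c * \<phi> z) = (\<lambda>_. 0)"
    by (intro zero_energy_vanishing_imp_zero Dom_add_scaled[OF F phi_in_Dom])
  then have "F z = c * \<phi> z" for z by (drule_tac x = z in fun_cong) simp
  then show thesis using that by blast
qed

end

subsection \<open>Norm ratios and the reproducing kernel\<close>

context rotated_hermite_biehler
begin

lemma dB_normsq_eq: "dB_normsq E F = (\<integral>\<^sup>+ x. ennreal (wt F x) \<partial>lborel)"
  by (simp add: dB_normsq_def wt_def norm_divide power_divide)

lemma dB_normsq_times_eq: "dB_normsq E (\<lambda>z. z * F z) = (\<integral>\<^sup>+ x. ennreal (x\<^sup>2 * wt F x) \<partial>lborel)"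
  by (simp add: dB_normsq_def wt_def norm_divide norm_mult power_divide power_mult_distrib)

lemma dB_space_admissible:
  assumes "F \<in> dB_space E"
  shows "admissible F" "admissible (star_fun F)"
proof -
  have F: "F holomorphic_on UNIV" and bt: "bounded_type (\<lambda>z. F z / E z)" "bounded_type (\<lambda>z. star_fun F z / E z)"
    and mt: "mean_type_nonpos (\<lambda>z. F z / E z)" "mean_type_nonpos (\<lambda>z. star_fun F z / E z)"
    using assms by (auto simp: dB_space_def entire_def)
  have U: "{z. 0 < Im z} = UHP" by (simp add: UHP_def)
  show "admissible F"
    using bounded_type_imp_hp_growth[OF bt(1)] quotient_holomorphic_on[OF F] mean_type_nonpos_imp_subexp_imag[OF mt(1)] F
    unfolding admissible_def by (simp add: U)
  show "admissible (star_fun F)"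
    using bounded_type_imp_hp_growth[OF bt(2)] quotient_holomorphic_on[OF star_fun_holomorphic[OF F]]
      mean_type_nonpos_imp_subexp_imag[OF mt(2)] star_fun_holomorphic[OF F]
    unfolding admissible_def by (simp add: U)
qed

lemma dB_normsq_pos:
  assumes F: "F holomorphic_on UNIV" and "F \<noteq> (\<lambda>_. 0)"
  shows "dB_normsq E F \<noteq> 0"
proof
  assume "dB_normsq E F = 0"
  moreover have m: "(\<lambda>x. ennreal (wt F x)) \<in> borel_measurable lborel"
    by (rule measurable_compose[OF measurable_wt[OF F] measurable_ennreal])
  ultimately have "AE x in lborel. ennreal (wt F x) = 0"
    unfolding dB_normsq_eq using nn_integral_0_iff_AE[OF m] by simp
  then have "AE x in lborel. ennreal ((x - 0)\<^sup>2 * wt F x) = 0"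
  proof eventually_elim
    case (elim x)
    then have "wt F x = 0" using wt_nonneg[of F x] by (simp add: ennreal_eq_0_iff)
    then show ?case by simp
  qed
  moreover have "(\<lambda>x. ennreal ((x - 0)\<^sup>2 * wt F x)) \<in> borel_measurable lborel"
    using measurable_wt[OF F] by measurable
  ultimately have "(\<integral>\<^sup>+ x. ennreal ((x - 0)\<^sup>2 * wt F x) \<partial>lborel) = 0"
    using nn_integral_0_iff_AE by blast
  then show False using wt_integral_zero_imp_zero[OF F] assms(2) by blast
qed

lemma dB_space_Dom:
  assumes F: "F \<in> dB_space E" and fin: "dB_normsq E (\<lambda>z. z * F z) \<noteq> \<infinity>"
  shows "F \<in> Dom"
proof -
  note ad = dB_space_admissible[OF F]
  have hol: "F holomorphic_on UNIV" using ad by (simp add: admissible_def)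
  note m = measurable_wt[OF hol]
  have "integrable lborel (wt F)"
    using F m wt_nonneg unfolding dB_space_def dB_normsq_eq
    by (intro integrableI_nonneg) auto
  moreover have "integrable lborel (\<lambda>x. x\<^sup>2 * wt F x)"
    using fin m wt_nonneg unfolding dB_normsq_times_eq
    by (intro integrableI_nonneg) (auto simp: less_top)
  ultimately have "integrable lborel (\<lambda>x. wt F x + x\<^sup>2 * wt F x)" by (rule Bochner_Integration.integrable_add)
  then show ?thesis using ad by (simp add: Dom_def distrib_right)
qed

end

context ground_state
begin

text \<open>With N the squared norm of F, the squared ratio is \<xi>^2 + energy F / N, so comparing
  the ratio with \<xi> amounts to reading off the sign of the energy.\<close>

lemma norm_ratio_Dom:
  assumes F: "F \<in> Dom" and nz: "F \<noteq> (\<lambda>_. 0)"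
  defines "N \<equiv> (LINT x|lborel. wt F x)"
  shows "N > 0" "dB_normsq E F = ennreal N"
    "energy F + \<xi>\<^sup>2 * N \<ge> 0"
    "dB_norm E (\<lambda>z. z * F z) / dB_norm E F = ereal (sqrt ((energy F + \<xi>\<^sup>2 * N) / N))"
proof -
  have iN: "integrable lborel (wt F)" using integrable_quadratic_wt[OF F, of 1 0 0] by simp
  have iZ: "integrable lborel (\<lambda>x. x\<^sup>2 * wt F x)" using integrable_quadratic_wt[OF F, of 0 0 1] by simp
  define Z where "Z = (LINT x|lborel. x\<^sup>2 * wt F x)"
  show nN: "dB_normsq E F = ennreal N"
    unfolding dB_normsq_eq N_def using nn_integral_eq_integral[OF iN] wt_nonneg by simp
  have nZ: "dB_normsq E (\<lambda>z. z * F z) = ennreal Z"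
    unfolding dB_normsq_times_eq Z_def using nn_integral_eq_integral[OF iZ] wt_nonneg by simp
  have N0: "N \<ge> 0" unfolding N_def by (intro integral_nonneg_AE) (simp add: wt_nonneg)
  have Z0: "Z \<ge> 0" unfolding Z_def by (intro integral_nonneg_AE) (simp add: wt_nonneg)
  show Np: "N > 0"
    using dB_normsq_pos[OF Dom_holomorphic[OF F] nz] N0 unfolding nN by (cases "N = 0") auto
  have "energy F = (LINT x|lborel. x\<^sup>2 * wt F x - \<xi>\<^sup>2 * wt F x)"
    unfolding energy_def by (simp add: left_diff_distrib)
  also have "\<dots> = Z - \<xi>\<^sup>2 * N"
    unfolding Z_def N_def using iZ iN by (subst Bochner_Integration.integral_diff) auto
  finally have Ze: "energy F + \<xi>\<^sup>2 * N = Z" by simp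
  show "energy F + \<xi>\<^sup>2 * N \<ge> 0" using Ze Z0 by simp
  have "dB_norm E (\<lambda>z. z * F z) / dB_norm E F = ereal (sqrt Z) / ereal (sqrt N)"
    unfolding dB_norm_def nN nZ using N0 Z0 by simp
  also have "\<dots> = ereal (sqrt Z / sqrt N)" using Np by simp
  finally show "dB_norm E (\<lambda>z. z * F z) / dB_norm E F = ereal (sqrt ((energy F + \<xi>\<^sup>2 * N) / N))"
    unfolding Ze by (simp add: real_sqrt_divide)
qed

lemma norm_ratio_infinite:
  assumes F: "F \<in> dB_space E" "F \<noteq> (\<lambda>_. 0)" and inf: "dB_normsq E (\<lambda>z. z * F z) = \<infinity>"
  shows "dB_norm E (\<lambda>z. z * F z) / dB_norm E F = \<infinity>"
proof -
  have "dB_normsq E F \<noteq> 0"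
    using dB_space_admissible(1)[OF F(1)] F(2) by (intro dB_normsq_pos) (auto simp: admissible_def)
  moreover have "dB_normsq E F < \<infinity>" using F(1) by (simp add: dB_space_def)
  ultimately have "enn2real (dB_normsq E F) > 0" by (simp add: enn2real_positive_iff zero_less_iff_neq_zero)
  then show ?thesis using inf \<open>dB_normsq E F < \<infinity>\<close> by (simp add: dB_norm_def divide_ereal_def)
qed

lemma norm_ratio_ge:
  assumes F: "F \<in> dB_space E" "F \<noteq> (\<lambda>_. 0)"
  shows "ereal \<xi> \<le> dB_norm E (\<lambda>z. z * F z) / dB_norm E F"
proof (cases "dB_normsq E (\<lambda>z. z * F z) = \<infinity>")
  case True
  then show ?thesis using norm_ratio_infinite[OF F] by simp
next
  case False
  have D: "F \<in> Dom" by (rule dB_space_Dom[OF F(1) False])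
  note r = norm_ratio_Dom[OF D F(2)]
  define N where "N = (LINT x|lborel. wt F x)"
  have "\<xi>\<^sup>2 \<le> (energy F + \<xi>\<^sup>2 * N) / N"
    using r(1) energy_nonneg[OF D] by (simp add: N_def field_simps)
  then have "\<xi> \<le> sqrt ((energy F + \<xi>\<^sup>2 * N) / N)" by (rule real_le_rsqrt)
  then show ?thesis unfolding r(4) N_def by simp
qed

lemma norm_ratio_eq_imp:
  assumes F: "F \<in> dB_space E" "F \<noteq> (\<lambda>_. 0)"
    and eq: "dB_norm E (\<lambda>z. z * F z) / dB_norm E F = ereal \<xi>"
  obtains c where "c \<noteq> 0" "F = (\<lambda>z. c * \<phi> z)"
proof -
  have "dB_normsq E (\<lambda>z. z * F z) \<noteq> \<infinity>" using norm_ratio_infinite[OF F] eq by auto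
  then have D: "F \<in> Dom" by (rule dB_space_Dom[OF F(1)])
  note r = norm_ratio_Dom[OF D F(2)]
  define N where "N = (LINT x|lborel. wt F x)"
  have N: "N > 0" using r(1) by (simp add: N_def)
  have "sqrt ((energy F + \<xi>\<^sup>2 * N) / N) = \<xi>" using eq unfolding r(4) N_def by simp
  then have "(sqrt ((energy F + \<xi>\<^sup>2 * N) / N))\<^sup>2 = \<xi>\<^sup>2" by simp
  moreover have "(energy F + \<xi>\<^sup>2 * N) / N \<ge> 0" using r(3) N by (simp add: N_def)
  ultimately have "(energy F + \<xi>\<^sup>2 * N) / N = \<xi>\<^sup>2" by simp
  then have "energy F = 0" using N by (simp add: field_simps)
  then obtain c where c: "F = (\<lambda>z. c * \<phi> z)" using zero_energy_imp_multiple_of_phi[OF D] by blast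
  moreover have "c \<noteq> 0" using F(2) c by auto
  ultimately show thesis using that by blast
qed

lemma phi_not_zero: "\<phi> \<noteq> (\<lambda>_. 0)"
  using phi_xi_nonzero by auto

lemma phi_in_dB_space: "\<phi> \<in> dB_space E"
  unfolding dB_space_def entire_def
  using A_quotient_bounded_type[OF phi_holomorphic phi_eq] A_quotient_mean_type_nonpos[OF phi_eq]
    A_quotient_bounded_type[OF star_phi_holomorphic star_phi_eq] A_quotient_mean_type_nonpos[OF star_phi_eq]
    phi_holomorphic norm_ratio_Dom(2)[OF phi_in_Dom phi_not_zero]
  by simp

lemma norm_ratio_phi: "dB_norm E (\<lambda>z. z * \<phi> z) / dB_norm E \<phi> = ereal \<xi>"
  unfolding norm_ratio_Dom(4)[OF phi_in_Dom phi_not_zero] energy_phi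
  using norm_ratio_Dom(1)[OF phi_in_Dom phi_not_zero] xi_pos by simp

lemma ground_state_scaled:
  assumes "c \<noteq> 0"
  shows "ground_state E \<xi> (\<lambda>z. c * \<phi> z) (c * \<kappa>)"
  by unfold_locales
     (use assms xi_pos A_xi A_less_xi phi_holomorphic phi_eq kappa_nonzero phi_minus in
       \<open>auto intro!: holomorphic_intros simp: mult.assoc\<close>)

end

section \<open>From the hypotheses on E and its kernel to the abstract setting\<close>

text \<open>The function G(w) = E(i w) is real on the real line, so it coincides with
  \<open>star_fun G\<close> by the identity theorem; evaluating at w = i z gives the symmetry of
  E.\<close>

lemma rotated_hermite_biehler_of_real_entire:
  assumes HB: "hermite_biehler E" and nz: "\<forall>x::real. E (complex_of_real x) \<noteq> 0"
    and re: "real_entire (\<lambda>z. E (\<i> * z))"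
  shows "rotated_hermite_biehler E"
proof
  show hol: "E holomorphic_on UNIV" using HB by (simp add: hermite_biehler_def entire_def)
  show star: "cnj (E (cnj z)) = E (- z)" for z
  proof -
    define G where "G w = E (\<i> * w)" for w
    have holG: "G holomorphic_on UNIV" using re by (simp add: real_entire_def entire_def G_def[abs_def])
    have "star_fun G w - G w = 0" for w
    proof (rule analytic_continuation[of "\<lambda>w. star_fun G w - G w" UNIV "\<real>" 0])
      show "(\<lambda>w. star_fun G w - G w) holomorphic_on UNIV"
        by (intro holomorphic_on_diff star_fun_holomorphic holG)
      show "(0::complex) islimpt \<real>"
        unfolding islimpt_approachable
      proof (intro allI impI)
        fix e :: real assume "e > 0"
        then show "\<exists>x'\<in>\<real>. x' \<noteq> (0::complex) \<and> dist x' 0 < e"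
          by (intro bexI[of _ "complex_of_real (e / 2)"]) auto
      qed
      show "star_fun G w - G w = 0" if "w \<in> \<real>" for w
      proof -
        have "cnj w = w" using that by (simp add: Reals_cnj_iff)
        moreover have "G w \<in> \<real>" using re that by (auto simp: real_entire_def G_def elim!: Reals_cases)
        then have "cnj (G w) = G w" by (simp add: Reals_cnj_iff)
        ultimately show ?thesis by (simp add: star_fun_def)
      qed
    qed auto
    from this[of "\<i> * z"] show ?thesis
      by (simp add: star_fun_def G_def flip: mult.assoc)
  qed
  show "norm (E (- z)) < norm (E z)" if "Im z > 0" for z
    using HB that star[of z, symmetric] by (simp add: hermite_biehler_def)
  show "E (complex_of_real x) \<noteq> 0" for x using nz by blast
qed

context rotated_hermite_biehler
begin

lemma star_fun_E: "star_fun E z = E (- z)"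
  by (simp add: star_fun_def E_star)

lemma dB_A_eq: "dB_A E z = A z"
  by (simp add: dB_A_def A_def star_fun_E)

text \<open>As A vanishes at \<xi>, E(-\<xi>) = -E(\<xi>), and the kernel numerator collapses to -2
  E(\<xi>) A(z). The value prescribed at z = \<xi> is the derivative that fills the removable
  singularity.\<close>

lemma dB_kernel_real:
  fixes \<xi> :: real
  assumes A0: "A (complex_of_real \<xi>) = 0"
  shows "dB_kernel E (complex_of_real \<xi>) holomorphic_on UNIV"
    and "dB_kernel E (complex_of_real \<xi>) z * (z - complex_of_real \<xi>) = E (complex_of_real \<xi>) / (pi * \<i>) * A z"
proof -
  let ?x = "complex_of_real \<xi>"
  define N where "N z = E z * star_fun E ?x - star_fun E z * E ?x" for z
  have Ex: "E (- ?x) = - E ?x" using A0 by (simp add: A_def add_eq_0_iff)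
  have NA: "N z = - 2 * E ?x * A z" for z
    by (simp add: N_def star_fun_E Ex A_def algebra_simps)
  have Nx: "N ?x = 0" by (simp add: NA A0)
  have holS: "star_fun E holomorphic_on UNIV" by (rule star_fun_holomorphic[OF E_holomorphic])
  have holN: "N holomorphic_on UNIV"
    unfolding N_def by (intro holomorphic_intros E_holomorphic holS)
  have dN: "deriv N ?x = deriv E ?x * star_fun E ?x - deriv (star_fun E) ?x * E ?x"
  proof (rule DERIV_imp_deriv)
    have 1: "(E has_field_derivative deriv E ?x) (at ?x)"
      by (rule holomorphic_derivI[OF E_holomorphic]) auto
    have 2: "(star_fun E has_field_derivative deriv (star_fun E) ?x) (at ?x)"
      by (rule holomorphic_derivI[OF holS]) auto
    show "(N has_field_derivative deriv E ?x * star_fun E ?x - deriv (star_fun E) ?x * E ?x) (at ?x)"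
      unfolding N_def[abs_def] using DERIV_diff[OF DERIV_cmult_right[OF 1] DERIV_cmult_right[OF 2]] .
  qed
  have K: "dB_kernel E ?x z = - 1 / (2 * pi * \<i>) * (if z = ?x then deriv N ?x else (N z - N ?x) / (z - ?x))" for z
  proof (cases "z = ?x")
    case True
    then have "dB_kernel E ?x z = (deriv (star_fun E) ?x * E ?x - deriv E ?x * star_fun E ?x) / (2 * pi * \<i>)"
      by (simp add: dB_kernel_def)
    also have "(b - a) / d = - 1 / d * (a - b)" for a b d :: complex by (simp add: diff_divide_distrib)
    finally show ?thesis using True by (simp only: dN refl if_True)
  next
    case False
    have "dB_kernel E ?x z = N z / (2 * pi * \<i> * (?x - z))"
      using False by (simp add: dB_kernel_def N_def)
    also have "n / (d * (x - w)) = - 1 / d * (n / (w - x))" for n d x w :: complex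
      by (subst minus_diff_eq[of w x, symmetric]) (simp only: mult_minus_right divide_minus_right
          minus_divide_left times_divide_times_eq mult_minus_left mult_1_left)
    finally show ?thesis using False by (simp add: Nx)
  qed
  have "(\<lambda>z. - 1 / (2 * pi * \<i>) * (if z = ?x then deriv N ?x else (N z - N ?x) / (z - ?x))) holomorphic_on UNIV"
    by (intro holomorphic_on_mult holomorphic_on_const pole_lemma_open[OF holN]) simp
  then show "dB_kernel E ?x holomorphic_on UNIV" unfolding K[abs_def, symmetric] by (simp add: K[symmetric])
  show "dB_kernel E ?x z * (z - ?x) = E ?x / (pi * \<i>) * A z"
  proof (cases "z = ?x")
    case True
    then show ?thesis by (simp add: A0)
  next
    case False
    then have "dB_kernel E ?x z * (z - ?x) = - 1 / (2 * pi * \<i>) * N z" unfolding K by (simp add: Nx)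
    then show ?thesis by (simp add: NA)
  qed
qed

end

theorem theorem14:
  fixes E :: "complex \<Rightarrow> complex" and \<xi>0 :: real
  assumes HB: "hermite_biehler E"
    and no_real_zeros: "\<forall>x::real. E (complex_of_real x) \<noteq> 0"
    and rot_real: "real_entire (\<lambda>z. E (\<i> * z))"
    and xi_pos: "\<xi>0 > 0"
    and xi_zero: "dB_A E (complex_of_real \<xi>0) = 0"
    and xi_smallest: "\<forall>x::real. 0 < x \<and> x < \<xi>0 \<longrightarrow> dB_A E (complex_of_real x) \<noteq> 0"
  shows "Inf {dB_norm E (\<lambda>z. z * F z) / dB_norm E F | F. F \<in> dB_space E \<and> F \<noteq> (\<lambda>_. 0)} = ereal \<xi>0
    \<and> {F. F \<in> dB_space E \<and> F \<noteq> (\<lambda>_. 0) \<and> dB_norm E (\<lambda>z. z * F z) / dB_norm E F = ereal \<xi>0}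
      = {(\<lambda>z. c * (dB_kernel E (complex_of_real \<xi>0) z + dB_kernel E (complex_of_real \<xi>0) (- z))) | c. c \<noteq> 0}"
proof -
  interpret rotated_hermite_biehler E
    by (rule rotated_hermite_biehler_of_real_entire[OF HB no_real_zeros rot_real])
  let ?K = "dB_kernel E (complex_of_real \<xi>0)"
  define \<phi> where "\<phi> z = ?K z + ?K (- z)" for z
  have A0: "A (complex_of_real \<xi>0) = 0" using xi_zero by (simp add: dB_A_eq)
  note holK = dB_kernel_real(1)[OF A0] and eqK = dB_kernel_real(2)[OF A0]
  interpret ground_state E \<xi>0 \<phi> "2 * complex_of_real \<xi>0 * (E (complex_of_real \<xi>0) / (pi * \<i>))"
  proof unfold_locales
    show "\<phi> holomorphic_on UNIV"
      unfolding \<phi>_def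
      by (intro holomorphic_on_add holK holomorphic_on_compose_gen[OF _ holK, unfolded o_def]) (auto intro!: holomorphic_intros)
    show "\<phi> z * (z\<^sup>2 - (complex_of_real \<xi>0)\<^sup>2) = 2 * complex_of_real \<xi>0 * (E (complex_of_real \<xi>0) / (pi * \<i>)) * A z" for z
    proof -
      let ?x = "complex_of_real \<xi>0" and ?c = "E (complex_of_real \<xi>0) / (pi * \<i>)"
      \<comment> \<open>Evenness of A makes the two kernels multiples of A / (z - \<xi>) and -A / (z
        + \<xi>) with the same constant, and 1 / (z - \<xi>) - 1 / (z + \<xi>) = 2 \<xi> / (z^2 -
        \<xi>^2).\<close>
      have "\<phi> z * (z\<^sup>2 - ?x\<^sup>2) = (?K z * (z - ?x)) * (z + ?x) - (?K (- z) * (- z - ?x)) * (z - ?x)"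
        by (simp add: \<phi>_def power2_eq_square algebra_simps)
      also have "\<dots> = ?c * A z * (z + ?x) - ?c * A z * (z - ?x)" unfolding eqK A_minus ..
      also have "c * a * (z + x) - c * a * (z - x) = 2 * x * c * a" for a c x :: complex
        by (simp add: algebra_simps)
      finally show ?thesis .
    qed
    show "2 * complex_of_real \<xi>0 * (E (complex_of_real \<xi>0) / (pi * \<i>)) \<noteq> 0"
      using xi_pos no_real_zeros by simp
  qed (use xi_pos A0 xi_smallest in \<open>auto simp: dB_A_eq \<phi>_def\<close>)
  have attained: "(\<lambda>z. c * \<phi> z) \<in> dB_space E \<and> (\<lambda>z. c * \<phi> z) \<noteq> (\<lambda>_. 0)
      \<and> dB_norm E (\<lambda>z. z * (c * \<phi> z)) / dB_norm E (\<lambda>z. c * \<phi> z) = ereal \<xi>0" if "c \<noteq> 0" for c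
  proof -
    \<comment> \<open>A second instance, with the multiple in the role of \<open>\<phi>\<close>,
      yields membership and the value of the ratio at once.\<close>
    interpret sc: ground_state E \<xi>0 "\<lambda>z. c * \<phi> z" "c * (2 * complex_of_real \<xi>0 * (E (complex_of_real \<xi>0) / (pi * \<i>)))"
      by (rule ground_state_scaled[OF that])
    show ?thesis using sc.phi_in_dB_space sc.phi_not_zero sc.norm_ratio_phi by blast
  qed
  let ?R = "{dB_norm E (\<lambda>z. z * F z) / dB_norm E F | F. F \<in> dB_space E \<and> F \<noteq> (\<lambda>_. 0)}"
  have "Inf ?R = ereal \<xi>0"
  proof (rule antisym)
    show "Inf ?R \<le> ereal \<xi>0" using phi_in_dB_space phi_not_zero norm_ratio_phi by (intro Inf_lower) (simp, metis)
    show "ereal \<xi>0 \<le> Inf ?R" using norm_ratio_ge by (intro Inf_greatest) auto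
  qed
  moreover have "{F. F \<in> dB_space E \<and> F \<noteq> (\<lambda>_. 0) \<and> dB_norm E (\<lambda>z. z * F z) / dB_norm E F = ereal \<xi>0}
      = {(\<lambda>z. c * \<phi> z) | c. c \<noteq> 0}"
  proof (intro equalityI subsetI)
    fix F assume "F \<in> {F. F \<in> dB_space E \<and> F \<noteq> (\<lambda>_. 0) \<and> dB_norm E (\<lambda>z. z * F z) / dB_norm E F = ereal \<xi>0}"
    then obtain c where "c \<noteq> 0" "F = (\<lambda>z. c * \<phi> z)" using norm_ratio_eq_imp[of F] by blast
    then show "F \<in> {(\<lambda>z. c * \<phi> z) | c. c \<noteq> 0}" by blast
  next
    fix F assume "F \<in> {(\<lambda>z. c * \<phi> z) | c. c \<noteq> 0}"
    then obtain c where "c \<noteq> 0" "F = (\<lambda>z. c * \<phi> z)" by blast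
    then show "F \<in> {F. F \<in> dB_space E \<and> F \<noteq> (\<lambda>_. 0) \<and> dB_norm E (\<lambda>z. z * F z) / dB_norm E F = ereal \<xi>0}"
      using attained[of c] by simp
  qed
  ultimately show ?thesis by (simp add: \<phi>_def)
qed

end
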